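(* Consider the exponential model and suppose that $\underline{\alpha}+\underline{\beta}>0$. Set $$c_1=\frac{E[(b+\underline{\alpha})^{-2}]}{E[(a-\underline{\alpha})^{-2}]},\qquad c_2=\frac{E[(b-\underline{\beta})^{-2}]}{E[(a+\underline{\beta})^{-2}]}$$ (so that $0\le c_1<c_2\le\infty$). Then the shape function $g$ on $(0,\infty)^2$ satisfies: (a) $g(s,t)=s\,E[(a-\underline{\alpha})^{-1}]+t\,E[(b+\underline{\alpha})^{-1}]$ for $s,t>0$ with $s/t\le c_1$. (b) $g(s,t)=s\,E[(a+\underline{\beta})^{-1}]+t\,E[(b-\underline{\beta})^{-1}]$ for $s,t>0$ with $s/t\ge c_2$. (c) $g(cs_1+(1-c)s_2,\;ct_1+(1-c)t_2)>c\,g(s_1,t_1)+(1-c)\,g(s_2,t_2)$ for all $c\in(0,1)$ and $s_1,s_2,t_1,t_2>0$ such that $c_1<s_1/t_1<c_2$, $c_1<s_2/t_2<c_2$ and $(s_1,t_1)\ne k(s_2,t_2)$ for every $k\in\mathbb{R}$. (d) $g$ is continuously differentiable.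
   Context: $\mathbb{N}=\{1,2,\dots\}$, $\mathbb{Z}_+=\{0,1,2,\dots\}$, $\mathbb{R}_+=[0,\infty)$; $\lfloor x\rfloor$ is the integer part; $x\vee y=\max\{x,y\}$; by convention $1/0=\infty$ and $1/\infty=0$. Environment. Let $\mathbf{a}=(a_n)_{n\in\mathbb{N}}$ and $\mathbf{b}=(b_n)_{n\in\mathbb{N}}$ be stationary random sequences in $(0,\infty)$, and let $\mu$ be the distribution of $(\mathbf{a},\mathbf{b})$. For $k\in\mathbb{Z}_+$ let $\tau_k$ be the shift $(c_n)_{n\in\mathbb{N}}\mapsto(c_{n+k})_{n\in\mathbb{N}}$. It is assumed that $\mu$ is (stationary and) ergodic under the map $\tau_k\times\tau_l:(\mathbf{a},\mathbf{b})\mapsto(\tau_k\mathbf{a},\tau_l\mathbf{b})$ for each $k,l\in\mathbb{N}$. Write $E$ for expectation under $\mu$, $a=a_1$, $b=b_1$, and let $\alpha,\beta$ be the distributions of $a,b$. For a Borel measure $\eta$ on $\mathbb{R}$, $\underline{\eta}$ is the left endpoint of the support of $\eta$. Exponential model. Given $(\mathbf{a},\mathbf{b})$, the weights $W(i,j)$, $i,j\in\mathbb{N}$, are (conditionally) independent and $W(i,j)$ is exponentially distributed with rate $a_i+b_j$. Their conditional joint law (a product measure on $\mathbb{R}_+^{\mathbb{N}^2}$) is $\mathbf{P}_{\mathbf{a},\mathbf{b}}$, and $\mathbb{P}(\cdot)=\int\mathbf{P}_{\mathbf{a},\mathbf{b}}(\cdot)\,\mu(d\mathbf{a},d\mathbf{b})$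 is the joint law of the weights. Last-passage times. $G(i,j)=G(i-1,j)\vee G(i,j-1)+W(i,j)$ for $i,j\in\mathbb{N}$, with $G(i,0)=G(0,j)=0$. Equivalently, $G(m,n)$ is the maximum over all directed paths $\pi$ from $(1,1)$ to $(m,n)$ with steps $(1,0)$ or $(0,1)$ of $\sum_{(i,j)\in\pi}W(i,j)$. Shape function. There is a deterministic function $g:(0,\infty)^2\to[0,\infty]$, called the shape function, such that $\mathbb{P}$-a.s. $\lim_{n\to\infty}G(\lfloor ns\rfloor,\lfloor nt\rfloor)/n=g(s,t)$ for all $s,t>0$. It is finite when $\underline{\alpha}+\underline{\beta}>0$. *)

theory Defs
  imports "HOL-Probability.Probability"
begin

text \<open>
  Index convention: the sequences and the array of weights are indexed from 0 here, so that the
  \<open>n\<close>-th entry stands for \<open>a\<^sub>n\<^sub>+\<^sub>1\<close>, and \<open>W (i, j)\<close> for the weight at the site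
  \<open>(i + 1, j + 1)\<close>.  The last-passage times keep the 1-based indexing, with value 0 on the axes.
\<close>

definition pos_seq :: "(nat \<Rightarrow> real) measure" where
  "pos_seq = PiM UNIV (\<lambda>_. restrict_space borel {0<..})"

type_synonym env = "(nat \<Rightarrow> real) \<times> (nat \<Rightarrow> real)"

definition shift :: "nat \<Rightarrow> (nat \<Rightarrow> real) \<Rightarrow> nat \<Rightarrow> real" where
  "shift k c = (\<lambda>n. c (n + k))"

definition preserves_measure :: "'a measure \<Rightarrow> ('a \<Rightarrow> 'a) \<Rightarrow> bool" where
  "preserves_measure M T \<longleftrightarrow> T \<in> measurable M M \<and> distr M M T = M"

definition ergodic :: "'a measure \<Rightarrow> ('a \<Rightarrow> 'a) \<Rightarrow> bool" where
  "ergodic M T \<longleftrightarrow> preserves_measure M T \<and>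
     (\<forall>A\<in>sets M. T -` A \<inter> space M = A \<longrightarrow> measure M A = 0 \<or> measure M A = 1)"

text \<open>
  The law \<open>\<mu>\<close> of the pair of parameter sequences.  Stationarity under \<open>\<tau>\<^sub>k \<times> \<tau>\<^sub>l\<close> is part of
  \<^const>\<open>ergodic\<close>, and the case \<open>k = l = 1\<close> makes both sequences stationary.
\<close>

definition environment :: "env measure \<Rightarrow> bool" where
  "environment \<mu> \<longleftrightarrow> prob_space \<mu> \<and> sets \<mu> = sets (pos_seq \<Otimes>\<^sub>M pos_seq) \<and>
     (\<forall>k\<ge>1. \<forall>l\<ge>1. ergodic \<mu> (map_prod (shift k) (shift l)))"

definition law_a :: "env measure \<Rightarrow> real measure" where
  "law_a \<mu> = distr \<mu> borel (\<lambda>\<omega>. fst \<omega> 0)"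

definition law_b :: "env measure \<Rightarrow> real measure" where
  "law_b \<mu> = distr \<mu> borel (\<lambda>\<omega>. snd \<omega> 0)"

definition support :: "'a::topological_space measure \<Rightarrow> 'a set" where
  "support \<eta> = {x. \<forall>U. open U \<and> x \<in> U \<longrightarrow> emeasure \<eta> U > 0}"

text \<open>
  Only used for probability measures on the positive half-line, whose support is nonempty and
  bounded below, so the infimum in the type of reals is the genuine one.
\<close>

definition left_endpoint :: "real measure \<Rightarrow> real" where
  "left_endpoint \<eta> = Inf (support \<eta>)"

definition quenched_law :: "env \<Rightarrow> (nat \<times> nat \<Rightarrow> real) measure" where
  "quenched_law \<omega> =
     PiM UNIV (\<lambda>(i, j). density lborel (exponential_density (fst \<omega> i + snd \<omega> j)))"

text \<open>The mixture of the quenched laws with respect to \<open>\<mu>\<close>.\<close>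

definition weight_law :: "env measure \<Rightarrow> (nat \<times> nat \<Rightarrow> real) measure" where
  "weight_law \<mu> = \<mu> \<bind> quenched_law"

fun lpp :: "(nat \<times> nat \<Rightarrow> real) \<Rightarrow> nat \<Rightarrow> nat \<Rightarrow> real" where
  "lpp W 0 j = 0"
| "lpp W (Suc i) 0 = 0"
| "lpp W (Suc i) (Suc j) = max (lpp W i (Suc j)) (lpp W (Suc i) j) + W (i, j)"

text \<open>
  The values of \<open>g\<close> outside the open quadrant are irrelevant.  The weights are almost surely
  nonnegative, so that \<^const>\<open>ennreal\<close> truncates nothing.
\<close>

definition is_shape_function :: "env measure \<Rightarrow> (real \<Rightarrow> real \<Rightarrow> ennreal) \<Rightarrow> bool" where
  "is_shape_function \<mu> g \<longleftrightarrow>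
     (AE W in weight_law \<mu>. \<forall>s>0. \<forall>t>0.
        (\<lambda>n. ennreal (lpp W (nat \<lfloor>real n * s\<rfloor>) (nat \<lfloor>real n * t\<rfloor>) / real n)) \<longlonglongrightarrow> g s t)"

definition continuously_differentiable_on ::
    "('a::real_normed_vector \<Rightarrow> 'b::real_normed_vector) \<Rightarrow> 'a set \<Rightarrow> bool" where
  "continuously_differentiable_on f S \<longleftrightarrow>
     (\<exists>f' :: 'a \<Rightarrow> 'a \<Rightarrow>\<^sub>L 'b. (\<forall>x\<in>S. (f has_derivative blinfun_apply (f' x)) (at x)) \<and>
        continuous_on S f')"

end

theory Submission
  imports Defs "HOL-Real_Asymp.Real_Asymp"
begin

text \<open>
  Let \<open>A z = E (1 / (a + z))\<close>, \<open>B z = E (1 / (b - z))\<close> and \<open>h z = s * A z + t * B z\<close> for \<open>z\<close> strictly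
  between \<open>- \<alpha>\<^sub>0\<close> and \<open>\<beta>\<^sub>0\<close>. The proof identifies \<open>g s t\<close> with the infimum of \<open>h\<close> over this interval
  (\<open>shape_function_variational_formula\<close>); the rest is convexity in the one real variable \<open>z\<close>.

  Upper bound. Put a row and a column of independent boundary weights next to the quadrant,
  exponential with rates \<open>a\<^sub>i + z\<close> on the row and \<open>b\<^sub>j - z\<close> on the column. Burke's property
  (\<open>burke_move_preserves\<close>) says that the increments of the last-passage time of the enlarged
  system along a horizontal line are again independent with rates \<open>a\<^sub>i + z\<close>. The last-passage time is
  then the sum of two families of independent exponential variables, with limit \<open>h z\<close>
  (\<open>slpp_limit_squares\<close>). It dominates the original last-passage time, so \<open>g s t \<le> h z\<close>.

  Lower bound. The last-passage time of the enlarged system is realised by a path that leaves the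
  axes at some point. If it leaves the row at a distance larger than \<open>n * u\<close>, then in the system with
  a parameter \<open>z' < z\<close> the same path collects at least about \<open>n * u * (A z' - A z)\<close> more. Its weight
  is therefore at most about \<open>n * (h z' - u * (A z' - A z))\<close>, which is smaller than \<open>n * h z\<close> when
  \<open>z'\<close> is close to \<open>z\<close> and the derivative of \<open>h\<close> at \<open>z\<close> is nonnegative (\<open>row_exit_gain\<close>). When the
  derivative is nonpositive, late exits from the column are excluded in the same way. At an interior
  zero of the derivative both apply, and \<open>g s t \<ge> h z\<close> up to terms that vanish with \<open>u\<close>. If \<open>h\<close> is
  increasing on the whole interval, exits from the column do occur. But then \<open>z\<close> can be taken close
  to \<open>- \<alpha>\<^sub>0\<close>, and by ergodicity some column of the original system has its rate parameter close to
  \<open>\<alpha>\<^sub>0\<close>. That column is almost as heavy as the boundary column, so the exit takes place inside the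
  original system (\<open>slpp_exit_bound_column\<close>). The decreasing case is symmetric.

  Environment. The sums of \<open>1 / (a\<^sub>i + z)\<close> and \<open>1 / (b\<^sub>j - z)\<close> grow linearly by Birkhoff's theorem for
  bounded functions. Since the limit defining \<open>g\<close> is given, it can be computed along the
  subsequence of squares, where second moments are summable and almost sure convergence is immediate.

  Consequences. The function \<open>h\<close> is strictly convex, and \<open>c\<^sub>1\<close>, \<open>c\<^sub>2\<close> are the values of \<open>s / t\<close> at which
  its derivative vanishes at the left and at the right end of the interval (0 and infinity when the
  derivative is infinite there). Outside \<open>(c\<^sub>1, c\<^sub>2)\<close> the
  infimum sits at an end point, which gives the two linear pieces. Between them the minimiser is
  interior and depends on the direction injectively, which gives strict concavity. The infimum of
  linear functions of \<open>(s, t)\<close> has the gradient \<open>(A \<zeta>, B \<zeta>)\<close> at the minimiser \<open>\<zeta>\<close>, which is continuous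
  because \<open>\<zeta>\<close> is.
\<close>

section \<open>Burke's property at a single site\<close>

definition expo :: "real \<Rightarrow> real measure" where
  "expo r = density lborel (exponential_density r)"

lemma sets_expo [measurable_cong]: "sets (expo r) = sets borel"
  by (simp add: expo_def)

lemma space_expo [simp]: "space (expo r) = UNIV"
  by (simp add: expo_def)

lemma prob_space_expo: "r > 0 \<Longrightarrow> prob_space (expo r)"
  unfolding expo_def by (rule prob_space_exponential_density)

text \<open>
  The passage of a last-passage time across one site: \<open>i\<close> and \<open>j\<close> are the horizontal and vertical
  increments on the incoming edges, \<open>w\<close> is the weight, and the first two components of the result are
  the increments on the outgoing edges. The third component makes the map an involution of the space.
\<close>

definition burke_swap :: "real \<times> real \<times> real \<Rightarrow> real \<times> real \<times> real" where
  "burke_swap = (\<lambda>(i, j, w). (w + max 0 (i - j), w + max 0 (j - i), min i j))"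

lemma nn_integral_lborel_shift:
  fixes f :: "real \<Rightarrow> ennreal"
  assumes [measurable]: "f \<in> borel_measurable borel"
  shows "(\<integral>\<^sup>+x. f (c + x) \<partial>lborel) = (\<integral>\<^sup>+x. f x \<partial>lborel)"
  using nn_integral_real_affine[OF assms, of 1 c] by simp

lemma nn_integral_lborel_swap:
  fixes f :: "real \<Rightarrow> real \<Rightarrow> ennreal"
  assumes "case_prod f \<in> borel_measurable (borel \<Otimes>\<^sub>M borel)"
  shows "(\<integral>\<^sup>+x. \<integral>\<^sup>+y. f x y \<partial>lborel \<partial>lborel) = (\<integral>\<^sup>+y. \<integral>\<^sup>+x. f x y \<partial>lborel \<partial>lborel)"
proof -
  have "case_prod f \<in> borel_measurable (lborel \<Otimes>\<^sub>M lborel)"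
    using assms by (simp cong: measurable_cong_sets)
  from lborel_pair.Fubini[OF this] show ?thesis by simp
qed

abbreviation lborel3 :: "(real \<Rightarrow> real \<Rightarrow> real \<Rightarrow> ennreal) \<Rightarrow> ennreal" where
  "lborel3 f \<equiv> \<integral>\<^sup>+x. \<integral>\<^sup>+y. \<integral>\<^sup>+z. f x y z \<partial>lborel \<partial>lborel \<partial>lborel"

text \<open>
  Tonelli's theorem, in the form in which the integration over the first variable is done first.
\<close>

lemma lborel3_rotate:
  assumes [measurable]: "(\<lambda>(x, y, z). f x y z) \<in> borel_measurable (borel \<Otimes>\<^sub>M borel \<Otimes>\<^sub>M borel)"
  shows "lborel3 f = lborel3 (\<lambda>y z x. f x y z)"
proof -
  have [measurable]: "(\<lambda>x. f (a x) (b x) (c x)) \<in> borel_measurable M"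
    if [measurable]: "a \<in> borel_measurable M" "b \<in> borel_measurable M" "c \<in> borel_measurable M"
    for a b c :: "'x \<Rightarrow> real" and M
    using measurable_compose[of "\<lambda>x. (a x, b x, c x)" M _ _ borel, OF _ assms] by simp
  have "lborel3 f = lborel3 (\<lambda>y x z. f x y z)"
    by (rule nn_integral_lborel_swap) measurable
  also have "\<dots> = lborel3 (\<lambda>y z x. f x y z)"
    by (rule nn_integral_cong, rule nn_integral_lborel_swap) measurable
  finally show ?thesis .
qed

text \<open>
  Lebesgue measure is preserved because on each of the regions \<open>j \<le> i\<close> and \<open>i < j\<close> the map is a
  shear followed by a permutation of the coordinates.
\<close>

lemma burke_swap_lebesgue:
  fixes H :: "real \<times> real \<times> real \<Rightarrow> ennreal"
  assumes [measurable]: "H \<in> borel_measurable (borel \<Otimes>\<^sub>M borel \<Otimes>\<^sub>M borel)"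
  shows "lborel3 (\<lambda>i j w. H (burke_swap (i, j, w))) = lborel3 (\<lambda>i j w. H (i, j, w))"
proof -
  let ?f = "\<lambda>i j w. if j \<le> i then H (w + i - j, w, j) else 0"
  let ?g = "\<lambda>i j w. if i < j then H (w, w + j - i, i) else 0"
  have "H (burke_swap (i, j, w)) = ?f i j w + ?g i j w" for i j w
    by (auto simp: burke_swap_def max_def min_def algebra_simps)
  then have "lborel3 (\<lambda>i j w. H (burke_swap (i, j, w))) = lborel3 ?f + lborel3 ?g"
    by (simp add: nn_integral_add)
  also have "lborel3 ?f = lborel3 (\<lambda>j w i. ?f i j w)"
    by (rule lborel3_rotate) measurable
  also have "\<dots> = lborel3 (\<lambda>j w i. if w \<le> i then H (i, w, j) else 0)"
  proof (rule nn_integral_cong, rule nn_integral_cong)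
    fix j w :: real
    show "(\<integral>\<^sup>+i. ?f i j w \<partial>lborel) = (\<integral>\<^sup>+i. (if w \<le> i then H (i, w, j) else 0) \<partial>lborel)"
      by (subst nn_integral_lborel_shift[of _ "w - j", symmetric])
        (auto intro!: nn_integral_cong simp: algebra_simps)
  qed
  also have "\<dots> = lborel3 (\<lambda>j i w. if w \<le> i then H (i, w, j) else 0)"
    by (rule nn_integral_cong, rule nn_integral_lborel_swap) measurable
  also have "\<dots> = lborel3 (\<lambda>i w j. if w \<le> i then H (i, w, j) else 0)"
    by (rule lborel3_rotate) measurable
  also have "lborel3 ?g = lborel3 (\<lambda>i w j. ?g i j w)"
    by (rule nn_integral_cong, rule nn_integral_lborel_swap) measurable
  also have "\<dots> = lborel3 (\<lambda>i w j. if w < j then H (w, j, i) else 0)"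
  proof (rule nn_integral_cong, rule nn_integral_cong)
    fix i w :: real
    show "(\<integral>\<^sup>+j. ?g i j w \<partial>lborel) = (\<integral>\<^sup>+j. (if w < j then H (w, j, i) else 0) \<partial>lborel)"
      by (subst nn_integral_lborel_shift[of _ "w - i", symmetric])
        (auto intro!: nn_integral_cong simp: algebra_simps)
  qed
  also have "\<dots> = lborel3 (\<lambda>w j i. if w < j then H (w, j, i) else 0)"
    by (rule lborel3_rotate) measurable
  also have "lborel3 (\<lambda>i w j. if w \<le> i then H (i, w, j) else 0) + \<dots> =
      lborel3 (\<lambda>i j w. (if j \<le> i then H (i, j, w) else 0) + (if i < j then H (i, j, w) else 0))"
    by (simp add: nn_integral_add)
  also have "\<dots> = lborel3 (\<lambda>i j w. H (i, j, w))"
    by (intro nn_integral_cong) auto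
  finally show ?thesis .
qed

text \<open>
  The swap leaves both the octant of nonnegative triples and the exponent \<open>x * i + y * j + (x + y) * w\<close>
  invariant, hence also the product density.
\<close>

lemma burke_swap_expo:
  fixes F :: "real \<times> real \<times> real \<Rightarrow> ennreal"
  assumes [measurable]: "F \<in> borel_measurable (borel \<Otimes>\<^sub>M borel \<Otimes>\<^sub>M borel)" and "x > 0" "y > 0"
  shows "(\<integral>\<^sup>+i. \<integral>\<^sup>+j. \<integral>\<^sup>+w. F (burke_swap (i, j, w)) \<partial>expo (x + y) \<partial>expo y \<partial>expo x) =
         (\<integral>\<^sup>+i. \<integral>\<^sup>+j. \<integral>\<^sup>+w. F (i, j, w) \<partial>expo (x + y) \<partial>expo y \<partial>expo x)"
proof -
  define d :: "real \<times> real \<times> real \<Rightarrow> ennreal" where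
    "d = (\<lambda>(i, j, w). ennreal (exponential_density x i * exponential_density y j * exponential_density (x + y) w))"
  have [measurable]: "d \<in> borel_measurable (borel \<Otimes>\<^sub>M borel \<Otimes>\<^sub>M borel)"
    unfolding d_def by measurable
  have [measurable]: "burke_swap \<in> measurable (borel \<Otimes>\<^sub>M borel \<Otimes>\<^sub>M borel) (borel \<Otimes>\<^sub>M borel \<Otimes>\<^sub>M borel)"
    unfolding burke_swap_def by measurable
  have density: "(\<integral>\<^sup>+i. \<integral>\<^sup>+j. \<integral>\<^sup>+w. G (i, j, w) \<partial>expo (x + y) \<partial>expo y \<partial>expo x) =
     lborel3 (\<lambda>i j w. d (i, j, w) * G (i, j, w))"
    if [measurable]: "G \<in> borel_measurable (borel \<Otimes>\<^sub>M borel \<Otimes>\<^sub>M borel)" for G :: "real \<times> real \<times> real \<Rightarrow> ennreal"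
    using assms unfolding expo_def d_def
    by (simp add: nn_integral_density nn_integral_cmult[symmetric] ennreal_mult exponential_density_nonneg
         mult.assoc del: nn_integral_cmult)
  have inv: "d (burke_swap v) = d v" for v
  proof -
    obtain i j w where v: "v = (i, j, w)" by (cases v)
    have *: "exp (- ((w + max 0 (i - j)) * x)) * exp (- ((w + max 0 (j - i)) * y)) * exp (- (min i j * (x + y)))
      = exp (- (i * x)) * exp (- (j * y)) * exp (- (w * (x + y)))"
      by (auto simp: exp_add[symmetric] max_def min_def algebra_simps)
    show ?thesis
    proof (cases "i < 0 \<or> j < 0 \<or> w < 0")
      case True
      then show ?thesis
        unfolding v d_def burke_swap_def exponential_density_def
        by (auto simp: min_def max_def)
    next
      case False
      then have "\<not> w + max 0 (i - j) < 0" "\<not> w + max 0 (j - i) < 0" "\<not> min i j < 0" by auto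
      then have "exponential_density x (w + max 0 (i - j)) = x * exp (- ((w + max 0 (i - j)) * x))"
        "exponential_density y (w + max 0 (j - i)) = y * exp (- ((w + max 0 (j - i)) * y))"
        "exponential_density (x + y) (min i j) = (x + y) * exp (- (min i j * (x + y)))"
        unfolding exponential_density_def by (auto simp: algebra_simps)
      moreover have "exponential_density x i = x * exp (- (i * x))"
        "exponential_density y j = y * exp (- (j * y))"
        "exponential_density (x + y) w = (x + y) * exp (- (w * (x + y)))"
        using False unfolding exponential_density_def by auto
      moreover have "(x * A) * (y * B) * ((x + y) * C) = x * y * (x + y) * (A * B * C)" for A B C :: real
        by simp
      ultimately show ?thesis
        using * unfolding v d_def burke_swap_def by (simp only: prod.case)
    qed
  qed
  have "(\<integral>\<^sup>+i. \<integral>\<^sup>+j. \<integral>\<^sup>+w. F (burke_swap (i, j, w)) \<partial>expo (x + y) \<partial>expo y \<partial>expo x) =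
    lborel3 (\<lambda>i j w. d (i, j, w) * F (burke_swap (i, j, w)))"
    using density[of "\<lambda>v. F (burke_swap v)"] by simp
  also have "\<dots> = lborel3 (\<lambda>i j w. (\<lambda>v. d v * F v) (burke_swap (i, j, w)))"
    by (simp add: inv)
  also have "\<dots> = lborel3 (\<lambda>i j w. d (i, j, w) * F (i, j, w))"
    by (rule burke_swap_lebesgue) measurable
  also have "\<dots> = (\<integral>\<^sup>+i. \<integral>\<^sup>+j. \<integral>\<^sup>+w. F (i, j, w) \<partial>expo (x + y) \<partial>expo y \<partial>expo x)"
    by (simp add: density)
  finally show ?thesis .
qed

definition expo_field :: "('k \<Rightarrow> real) \<Rightarrow> ('k \<Rightarrow> real) measure" where
  "expo_field R = PiM UNIV (\<lambda>k. expo (R k))"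

lemma sets_expo_field [measurable_cong]: "sets (expo_field R) = sets (PiM UNIV (\<lambda>_. borel))"
  unfolding expo_field_def by (intro sets_PiM_cong) (auto simp: sets_expo)

lemma space_expo_field [simp]: "space (expo_field R) = UNIV"
  by (auto simp: expo_field_def space_PiM)

lemma prob_space_expo_field: "(\<And>k. R k > 0) \<Longrightarrow> prob_space (expo_field R)"
  unfolding expo_field_def by (intro prob_space_PiM prob_space_expo)

text \<open>
  Tonelli's theorem for splitting one coordinate off a possibly infinite product.
\<close>

lemma nn_integral_PiM_insert:
  fixes M :: "'k \<Rightarrow> 'a measure"
  assumes M: "\<And>i. prob_space (M i)"
    and [measurable]: "f \<in> borel_measurable (PiM (insert k I) M)"
  shows "(\<integral>\<^sup>+X. f X \<partial>PiM (insert k I) M) = (\<integral>\<^sup>+x. \<integral>\<^sup>+X. f (X(k := x)) \<partial>PiM I M \<partial>M k)"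
proof -
  interpret I: prob_space "PiM I M" using M by (intro prob_space_PiM)
  have m [measurable]: "(\<lambda>(x, X). X(k := x)) \<in> measurable (M k \<Otimes>\<^sub>M PiM I M) (PiM (insert k I) M)"
    by measurable
  have "(\<integral>\<^sup>+X. f X \<partial>PiM (insert k I) M) =
      (\<integral>\<^sup>+X. f X \<partial>distr (M k \<Otimes>\<^sub>M PiM I M) (PiM (insert k I) M) (\<lambda>(x, X). X(k := x)))"
    by (subst distr_pair_PiM_eq_PiM) (auto intro: M)
  also have "\<dots> = (\<integral>\<^sup>+v. f ((snd v)(k := fst v)) \<partial>(M k \<Otimes>\<^sub>M PiM I M))"
    by (subst nn_integral_distr) (auto simp: case_prod_beta)
  also have "\<dots> = (\<integral>\<^sup>+x. \<integral>\<^sup>+X. f (X(k := x)) \<partial>PiM I M \<partial>M k)"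
    by (subst I.nn_integral_fst[symmetric]) (auto simp: case_prod_beta)
  finally show ?thesis .
qed

text \<open>
  The swap acting on three coordinates of a field. Storing the minimum at \<open>r\<close>, where the weight was,
  keeps the index set fixed, so that such moves can be composed on one probability space.
\<close>

definition burke_move :: "'k \<Rightarrow> 'k \<Rightarrow> 'k \<Rightarrow> ('k \<Rightarrow> real) \<Rightarrow> 'k \<Rightarrow> real" where
  "burke_move p q r V =
     V(p := V r + max 0 (V p - V q), q := V r + max 0 (V q - V p), r := min (V p) (V q))"

lemma measurable_burke_move [measurable]:
  "burke_move p q r \<in> measurable (expo_field R) (expo_field R')"
proof -
  have "burke_move p q r \<in> measurable (PiM UNIV (\<lambda>_. borel)) (PiM UNIV (\<lambda>_. borel))"
    unfolding burke_move_def
    by (rule measurable_PiM_single') (auto simp: space_PiM fun_upd_def)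
  then show ?thesis by (simp cong: measurable_cong_sets add: sets_expo_field)
qed

text \<open>
  Burke's property: the outgoing increments at a site have the same joint law as the incoming ones.
  Only three coordinates change, and for these the claim is \<open>burke_swap_expo\<close>.
\<close>

lemma burke_move_preserves:
  fixes R :: "'k \<Rightarrow> real"
  assumes R: "\<And>k. R k > 0" and d: "p \<noteq> q" "q \<noteq> r" "p \<noteq> r" and r: "R r = R p + R q"
  shows "distr (expo_field R) (expo_field R) (burke_move p q r) = expo_field R"
proof (rule measure_eqI)
  fix A assume "A \<in> sets (distr (expo_field R) (expo_field R) (burke_move p q r))"
  then have A [measurable]: "A \<in> sets (expo_field R)" by simp
  define M where "M = (\<lambda>k. expo (R k))"
  define I where "I = UNIV - {p, q, r}"
  have M: "prob_space (M k)" for k unfolding M_def by (rule prob_space_expo[OF R])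
  interpret I: prob_space "PiM I M" using M by (intro prob_space_PiM)
  interpret Mr: prob_space "M r" by (rule M)
  interpret Mq: prob_space "M q" by (rule M)
  have U: "UNIV = insert p (insert q (insert r I))" by (auto simp: I_def)
  have [simp]: "sets (PiM UNIV M) = sets (PiM UNIV (\<lambda>_. borel))"
    unfolding M_def using sets_expo_field[of R] by (simp add: expo_field_def)
  have upd: "(\<lambda>(a, b, c, X). X(r := c, q := b, p := a))
     \<in> measurable (M p \<Otimes>\<^sub>M M q \<Otimes>\<^sub>M M r \<Otimes>\<^sub>M PiM I M) (PiM UNIV M)"
    unfolding U by measurable
  have upd2: "(\<lambda>((a, b, c), X). X(r := c, q := b, p := a))
     \<in> measurable ((borel \<Otimes>\<^sub>M borel \<Otimes>\<^sub>M borel) \<Otimes>\<^sub>M PiM I M) (PiM UNIV M)"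
  proof -
    have "(\<lambda>v. (fst (fst v), fst (snd (fst v)), snd (snd (fst v)), snd v)) \<in> 
      measurable ((borel \<Otimes>\<^sub>M borel \<Otimes>\<^sub>M borel) \<Otimes>\<^sub>M PiM I M) (M p \<Otimes>\<^sub>M M q \<Otimes>\<^sub>M M r \<Otimes>\<^sub>M PiM I M)"
      unfolding M_def by measurable
    from measurable_compose[OF this upd] show ?thesis by (simp add: split_beta')
  qed
  have split: "(\<integral>\<^sup>+V. f V \<partial>PiM UNIV M) =
      (\<integral>\<^sup>+a. \<integral>\<^sup>+b. \<integral>\<^sup>+c. (\<integral>\<^sup>+X. f (X(r := c, q := b, p := a)) \<partial>PiM I M) \<partial>M r \<partial>M q \<partial>M p)"
    if f: "f \<in> borel_measurable (PiM UNIV M)" for f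
  proof -
    note f' = f[unfolded U]
    have "(\<integral>\<^sup>+V. f V \<partial>PiM UNIV M) = (\<integral>\<^sup>+a. \<integral>\<^sup>+X. f (X(p := a)) \<partial>PiM (insert q (insert r I)) M \<partial>M p)"
      unfolding U by (rule nn_integral_PiM_insert[OF M f'])
    also have "\<dots> = (\<integral>\<^sup>+a. \<integral>\<^sup>+b. \<integral>\<^sup>+X. f (X(q := b, p := a)) \<partial>PiM (insert r I) M \<partial>M q \<partial>M p)"
      by (intro nn_integral_cong nn_integral_PiM_insert M measurable_compose[OF _ f']) auto
    also have "\<dots> = (\<integral>\<^sup>+a. \<integral>\<^sup>+b. \<integral>\<^sup>+c. \<integral>\<^sup>+X. f (X(r := c, q := b, p := a)) \<partial>PiM I M \<partial>M r \<partial>M q \<partial>M p)"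
      by (intro nn_integral_cong nn_integral_PiM_insert M measurable_compose[OF _ f']) auto
    finally show ?thesis .
  qed
  define F where "F = (\<lambda>(a, b, c). \<integral>\<^sup>+X. indicator A (X(r := c, q := b, p := a)) \<partial>PiM I M)"
  have A': "A \<in> sets (PiM UNIV M)" using A by (simp add: expo_field_def M_def)
  have F: "F \<in> borel_measurable (borel \<Otimes>\<^sub>M borel \<Otimes>\<^sub>M borel)"
  proof -
    have "(\<lambda>v. indicator A ((\<lambda>((a, b, c), X). X(r := c, q := b, p := a)) v) :: ennreal)
      \<in> borel_measurable ((borel \<Otimes>\<^sub>M borel \<Otimes>\<^sub>M borel) \<Otimes>\<^sub>M PiM I M)"
      by (rule measurable_compose[OF upd2 borel_measurable_indicator[OF A']])
    then have "(\<lambda>v. \<integral>\<^sup>+X. indicator A ((\<lambda>((a, b, c), X). X(r := c, q := b, p := a)) (v, X)) \<partial>PiM I M)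
      \<in> borel_measurable (borel \<Otimes>\<^sub>M borel \<Otimes>\<^sub>M borel)"
      by (rule I.borel_measurable_nn_integral_fst)
    also have "(\<lambda>v. \<integral>\<^sup>+X. indicator A ((\<lambda>((a, b, c), X). X(r := c, q := b, p := a)) (v, X)) \<partial>PiM I M) = F"
      by (auto simp: F_def)
    finally show ?thesis .
  qed
  have "emeasure (distr (expo_field R) (expo_field R) (burke_move p q r)) A =
      (\<integral>\<^sup>+V. indicator A (burke_move p q r V) \<partial>PiM UNIV M)"
    by (subst nn_integral_indicator[symmetric], simp, subst nn_integral_distr)
       (auto simp: expo_field_def[of R, folded M_def] intro!: borel_measurable_indicator[OF A'] measurable_burke_move[of p q r R R, unfolded expo_field_def, folded M_def])
  also have "\<dots> = (\<integral>\<^sup>+a. \<integral>\<^sup>+b. \<integral>\<^sup>+c. (\<integral>\<^sup>+X. indicator A (burke_move p q r (X(r := c, q := b, p := a))) \<partial>PiM I M) \<partial>M r \<partial>M q \<partial>M p)"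
  proof (rule split)
    have "burke_move p q r \<in> measurable (PiM UNIV M) (PiM UNIV M)"
      using measurable_burke_move[of p q r R R] by (simp add: expo_field_def M_def)
    then show "(\<lambda>V. indicator A (burke_move p q r V) :: ennreal) \<in> borel_measurable (PiM UNIV M)"
      by (rule measurable_compose[OF _ borel_measurable_indicator[OF A']])
  qed
  also have "\<dots> = (\<integral>\<^sup>+a. \<integral>\<^sup>+b. \<integral>\<^sup>+c. F (burke_swap (a, b, c)) \<partial>M r \<partial>M q \<partial>M p)"
  proof -
    have "burke_move p q r (X(r := c, q := b, p := a)) =
       (case burke_swap (a, b, c) of (a', b', c') \<Rightarrow> X(r := c', q := b', p := a'))" for X a b c
      using d by (auto simp: burke_move_def burke_swap_def fun_eq_iff)
    then show ?thesis
      unfolding F_def by (intro nn_integral_cong) (simp add: case_prod_beta)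
  qed
  also have "\<dots> = (\<integral>\<^sup>+a. \<integral>\<^sup>+b. \<integral>\<^sup>+c. F (a, b, c) \<partial>M r \<partial>M q \<partial>M p)"
    unfolding M_def r by (rule burke_swap_expo[OF F R R])
  also have "\<dots> = (\<integral>\<^sup>+V. indicator A V \<partial>PiM UNIV M)"
    by (subst split[OF borel_measurable_indicator[OF A']]) (simp add: F_def)
  also have "\<dots> = emeasure (expo_field R) A"
    using A by (simp add: expo_field_def M_def)
  finally show "emeasure (distr (expo_field R) (expo_field R) (burke_move p q r)) A = emeasure (expo_field R) A" .
qed simp

section \<open>Last-passage times with boundary weights\<close>

text \<open>
  Last-passage times of a field whose row 0 and column 0 carry boundary weights. A weight of the
  original quadrant at \<open>(i, j)\<close> sits at \<open>(Suc i, Suc j)\<close> here.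
\<close>

fun slpp :: "(nat \<times> nat \<Rightarrow> real) \<Rightarrow> nat \<Rightarrow> nat \<Rightarrow> real" where
  "slpp V 0 0 = 0"
| "slpp V (Suc i) 0 = slpp V i 0 + V (Suc i, 0)"
| "slpp V 0 (Suc j) = slpp V 0 j + V (0, Suc j)"
| "slpp V (Suc i) (Suc j) = max (slpp V i (Suc j)) (slpp V (Suc i) j) + V (Suc i, Suc j)"

lemma slpp_row_axis: "slpp V m 0 = (\<Sum>i<m. V (Suc i, 0))"
  by (induction m) auto

lemma slpp_column_axis: "slpp V 0 n = (\<Sum>j<n. V (0, Suc j))"
  by (induction n) auto

text \<open>
  The increments along horizontal and vertical edges satisfy the recursion that \<open>burke_swap\<close> encodes.
\<close>

definition hinc :: "(nat \<times> nat \<Rightarrow> real) \<Rightarrow> nat \<Rightarrow> nat \<Rightarrow> real" where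
  "hinc V i j = slpp V (Suc i) j - slpp V i j"

definition vinc :: "(nat \<times> nat \<Rightarrow> real) \<Rightarrow> nat \<Rightarrow> nat \<Rightarrow> real" where
  "vinc V i j = slpp V i (Suc j) - slpp V i j"

lemma hinc_Suc: "hinc V i (Suc j) = V (Suc i, Suc j) + max 0 (hinc V i j - vinc V i j)"
  by (simp add: hinc_def vinc_def max_def)

lemma vinc_Suc: "vinc V (Suc i) j = V (Suc i, Suc j) + max 0 (vinc V i j - hinc V i j)"
  by (simp add: hinc_def vinc_def max_def)

text \<open>
  The sites of a row are processed from left to right, then the rows from bottom to top. The
  coordinate \<open>(Suc i, 0)\<close> always holds the current horizontal increment in column \<open>i\<close>, and \<open>(0, Suc j)\<close>
  the vertical increment that enters the next site of row \<open>j\<close>.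
\<close>

primrec burke_row :: "nat \<Rightarrow> nat \<Rightarrow> (nat \<times> nat \<Rightarrow> real) \<Rightarrow> nat \<times> nat \<Rightarrow> real" where
  "burke_row j 0 V = V"
| "burke_row j (Suc i) V = burke_move (Suc i, 0) (0, Suc j) (Suc i, Suc j) (burke_row j i V)"

primrec burke_rows :: "nat \<Rightarrow> nat \<Rightarrow> (nat \<times> nat \<Rightarrow> real) \<Rightarrow> nat \<times> nat \<Rightarrow> real" where
  "burke_rows m 0 V = V"
| "burke_rows m (Suc j) V = burke_row j m (burke_rows m j V)"

lemma burke_row_slots:
  assumes "\<And>k. k < m \<Longrightarrow> U (Suc k, 0) = hinc V k j" and "U (0, Suc j) = vinc V 0 j"
    and "\<And>k l. l \<ge> j \<Longrightarrow> U (Suc k, Suc l) = V (Suc k, Suc l)" and "i \<le> m"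
  shows "(\<forall>k<m. burke_row j i U (Suc k, 0) = (if k < i then hinc V k (Suc j) else hinc V k j)) \<and>
    burke_row j i U (0, Suc j) = vinc V i j \<and>
    (\<forall>l. l > j \<longrightarrow> burke_row j i U (0, Suc l) = U (0, Suc l)) \<and>
    (\<forall>k l. l > j \<or> l = j \<and> k \<ge> i \<longrightarrow> burke_row j i U (Suc k, Suc l) = V (Suc k, Suc l))"
  using assms(4)
proof (induction i)
  case 0
  then show ?case using assms by auto
next
  case (Suc i)
  then have IH: "\<And>k. k < m \<Longrightarrow> burke_row j i U (Suc k, 0) = (if k < i then hinc V k (Suc j) else hinc V k j)"
    "burke_row j i U (0, Suc j) = vinc V i j"
    "\<And>l. l > j \<Longrightarrow> burke_row j i U (0, Suc l) = U (0, Suc l)"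
    "\<And>k l. l > j \<or> l = j \<and> k \<ge> i \<Longrightarrow> burke_row j i U (Suc k, Suc l) = V (Suc k, Suc l)"
    by auto
  show ?case
    using Suc.prems IH(1)[of i] IH(2) IH(4)[of j i]
    by (auto simp: burke_move_def IH hinc_Suc vinc_Suc less_Suc_eq)
qed

lemma burke_rows_slots:
  "(\<forall>k<m. burke_rows m n V (Suc k, 0) = hinc V k n) \<and>
   (\<forall>l\<ge>n. burke_rows m n V (0, Suc l) = V (0, Suc l)) \<and>
   (\<forall>k l. l \<ge> n \<longrightarrow> burke_rows m n V (Suc k, Suc l) = V (Suc k, Suc l))"
proof (induction n)
  case 0
  show ?case by (simp add: hinc_def)
next
  case (Suc n)
  have v: "vinc V 0 n = V (0, Suc n)" by (simp add: vinc_def)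
  show ?case
    using burke_row_slots[of m "burke_rows m n V" V n m] Suc v by auto
qed

text \<open>
  The point \<open>(m, n)\<close> is reached by going up the column axis and then along row \<open>n\<close>. The horizontal
  increments met on the way are coordinates of the transformed field.
\<close>

lemma slpp_eq_boundary_sums:
  "slpp V m n = (\<Sum>k<m. burke_rows m n V (Suc k, 0)) + (\<Sum>l<n. V (0, Suc l))"
proof -
  have "slpp V m n - slpp V 0 n = (\<Sum>k<m. hinc V k n)"
    unfolding hinc_def by (rule sum_lessThan_telescope[symmetric])
  also have "\<dots> = (\<Sum>k<m. burke_rows m n V (Suc k, 0))"
    using burke_rows_slots[of m n V] by simp
  finally show ?thesis by (simp add: slpp_column_axis)
qed

fun rate :: "(nat \<Rightarrow> real) \<Rightarrow> (nat \<Rightarrow> real) \<Rightarrow> nat \<times> nat \<Rightarrow> real" where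
  "rate x y (0, 0) = 1"
| "rate x y (Suc i, 0) = x i"
| "rate x y (0, Suc j) = y j"
| "rate x y (Suc i, Suc j) = x i + y j"

lemma rate_pos:
  assumes "\<And>i. x i > 0" "\<And>j. y j > 0"
  shows "rate x y k > 0"
proof (cases k)
  case (Pair i j)
  then show ?thesis using assms add_pos_pos[of "x (i - 1)" "y (j - 1)"] by (cases i; cases j) auto
qed

lemma measure_preserving_compose:
  assumes "f \<in> measurable M M" "distr M M f = M" "g \<in> measurable M M" "distr M M g = M"
  shows "distr M M (\<lambda>x. g (f x)) = M"
  using distr_distr[OF assms(3,1)] assms(2,4) by (simp add: comp_def)

lemma burke_row_preserves:
  assumes "\<And>i. x i > 0" "\<And>j. y j > 0"
  shows "burke_row j m \<in> measurable (expo_field (rate x y)) (expo_field (rate x y)) \<and>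
    distr (expo_field (rate x y)) (expo_field (rate x y)) (burke_row j m) = expo_field (rate x y)"
proof (induction m)
  case 0
  show ?case by (auto simp: distr_id2)
next
  case (Suc m)
  have "distr (expo_field (rate x y)) (expo_field (rate x y))
    (burke_move (Suc m, 0) (0, Suc j) (Suc m, Suc j)) = expo_field (rate x y)"
    by (rule burke_move_preserves) (auto simp: rate_pos assms)
  with Suc show ?case
    using measure_preserving_compose[of "burke_row j m" "expo_field (rate x y)"
        "burke_move (Suc m, 0) (0, Suc j) (Suc m, Suc j)"]
    by (auto intro: measurable_compose)
qed

lemma burke_rows_preserves:
  assumes "\<And>i. x i > 0" "\<And>j. y j > 0"
  shows "burke_rows m n \<in> measurable (expo_field (rate x y)) (expo_field (rate x y)) \<and>
    distr (expo_field (rate x y)) (expo_field (rate x y)) (burke_rows m n) = expo_field (rate x y)"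
proof (induction n)
  case 0
  show ?case by (auto simp: distr_id2)
next
  case (Suc n)
  have row: "burke_row n m \<in> measurable (expo_field (rate x y)) (expo_field (rate x y))"
    "distr (expo_field (rate x y)) (expo_field (rate x y)) (burke_row n m) = expo_field (rate x y)"
    using burke_row_preserves[where x=x and y=y and j=n and m=m] assms by auto
  from Suc row show ?case
    using measure_preserving_compose[of "burke_rows m n" "expo_field (rate x y)" "burke_row n m"]
    by (auto intro: measurable_compose[OF _ row(1)])
qed

lemma measurable_expo_field_component [measurable]: "(\<lambda>V. V k) \<in> borel_measurable (expo_field R)"
proof -
  have "(\<lambda>V. V k) \<in> borel_measurable (PiM UNIV (\<lambda>_. borel))" by simp
  then show ?thesis by (simp cong: measurable_cong_sets add: sets_expo_field)
qed

lemma measurable_slpp [measurable]: "(\<lambda>V. slpp V m n) \<in> borel_measurable (expo_field R)"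
proof (induction m arbitrary: n)
  case 0
  show ?case by (simp add: slpp_column_axis)
next
  case (Suc m)
  show ?case
  proof (induction n)
    case 0
    show ?case by (simp add: slpp_row_axis)
  next
    case (Suc n)
    then show ?case using \<open>\<And>n. (\<lambda>V. slpp V m n) \<in> borel_measurable (expo_field R)\<close> by simp
  qed
qed

lemma expo_field_distributed:
  assumes R: "\<And>k. R k > 0"
  shows "distributed (expo_field R) lborel (\<lambda>V. V k) (exponential_density (R k))"
proof -
  have "distr (PiM UNIV (\<lambda>k. expo (R k))) (expo (R k)) (\<lambda>V. V k) = expo (R k)"
    by (rule distr_PiM_component) (auto intro: prob_space_expo R)
  then have "distr (expo_field R) lborel (\<lambda>V. V k) = density lborel (exponential_density (R k))"
    unfolding expo_field_def expo_def
    by (metis (no_types, lifting) distr_cong sets_density)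
  then show ?thesis
    by (auto simp: distributed_def)
qed

lemma expo_field_indep:
  assumes R: "\<And>k. R k > 0"
  shows "prob_space.indep_vars (expo_field R) (\<lambda>_. borel) (\<lambda>k V. V k) UNIV"
proof -
  interpret prob_space "expo_field R" by (rule prob_space_expo_field[OF R])
  have d: "distr (expo_field R) borel (\<lambda>V. V k) = expo (R k)" for k
  proof -
    have "distr (PiM UNIV (\<lambda>k. expo (R k))) (expo (R k)) (\<lambda>V. V k) = expo (R k)"
      by (rule distr_PiM_component) (auto intro: prob_space_expo R)
    then show ?thesis unfolding expo_field_def by (metis distr_cong sets_expo)
  qed
  have "distr (expo_field R) (PiM UNIV (\<lambda>_. borel)) (\<lambda>V. \<lambda>k\<in>UNIV. V k) = expo_field R"
    using distr_id2[OF sets_expo_field[of R, symmetric]] by (simp add: restrict_UNIV id_def)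
  then show ?thesis
    by (subst indep_vars_iff_distr_eq_PiM) (simp_all add: d expo_field_def[of R, symmetric])
qed

text \<open>
  Independent centred variables are orthogonal, so the second moment of the sum is the sum of the variances.
\<close>

lemma expo_field_sum_variance:
  fixes f :: "nat \<Rightarrow> 'k"
  assumes R: "\<And>k. R k > 0" and f: "inj f"
  shows "(\<integral>\<^sup>+V. ennreal ((\<Sum>i<n. V (f i) - 1 / R (f i))\<^sup>2) \<partial>expo_field R) = ennreal (\<Sum>i<n. 1 / (R (f i))\<^sup>2)"
proof -
  interpret prob_space "expo_field R" by (rule prob_space_expo_field[OF R])
  define X where "X k V = V k - 1 / R k" for k :: 'k and V :: "'k \<Rightarrow> real"
  have int1: "integrable (expo_field R) (\<lambda>V. V k)" for k
    using erlang_ith_moment_integrable[OF R expo_field_distributed[OF R], of k 1] by simp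
  have int2: "integrable (expo_field R) (\<lambda>V. (V k)\<^sup>2)" for k
    using erlang_ith_moment_integrable[OF R expo_field_distributed[OF R], of k 2] by simp
  have EV: "expectation (\<lambda>V. V k) = 1 / R k" for k
    by (rule exponential_distributed_expectation[OF R expo_field_distributed[OF R]])
  have intX: "integrable (expo_field R) (X k)" for k
    unfolding X_def by (intro Bochner_Integration.integrable_diff int1 integrable_const)
  have EX: "expectation (X k) = 0" for k
    unfolding X_def using int1 prob_space by (simp add: EV)
  have intX2: "integrable (expo_field R) (\<lambda>V. X k V * X k V)" for k
  proof -
    have "integrable (expo_field R) (\<lambda>V. (V k)\<^sup>2 + (- 2 * (1 / R k)) * V k + (1 / R k)\<^sup>2)"
      using int1 int2 by (intro Bochner_Integration.integrable_add integrable_mult_right) auto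
    then show ?thesis
      by (rule back_subst[of "integrable _"]) (auto simp: X_def power2_eq_square algebra_simps)
  qed
  have EX2: "expectation (\<lambda>V. X k V * X k V) = 1 / (R k)\<^sup>2" for k
    using exponential_distributed_variance[OF R expo_field_distributed[OF R], of k]
    by (simp add: X_def EV power2_eq_square)
  have indep: "indep_vars (\<lambda>_. borel) X {k, l}" for k l
  proof -
    have "indep_vars (\<lambda>_. borel) (\<lambda>k V. V k) {k, l}"
      by (rule indep_vars_subset[OF expo_field_indep[OF R]]) auto
    from indep_vars_compose2[OF this, of "\<lambda>k v. v - 1 / R k" "\<lambda>_. borel"] show ?thesis
      unfolding X_def by simp
  qed
  have XX: "integrable (expo_field R) (\<lambda>V. X k V * X l V) \<and>
      expectation (\<lambda>V. X k V * X l V) = (if k = l then 1 / (R k)\<^sup>2 else 0)" for k l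
  proof (cases "k = l")
    case False
    then show ?thesis
      using indep_vars_integrable[OF _ indep intX, of k l] indep_vars_lebesgue_integral[OF _ indep intX, of k l]
      by (simp add: EX)
  qed (use intX2 EX2 in auto)
  have sq: "(\<Sum>i<n. X (f i) V)\<^sup>2 = (\<Sum>i<n. \<Sum>j<n. X (f i) V * X (f j) V)" for V
    by (simp add: power2_eq_square sum_product)
  have "(\<integral>\<^sup>+V. ennreal ((\<Sum>i<n. X (f i) V)\<^sup>2) \<partial>expo_field R) = ennreal (expectation (\<lambda>V. (\<Sum>i<n. X (f i) V)\<^sup>2))"
    using XX by (intro nn_integral_eq_integral AE_I2)
      (auto simp: sq intro!: Bochner_Integration.integrable_sum, auto simp: sq[symmetric])
  also have "expectation (\<lambda>V. (\<Sum>i<n. X (f i) V)\<^sup>2) = (\<Sum>i<n. \<Sum>j<n. expectation (\<lambda>V. X (f i) V * X (f j) V))"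
    unfolding sq using XX by (subst Bochner_Integration.integral_sum, auto)
  also have "\<dots> = (\<Sum>i<n. 1 / (R (f i))\<^sup>2)"
    using XX by (simp add: sum.delta inj_eq[OF f])
  finally show ?thesis unfolding X_def .
qed

text \<open>
  In the decomposition of \<open>slpp_eq_boundary_sums\<close> each of the two sums has independent terms, by
  Burke's property for the horizontal one. The two sums may depend on each other, which costs the factor 2.
\<close>

lemma slpp_variance_bound:
  assumes x: "\<And>i. x i > 0" and y: "\<And>j. y j > 0"
  shows "(\<integral>\<^sup>+V. ennreal ((slpp V m n - ((\<Sum>i<m. 1 / x i) + (\<Sum>j<n. 1 / y j)))\<^sup>2) \<partial>expo_field (rate x y))
    \<le> ennreal (2 * ((\<Sum>i<m. 1 / (x i)\<^sup>2) + (\<Sum>j<n. 1 / (y j)\<^sup>2)))"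
proof -
  define P where "P = expo_field (rate x y)"
  have R: "rate x y k > 0" for k by (rule rate_pos[OF x y])
  define H where "H V = (\<Sum>i<m. V (Suc i, 0) - 1 / x i)" for V :: "nat \<times> nat \<Rightarrow> real"
  define J where "J V = (\<Sum>j<n. V (0, Suc j) - 1 / y j)" for V :: "nat \<times> nat \<Rightarrow> real"
  have [measurable]: "H \<in> borel_measurable P" "J \<in> borel_measurable P"
    unfolding H_def J_def P_def by measurable
  have rows: "burke_rows m n \<in> measurable P P" "distr P P (burke_rows m n) = P"
    unfolding P_def using burke_rows_preserves[OF x y] by auto
  note [measurable] = rows(1)
  have H2: "(\<integral>\<^sup>+V. ennreal ((H V)\<^sup>2) \<partial>P) = ennreal (\<Sum>i<m. 1 / (x i)\<^sup>2)"
    using expo_field_sum_variance[of "rate x y" "\<lambda>i. (Suc i, 0)" m] R by (simp add: P_def H_def inj_def)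
  have J2: "(\<integral>\<^sup>+V. ennreal ((J V)\<^sup>2) \<partial>P) = ennreal (\<Sum>j<n. 1 / (y j)\<^sup>2)"
    using expo_field_sum_variance[of "rate x y" "\<lambda>j. (0, Suc j)" n] R by (simp add: P_def J_def inj_def)
  have dec: "slpp V m n - ((\<Sum>i<m. 1 / x i) + (\<Sum>j<n. 1 / y j)) = H (burke_rows m n V) + J V" for V
    unfolding H_def J_def by (subst slpp_eq_boundary_sums) (simp add: sum_subtractf)
  have sq: "(a + b)\<^sup>2 \<le> 2 * a\<^sup>2 + 2 * b\<^sup>2" for a b :: real
    using zero_le_power2[of "a - b"] by (simp add: power2_eq_square algebra_simps)
  have "(\<integral>\<^sup>+V. ennreal ((slpp V m n - ((\<Sum>i<m. 1 / x i) + (\<Sum>j<n. 1 / y j)))\<^sup>2) \<partial>P)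
     \<le> (\<integral>\<^sup>+V. 2 * ennreal ((H (burke_rows m n V))\<^sup>2) + 2 * ennreal ((J V)\<^sup>2) \<partial>P)"
    unfolding dec using sq
    by (intro nn_integral_mono) (simp add: ennreal_plus[symmetric] ennreal_mult'[symmetric] 
        ennreal_numeral[symmetric] del: ennreal_plus ennreal_numeral)
  also have "\<dots> = 2 * (\<integral>\<^sup>+V. ennreal ((H (burke_rows m n V))\<^sup>2) \<partial>P) + 2 * (\<integral>\<^sup>+V. ennreal ((J V)\<^sup>2) \<partial>P)"
    by (simp add: nn_integral_add nn_integral_cmult)
  also have "(\<integral>\<^sup>+V. ennreal ((H (burke_rows m n V))\<^sup>2) \<partial>P) = (\<integral>\<^sup>+V. ennreal ((H V)\<^sup>2) \<partial>distr P P (burke_rows m n))"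
    by (subst nn_integral_distr) auto
  also have "2 * \<dots> + 2 * (\<integral>\<^sup>+V. ennreal ((J V)\<^sup>2) \<partial>P) = 
    ennreal (2 * ((\<Sum>i<m. 1 / (x i)\<^sup>2) + (\<Sum>j<n. 1 / (y j)\<^sup>2)))"
    unfolding rows H2 J2
    by (simp add: ennreal_plus[symmetric] ennreal_mult'[symmetric] sum_nonneg
        ennreal_numeral[symmetric] distrib_left del: ennreal_plus ennreal_numeral)
  finally show ?thesis unfolding P_def .
qed

lemma AE_tendsto_0_of_summable_squares:
  fixes f :: "nat \<Rightarrow> 'a \<Rightarrow> real"
  assumes [measurable]: "\<And>k. f k \<in> borel_measurable M"
    and fin: "(\<Sum>k. \<integral>\<^sup>+x. ennreal ((f k x)\<^sup>2) \<partial>M) < \<infinity>"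
  shows "AE x in M. (\<lambda>k. f k x) \<longlonglongrightarrow> 0"
proof -
  have "(\<integral>\<^sup>+x. (\<Sum>k. ennreal ((f k x)\<^sup>2)) \<partial>M) \<noteq> \<infinity>"
    using fin by (subst nn_integral_suminf) auto
  then have "AE x in M. (\<Sum>k. ennreal ((f k x)\<^sup>2)) \<noteq> \<infinity>"
    by (intro nn_integral_noteq_infinite) auto
  then show ?thesis
  proof eventually_elim
    case (elim x)
    then have "summable (\<lambda>k. (f k x)\<^sup>2)"
      by (intro summable_suminf_not_top) auto
    then have "(\<lambda>k. (f k x)\<^sup>2) \<longlonglongrightarrow> 0" by (rule summable_LIMSEQ_zero)
    from tendsto_real_sqrt[OF this] have "(\<lambda>k. \<bar>f k x\<bar>) \<longlonglongrightarrow> 0" by simp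
    then show ?case by (rule tendsto_rabs_zero_cancel)
  qed
qed

text \<open>
  At scale \<open>k\<^sup>2\<close> the normalised second moment is of order \<open>1 / k\<^sup>2\<close>, which is summable.
\<close>

lemma slpp_limit_squares:
  fixes x y :: "nat \<Rightarrow> real" and m n :: "nat \<Rightarrow> nat"
  assumes \<delta>: "\<delta> > 0" and x: "\<And>i. x i \<ge> \<delta>" and y: "\<And>j. y j \<ge> \<delta>"
    and mn: "\<And>k. real (m k) \<le> C * (real k)\<^sup>2" "\<And>k. real (n k) \<le> C * (real k)\<^sup>2"
    and L: "(\<lambda>k. (\<Sum>i<m k. 1 / x i) / (real k)\<^sup>2) \<longlonglongrightarrow> L" 
    and L': "(\<lambda>k. (\<Sum>j<n k. 1 / y j) / (real k)\<^sup>2) \<longlonglongrightarrow> L'"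
  shows "AE V in expo_field (rate x y). (\<lambda>k. slpp V (m k) (n k) / (real k)\<^sup>2) \<longlonglongrightarrow> L + L'"
proof -
  have xp: "x i > 0" and yp: "y i > 0" for i using \<delta> x[of i] y[of i] by auto
  define e where "e k = (\<Sum>i<m k. 1 / x i) + (\<Sum>j<n k. 1 / y j)" for k
  define f where "f k V = (slpp V (m k) (n k) - e k) / (real k)\<^sup>2" for k V
  define K where "K = 4 * C / \<delta>\<^sup>2"
  have Cn: "C * (real k)\<^sup>2 \<ge> 0" for k using mn(1)[of k] by (meson of_nat_0_le_iff order_trans)
  have Kn: "K \<ge> 0" using Cn[of 1] unfolding K_def by simp
  have bound: "(\<integral>\<^sup>+V. ennreal ((f k V)\<^sup>2) \<partial>expo_field (rate x y)) \<le> ennreal (K / (real k)\<^sup>2)" for k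
  proof (cases "k = 0")
    case False
    have inv: "(\<Sum>i<l. 1 / (u i)\<^sup>2) \<le> C * (real k)\<^sup>2 / \<delta>\<^sup>2"
      if "real l \<le> C * (real k)\<^sup>2" "\<And>i. u i \<ge> \<delta>" for l u
    proof -
      have "(\<Sum>i<l. 1 / (u i)\<^sup>2) \<le> (\<Sum>i<l. 1 / \<delta>\<^sup>2)"
      proof (rule sum_mono)
        fix i
        have "\<delta>\<^sup>2 \<le> (u i)\<^sup>2" using that(2)[of i] \<delta> by (intro power_mono) auto
        then show "1 / (u i)\<^sup>2 \<le> 1 / \<delta>\<^sup>2" using \<delta> by (intro divide_left_mono mult_pos_pos) auto
      qed
      also have "\<dots> \<le> C * (real k)\<^sup>2 / \<delta>\<^sup>2"
        using that(1) \<delta> by (simp add: divide_right_mono)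
      finally show ?thesis .
    qed
    have "(\<integral>\<^sup>+V. ennreal ((f k V)\<^sup>2) \<partial>expo_field (rate x y)) =
      (\<integral>\<^sup>+V. ennreal (1 / (real k)^4) * ennreal ((slpp V (m k) (n k) - e k)\<^sup>2) \<partial>expo_field (rate x y))"
      by (intro nn_integral_cong)
        (simp add: f_def ennreal_mult'[symmetric] power_divide power_mult[symmetric])
    also have "\<dots> = ennreal (1 / (real k)^4) * (\<integral>\<^sup>+V. ennreal ((slpp V (m k) (n k) - e k)\<^sup>2) \<partial>expo_field (rate x y))"
      by (rule nn_integral_cmult) measurable
    also have "\<dots> \<le> ennreal (1 / (real k)^4) * ennreal (2 * ((\<Sum>i<m k. 1 / (x i)\<^sup>2) + (\<Sum>j<n k. 1 / (y j)\<^sup>2)))"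
      unfolding e_def by (intro mult_left_mono slpp_variance_bound xp yp) auto
    also have "\<dots> \<le> ennreal (1 / (real k)^4) * ennreal (K * (real k)\<^sup>2)"
      using inv[where u=x, OF mn(1) x] inv[where u=y, OF mn(2) y]
      by (intro mult_left_mono ennreal_leI) (auto simp: K_def)
    also have "\<dots> = ennreal (K / (real k)\<^sup>2)"
      using False Kn by (simp add: ennreal_mult'[symmetric] power2_eq_square power4_eq_xxxx)
    finally show ?thesis .
  qed (simp add: f_def)
  have sums: "summable (\<lambda>k. K / (real k)\<^sup>2)"
    using summable_mult[OF inverse_power_summable[of 2, where 'a=real], of K] by (simp add: field_simps)
  have "(\<Sum>k. \<integral>\<^sup>+V. ennreal ((f k V)\<^sup>2) \<partial>expo_field (rate x y)) \<le> (\<Sum>k. ennreal (K / (real k)\<^sup>2))"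
    by (intro suminf_le bound) auto
  also have "\<dots> = ennreal (\<Sum>k. K / (real k)\<^sup>2)"
    using Kn sums by (intro suminf_ennreal2) auto
  also have "\<dots> < \<infinity>" by simp
  finally have "AE V in expo_field (rate x y). (\<lambda>k. f k V) \<longlonglongrightarrow> 0"
    by (intro AE_tendsto_0_of_summable_squares) (auto simp: f_def)
  then show ?thesis
  proof eventually_elim
    case (elim V)
    have "(\<lambda>k. f k V + ((\<Sum>i<m k. 1 / x i) / (real k)\<^sup>2 + (\<Sum>j<n k. 1 / y j) / (real k)\<^sup>2)) \<longlonglongrightarrow> 0 + (L + L')"
      by (intro tendsto_add elim L L')
    then show ?case by (simp add: f_def e_def diff_divide_distrib add_divide_distrib)
  qed
qed

section \<open>Comparison of last-passage times\<close>

lemma measurable_expo_fieldI: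
  assumes "\<And>k. (\<lambda>x. g x k) \<in> borel_measurable M"
  shows "g \<in> measurable M (expo_field R)"
proof -
  have "g \<in> measurable M (PiM UNIV (\<lambda>_. borel))"
    by (rule measurable_PiM_single') (use assms in \<open>auto simp: space_PiM\<close>)
  then show ?thesis by (simp cong: measurable_cong_sets add: sets_expo_field)
qed

text \<open>
  All systems below are functions of one field of exponential variables of rate 1. This couples the
  systems with different parameters and different positions of the axes.
\<close>

lemma distr_expo_field_rescale:
  fixes f :: "'k \<Rightarrow> 'l" and r :: "'k \<Rightarrow> real"
  assumes f: "inj f" and r: "\<And>k. r k > 0"
  shows "distr (expo_field (\<lambda>_. 1)) (PiM UNIV (\<lambda>_. borel)) (\<lambda>E k. E (f k) / r k) = expo_field r"
proof -
  interpret prob_space "expo_field (\<lambda>_::'k. 1)" by (rule prob_space_expo_field) simp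
  have indep: "indep_vars (\<lambda>_. borel) (\<lambda>k E. E k / r k) UNIV"
    by (rule indep_vars_compose2[OF expo_field_indep, where Y="\<lambda>k v. v / r k"]) auto
  have d: "distr (expo_field (\<lambda>_::'k. 1)) borel (\<lambda>E. E k / r k) = expo (r k)" for k
  proof -
    have "distributed (expo_field (\<lambda>_::'k. 1)) lborel (\<lambda>E. 0 + (1 / r k) * E k)
        (\<lambda>x. ennreal (exponential_density 1 ((x - 0) / (1 / r k))) / ennreal \<bar>1 / r k\<bar>)"
      using r[of k] expo_field_distributed[of "\<lambda>_. 1" k] by (intro distributed_affine) auto
    then have "distr (expo_field (\<lambda>_::'k. 1)) lborel (\<lambda>E. 0 + (1 / r k) * E k) =
        density lborel (\<lambda>x. ennreal (exponential_density 1 ((x - 0) / (1 / r k))) / ennreal \<bar>1 / r k\<bar>)"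
      by (auto simp: distributed_def)
    moreover have "ennreal (exponential_density 1 ((x - 0) / (1 / r k))) / ennreal \<bar>1 / r k\<bar> = ennreal (exponential_density (r k) x)" for x
      using r[of k] by (subst divide_ennreal) (auto simp: exponential_density_def mult_less_0_iff zero_less_mult_iff)
    moreover have "distr (expo_field (\<lambda>_::'k. 1)) borel (\<lambda>E. E k / r k) =
       distr (expo_field (\<lambda>_::'k. 1)) lborel (\<lambda>E. 0 + (1 / r k) * E k)"
      by (rule distr_cong) auto
    ultimately show ?thesis by (simp add: expo_def)
  qed
  have scale: "distr (expo_field (\<lambda>_. 1)) (PiM UNIV (\<lambda>_. borel)) (\<lambda>E k. E k / r k) = expo_field r"
    using indep by (subst (asm) indep_vars_iff_distr_eq_PiM)
      (simp_all add: d restrict_UNIV expo_field_def[of r, symmetric])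
  have reindex: "distr (expo_field (\<lambda>_. 1)) (expo_field (\<lambda>_. 1)) (\<lambda>E k. E (f k)) = expo_field (\<lambda>_. 1)"
    using distr_PiM_reindex[of UNIV "\<lambda>_. expo 1" f UNIV] f prob_space_expo[of 1]
    by (simp add: expo_field_def restrict_UNIV)
  have "distr (distr (expo_field (\<lambda>_. 1)) (expo_field (\<lambda>_. 1)) (\<lambda>E k. E (f k))) (PiM UNIV (\<lambda>_. borel)) (\<lambda>E k. E k / r k) =
    distr (expo_field (\<lambda>_. 1)) (PiM UNIV (\<lambda>_. borel)) (\<lambda>E k. E (f k) / r k)"
  proof (subst distr_distr)
    show "(\<lambda>E k. E k / r k) \<in> measurable (expo_field (\<lambda>_. 1)) (PiM UNIV (\<lambda>_. borel))"
      by (rule measurable_PiM_single') (auto simp: space_PiM)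
    show "(\<lambda>E k. E (f k)) \<in> measurable (expo_field (\<lambda>_. 1)) (expo_field (\<lambda>_. 1))"
      by (rule measurable_expo_fieldI) simp
  qed (simp add: comp_def)
  then show ?thesis unfolding reindex scale by simp
qed

lemma AE_expo_field_rescale:
  assumes "inj f" "\<And>k. r k > 0" and "AE V in expo_field r. Q V"
  shows "AE E in expo_field (\<lambda>_. 1). Q (\<lambda>k. E (f k) / r k)"
proof (rule AE_distrD[where M'="PiM UNIV (\<lambda>_. borel)" and f="\<lambda>E k. E (f k) / r k" and P=Q])
  show "(\<lambda>E k. E (f k) / r k) \<in> measurable (expo_field (\<lambda>_. 1)) (PiM UNIV (\<lambda>_. borel))"
    by (rule measurable_PiM_single') (auto simp: space_PiM)
  show "AE V in distr (expo_field (\<lambda>_. 1)) (PiM UNIV (\<lambda>_. borel)) (\<lambda>E k. E (f k) / r k). Q V"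
    by (subst distr_expo_field_rescale[OF assms(1,2)]) (rule assms(3))
qed

definition weights :: "(nat \<Rightarrow> real) \<Rightarrow> (nat \<Rightarrow> real) \<Rightarrow> (nat \<times> nat \<Rightarrow> real) \<Rightarrow> nat \<times> nat \<Rightarrow> real" where
  "weights a b E = (\<lambda>(i, j). E (Suc i, Suc j) / (a i + b j))"

text \<open>
  The system whose axes are row \<open>q\<close> and column \<open>p\<close> of the field. Rates \<open>a\<^sub>i + z\<close> on the row and
  \<open>b\<^sub>j - z\<close> on the column are what Burke's property needs next to weights of rate \<open>a\<^sub>i + b\<^sub>j\<close>. The
  interior weights do not depend on \<open>z\<close>, and the boundary weights are monotone in \<open>z\<close>.
\<close>

definition bdry :: "(nat \<Rightarrow> real) \<Rightarrow> (nat \<Rightarrow> real) \<Rightarrow> real \<Rightarrow> nat \<Rightarrow> nat \<Rightarrow> (nat \<times> nat \<Rightarrow> real) \<Rightarrow> nat \<times> nat \<Rightarrow> real" where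
  "bdry a b z p q E = (\<lambda>(i, j). E (i + p, j + q) / rate (\<lambda>i. a (i + p) + z) (\<lambda>j. b (j + q) - z) (i, j))"

lemma bdry_simps:
  "bdry a b z p q E (Suc i, 0) = E (Suc i + p, q) / (a (i + p) + z)"
  "bdry a b z p q E (0, Suc j) = E (p, Suc j + q) / (b (j + q) - z)"
  "bdry a b z p q E (Suc i, Suc j) = weights a b E (i + p, j + q)"
  by (simp_all add: bdry_def weights_def)

text \<open>
  Supersolutions of the last-passage recursion. They dominate last-passage times as soon as they do
  so on the axes, and this replaces all arguments about paths: a bound with several cases, one for each
  kind of path, becomes a maximum of supersolutions.
\<close>

definition lpp_super :: "(nat \<times> nat \<Rightarrow> real) \<Rightarrow> (nat \<Rightarrow> nat \<Rightarrow> real) \<Rightarrow> bool" where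
  "lpp_super W X \<longleftrightarrow> (\<forall>i j. X i (Suc j) + W (i, j) \<le> X (Suc i) (Suc j) \<and> X (Suc i) j + W (i, j) \<le> X (Suc i) (Suc j))"

lemma lpp_super_max: "lpp_super W X \<Longrightarrow> lpp_super W Y \<Longrightarrow> lpp_super W (\<lambda>i j. max (X i j) (Y i j))"
  unfolding lpp_super_def max_add_distrib_left by (intro allI conjI max.mono) auto

lemma lpp_super_add: "lpp_super W X \<Longrightarrow> lpp_super W (\<lambda>i j. X i j + c)"
  unfolding lpp_super_def by (auto simp: algebra_simps)

lemma lpp_super_lpp: "lpp_super W (lpp W)"
  by (simp add: lpp_super_def)

lemma lpp_super_slpp: "lpp_super (\<lambda>(i, j). V (Suc i, Suc j)) (slpp V)"
  by (simp add: lpp_super_def)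

lemma slpp_le_super:
  assumes X: "lpp_super (\<lambda>(i, j). V (Suc i, Suc j)) X"
    and ax: "\<And>i. slpp V i 0 \<le> X i 0" "\<And>j. slpp V 0 j \<le> X 0 j"
  shows "slpp V m n \<le> X m n"
proof (induction m arbitrary: n)
  case (Suc m)
  note left = Suc
  show ?case
  proof (induction n)
    case (Suc n)
    from X have "X m (Suc n) + V (Suc m, Suc n) \<le> X (Suc m) (Suc n)"
      "X (Suc m) n + V (Suc m, Suc n) \<le> X (Suc m) (Suc n)"
      unfolding lpp_super_def by auto
    with Suc left[of "Suc n"] show ?case by simp
  qed (rule ax)
qed (rule ax)

lemma lpp_le_super:
  assumes X: "lpp_super W X" and ax: "\<And>i. 0 \<le> X i 0" "\<And>j. 0 \<le> X 0 j"
  shows "lpp W m n \<le> X m n"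
proof (induction m arbitrary: n)
  case (Suc m)
  note left = Suc
  show ?case
  proof (induction n)
    case (Suc n)
    from X have "X m (Suc n) + W (m, n) \<le> X (Suc m) (Suc n)" "X (Suc m) n + W (m, n) \<le> X (Suc m) (Suc n)"
      unfolding lpp_super_def by auto
    with Suc left[of "Suc n"] show ?case by simp
  qed (simp add: ax)
qed (simp add: ax)

lemma lpp_nonneg: "(\<And>k. W k \<ge> 0) \<Longrightarrow> lpp W m n \<ge> 0"
  by (induction W m n rule: lpp.induct) (auto simp: max_def)

lemma lpp_le_slpp:
  assumes "\<And>k. V k \<ge> 0"
  shows "lpp (\<lambda>(i, j). V (Suc i, Suc j)) m n \<le> slpp V m n"
  by (rule lpp_le_super[OF lpp_super_slpp])
    (auto simp: slpp_row_axis slpp_column_axis intro: sum_nonneg assms)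

lemma lpp_shift_le:
  assumes "\<And>k. W k \<ge> 0"
  shows "lpp (\<lambda>(i, j). W (i + p, j + q)) m n \<le> lpp W (m + p) (n + q)"
  by (rule lpp_le_super[where X="\<lambda>i j. lpp W (i + p) (j + q)"])
    (auto simp: lpp_super_def lpp_nonneg assms)

lemma column_sum_le_lpp:
  assumes "\<And>k. W k \<ge> 0"
  shows "(\<Sum>l<j. W (p, l)) \<le> lpp W (Suc p) j"
proof (induction j)
  case (Suc j)
  then show ?case using lpp_nonneg[of W p "Suc j", OF assms] by (auto simp: max_def)
qed simp

text \<open>
  Before \<open>k\<close> the axis sum is at most its value at \<open>k\<close>, and after \<open>k\<close> the gap between the two boundary
  rows only widens. The first term of the maximum stands for paths that leave the row before \<open>k\<close>, the
  second for those that leave it later.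
\<close>

lemma row_axis_split:
  assumes V: "\<And>k. V k \<ge> 0" and W: "\<And>k. W k \<ge> 0" and VV': "\<And>i. V (Suc i, 0) \<le> V' (Suc i, 0)"
  shows "slpp V i 0 \<le> max (lpp W i 0 + slpp V k 0) (slpp V' i 0 + (slpp V k 0 - slpp V' k 0))"
proof (cases "i \<le> k")
  case True
  have "slpp V i 0 \<le> slpp V k 0"
    unfolding slpp_row_axis using True V by (intro sum_mono2) auto
  then show ?thesis using lpp_nonneg[of W i 0, OF W] by (simp add: le_max_iff_disj)
next
  case False
  have "(\<Sum>l<i. V (Suc l, 0)) = (\<Sum>l<k. V (Suc l, 0)) + (\<Sum>l=k..<i. V (Suc l, 0))"
    "(\<Sum>l<i. V' (Suc l, 0)) = (\<Sum>l<k. V' (Suc l, 0)) + (\<Sum>l=k..<i. V' (Suc l, 0))"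
    using False by (auto simp: lessThan_atLeast0 sum.atLeastLessThan_concat)
  moreover have "(\<Sum>l=k..<i. V (Suc l, 0)) \<le> (\<Sum>l=k..<i. V' (Suc l, 0))"
    by (intro sum_mono VV')
  ultimately have "slpp V i 0 \<le> slpp V' i 0 + (slpp V k 0 - slpp V' k 0)"
    unfolding slpp_row_axis by simp
  then show ?thesis by simp
qed

lemma column_axis_split:
  assumes V: "\<And>k. V k \<ge> 0" and W: "\<And>k. W k \<ge> 0" and VV': "\<And>j. V (0, Suc j) \<le> V' (0, Suc j)"
  shows "slpp V 0 j \<le> max (lpp W 0 j + slpp V 0 k) (slpp V' 0 j + (slpp V 0 k - slpp V' 0 k))"
proof (cases "j \<le> k")
  case True
  have "slpp V 0 j \<le> slpp V 0 k"
    unfolding slpp_column_axis using True V by (intro sum_mono2) auto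
  then show ?thesis using lpp_nonneg[of W 0 j, OF W] by (simp add: le_max_iff_disj)
next
  case False
  have "(\<Sum>l<j. V (0, Suc l)) = (\<Sum>l<k. V (0, Suc l)) + (\<Sum>l=k..<j. V (0, Suc l))"
    "(\<Sum>l<j. V' (0, Suc l)) = (\<Sum>l<k. V' (0, Suc l)) + (\<Sum>l=k..<j. V' (0, Suc l))"
    using False by (auto simp: lessThan_atLeast0 sum.atLeastLessThan_concat)
  moreover have "(\<Sum>l=k..<j. V (0, Suc l)) \<le> (\<Sum>l=k..<j. V' (0, Suc l))"
    by (intro sum_mono VV')
  ultimately have "slpp V 0 j \<le> slpp V' 0 j + (slpp V 0 k - slpp V' 0 k)"
    unfolding slpp_column_axis by simp
  then show ?thesis by simp
qed

text \<open>
  \<open>V1\<close> has a boundary row at least as heavy as \<open>V\<close> and controls late exits from the row. \<open>V2\<close> has a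
  boundary column at least as heavy and controls late exits from the column. Early exits cost at most an axis sum.
\<close>

lemma slpp_exit_bound_interior:
  fixes m n :: nat
  assumes nonneg: "\<And>k. V k \<ge> 0"
    and H: "\<And>i. V (Suc i, 0) \<le> V1 (Suc i, 0)" and J: "\<And>j. V (0, Suc j) \<le> V2 (0, Suc j)"
    and W: "\<And>i j. V1 (Suc i, Suc j) = V (Suc i, Suc j)" "\<And>i j. V2 (Suc i, Suc j) = V (Suc i, Suc j)"
    and V1: "\<And>k. V1 k \<ge> 0" and V2: "\<And>k. V2 k \<ge> 0"
  defines "G \<equiv> lpp (\<lambda>(i, j). V (Suc i, Suc j)) m n"
  shows "slpp V m n \<le> max (max (G + slpp V k 0) (slpp V1 m n + (slpp V k 0 - slpp V1 k 0)))
                          (max (G + slpp V 0 l) (slpp V2 m n + (slpp V 0 l - slpp V2 0 l)))"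
proof -
  let ?W = "\<lambda>(i, j). V (Suc i, Suc j)"
  have sup: "lpp_super ?W (slpp V1)" "lpp_super ?W (slpp V2)"
    using lpp_super_slpp[of V1] lpp_super_slpp[of V2] by (simp_all add: W)
  have Wn: "?W k \<ge> 0" for k using nonneg by (cases k) auto
  show ?thesis unfolding G_def
  proof (rule slpp_le_super[where X="\<lambda>m n. max (max (lpp ?W m n + slpp V k 0) (slpp V1 m n + (slpp V k 0 - slpp V1 k 0)))
     (max (lpp ?W m n + slpp V 0 l) (slpp V2 m n + (slpp V 0 l - slpp V2 0 l)))"], goal_cases)
    case 1
    show ?case by (intro lpp_super_max lpp_super_add lpp_super_lpp sup)
  next
    case (2 i)
    show ?case by (rule max.coboundedI1, rule row_axis_split[where V=V and W="?W" and V'=V1, OF nonneg Wn H])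
  next
    case (3 j)
    show ?case by (rule max.coboundedI2, rule column_axis_split[where V=V and W="?W" and V'=V2, OF nonneg Wn J])
  qed
qed

text \<open>
  Here exits from the column are not cut off: the boundary column of \<open>V\<close> is at most \<open>c\<close> times column
  \<open>p\<close> of the larger system \<open>U\<close>, of which the interior of \<open>V\<close> is the part to the right of that column.
  A path through the boundary column then has at most \<open>c\<close> times the weight of a path in \<open>U\<close>.
\<close>

lemma slpp_exit_bound_column:
  assumes nonneg: "\<And>k. V k \<ge> 0"
    and H: "\<And>i. V (Suc i, 0) \<le> V1 (Suc i, 0)"
    and W1: "\<And>i j. V1 (Suc i, Suc j) = V (Suc i, Suc j)"
    and V1: "\<And>k. V1 k \<ge> 0"
    and U: "\<And>k. U k \<ge> 0" and UV: "\<And>i j. V (Suc i, Suc j) = U (i + Suc p, j)"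
    and col: "\<And>j. V (0, Suc j) \<le> c * U (p, j)" and c: "c \<ge> 1"
  shows "slpp V m n \<le> max (max (lpp U (m + Suc p) n + slpp V k 0) (slpp V1 m n + (slpp V k 0 - slpp V1 k 0)))
                          (c * lpp U (m + Suc p) n)"
proof -
  let ?W = "\<lambda>(i, j). V (Suc i, Suc j)"
  have sup: "lpp_super ?W (slpp V1)"
    using lpp_super_slpp[of V1] by (simp add: W1)
  have sup2: "lpp_super ?W (\<lambda>m n. c * lpp U (m + Suc p) n)"
  proof -
    have "c * a + w \<le> c * (b + w)" if "a \<le> b" "w \<ge> 0" for a b w :: real
    proof -
      have "c * a \<le> c * b" using c that by (intro mult_left_mono) auto
      moreover have "1 * w \<le> c * w" using c that by (intro mult_right_mono) auto
      ultimately show ?thesis by (simp add: algebra_simps)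
    qed
    then show ?thesis unfolding lpp_super_def using U by (simp add: UV)
  qed
  have Wn: "?W k \<ge> 0" for k using nonneg by (cases k) auto
  have G: "lpp ?W m n \<le> lpp U (m + Suc p) n"
    using lpp_shift_le[of U "Suc p" 0 m n, OF U] by (simp add: UV)
  have "slpp V m n \<le> max (max (lpp ?W m n + slpp V k 0) (slpp V1 m n + (slpp V k 0 - slpp V1 k 0)))
                          (c * lpp U (m + Suc p) n)"
  proof (rule slpp_le_super[where X="\<lambda>m n. max (max (lpp ?W m n + slpp V k 0) (slpp V1 m n + (slpp V k 0 - slpp V1 k 0)))
     (c * lpp U (m + Suc p) n)"], goal_cases)
    case 1
    show ?case by (intro lpp_super_max lpp_super_add lpp_super_lpp sup sup2)
  next
    case (2 i)
    show ?case by (rule max.coboundedI1, rule row_axis_split[where V=V and W="?W" and V'=V1, OF nonneg Wn H])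
  next
    case (3 j)
    have "slpp V 0 j \<le> (\<Sum>l<j. c * U (p, l))"
      unfolding slpp_column_axis by (intro sum_mono col)
    also have "\<dots> \<le> c * lpp U (0 + Suc p) j"
      using c column_sum_le_lpp[of U p j, OF U] by (simp add: sum_distrib_left[symmetric])
    finally show ?case by simp
  qed
  also have "\<dots> \<le> max (max (lpp U (m + Suc p) n + slpp V k 0) (slpp V1 m n + (slpp V k 0 - slpp V1 k 0)))
                          (c * lpp U (m + Suc p) n)"
    using G by (intro max.mono) auto
  finally show ?thesis .
qed

lemma lpp_transpose: "lpp (\<lambda>(j, i). W (i, j)) n m = lpp W m n"
proof (induction W m n rule: lpp.induct)
  case (1 W j)
  then show ?case by (cases j) auto
next
  case (2 W i)
  show ?case by simp
next
  case (3 W i j)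
  have "lpp (\<lambda>(j, i). W (i, j)) (Suc j) (Suc i) =
      max (lpp (\<lambda>(j, i). W (i, j)) j (Suc i)) (lpp (\<lambda>(j, i). W (i, j)) (Suc j) i) + W (i, j)"
    by simp
  also have "\<dots> = max (lpp W (Suc i) j) (lpp W i (Suc j)) + W (i, j)"
    by (simp only: 3)
  also have "\<dots> = lpp W (Suc i) (Suc j)"
    by (simp only: lpp.simps max.commute)
  finally show ?case .
qed

section \<open>Bounds in a fixed environment\<close>

text \<open>
  The entries of \<open>c\<close> are rates of exponential variables, whose means have the Cesaro limit \<open>A\<close>.
\<close>

definition mean_time :: "(nat \<Rightarrow> real) \<Rightarrow> real \<Rightarrow> bool" where
  "mean_time c A \<longleftrightarrow> (\<exists>\<delta>>0. \<forall>i. c i \<ge> \<delta>) \<and> (\<lambda>n. (\<Sum>i<n. 1 / c i) / real n) \<longlonglongrightarrow> A"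

abbreviation scaled :: "nat \<Rightarrow> real \<Rightarrow> nat" where
  "scaled k u \<equiv> nat \<lfloor>real (k\<^sup>2) * u\<rfloor>"

lemma scaled_limit:
  assumes "u \<ge> 0"
  shows "(\<lambda>k. real (scaled k u) / (real k)\<^sup>2) \<longlonglongrightarrow> u"
proof -
  have inv: "(\<lambda>k. 1 / (real k)\<^sup>2) \<longlonglongrightarrow> 0"
    by real_asymp
  show ?thesis
  proof (rule tendsto_sandwich)
    show "(\<lambda>k. u - 1 / (real k)\<^sup>2) \<longlonglongrightarrow> u" using tendsto_diff[OF tendsto_const inv, of u] by simp
    show "\<forall>\<^sub>F k in sequentially. u - 1 / (real k)\<^sup>2 \<le> real (scaled k u) / (real k)\<^sup>2"
      using eventually_gt_at_top[of 0]
    proof eventually_elim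
      case (elim k)
      have "real (k\<^sup>2) * u - 1 \<le> real (scaled k u)" using assms by linarith
      from divide_right_mono[OF this, of "(real k)\<^sup>2"] show ?case
        using elim by (simp add: diff_divide_distrib)
    qed
    show "\<forall>\<^sub>F k in sequentially. real (scaled k u) / (real k)\<^sup>2 \<le> u"
      using eventually_gt_at_top[of 0]
    proof eventually_elim
      case (elim k)
      have "real (scaled k u) \<le> real (k\<^sup>2) * u" using assms by simp
      then show ?case using elim by (simp add: field_simps)
    qed
  qed simp
qed

lemma mean_time_scaled:
  assumes c: "mean_time c A" and u: "u \<ge> 0"
  shows "(\<lambda>k. (\<Sum>i<scaled k u - p. 1 / c (i + p)) / (real k)\<^sup>2) \<longlonglongrightarrow> u * A"
proof (cases "u = 0")
  case False
  with u have u: "u > 0" by simp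
  have top: "filterlim (\<lambda>k. scaled k u) at_top sequentially"
  proof -
    have "filterlim (\<lambda>k. (real k)\<^sup>2 * u) at_top sequentially"
      using u by real_asymp
    then have "filterlim (\<lambda>k. real (k\<^sup>2) * u) at_top sequentially" by simp
    then have "filterlim (\<lambda>k. \<lfloor>real (k\<^sup>2) * u\<rfloor>) at_top sequentially"
      by (rule filterlim_compose[OF filterlim_floor_sequentially])
    then show ?thesis
      by (rule filterlim_compose[OF filterlim_nat_sequentially])
  qed
  have "(\<lambda>n. (\<Sum>i<n. 1 / c i) / real n) \<longlonglongrightarrow> A" using c by (simp add: mean_time_def)
  from filterlim_compose[OF this top] 
  have 1: "(\<lambda>k. (\<Sum>i<scaled k u. 1 / c i) / real (scaled k u)) \<longlonglongrightarrow> A" .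
  have "(\<lambda>k. real (scaled k u) / (real k)\<^sup>2 * ((\<Sum>i<scaled k u. 1 / c i) / real (scaled k u))
      - (\<Sum>i<p. 1 / c i) * (1 / (real k)\<^sup>2)) \<longlonglongrightarrow> u * A - (\<Sum>i<p. 1 / c i) * 0"
    by (intro tendsto_diff tendsto_mult scaled_limit 1 tendsto_const) (use u in simp, real_asymp)
  then have lim: "(\<lambda>k. real (scaled k u) / (real k)\<^sup>2 * ((\<Sum>i<scaled k u. 1 / c i) / real (scaled k u))
      - (\<Sum>i<p. 1 / c i) * (1 / (real k)\<^sup>2)) \<longlonglongrightarrow> u * A" by simp
  have "\<forall>\<^sub>F k in sequentially. scaled k u > p"
    using top[unfolded filterlim_at_top, rule_format, of "Suc p"] by (simp add: Suc_le_eq)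
  then have "\<forall>\<^sub>F k in sequentially. real (scaled k u) / (real k)\<^sup>2 * ((\<Sum>i<scaled k u. 1 / c i) / real (scaled k u))
      - (\<Sum>i<p. 1 / c i) * (1 / (real k)\<^sup>2) = (\<Sum>i<scaled k u - p. 1 / c (i + p)) / (real k)\<^sup>2"
  proof eventually_elim
    case (elim k)
    have "(\<Sum>i<scaled k u - p. 1 / c (i + p)) = (\<Sum>i=p..<scaled k u. 1 / c i)"
      using elim sum.shift_bounds_nat_ivl[of "\<lambda>i. 1 / c i" 0 p "scaled k u - p"] by (simp add: lessThan_atLeast0)
    also have "\<dots> = (\<Sum>i<scaled k u. 1 / c i) - (\<Sum>i<p. 1 / c i)"
      using elim sum.atLeastLessThan_concat[of 0 p "scaled k u" "\<lambda>i. 1 / c i"] by (simp add: lessThan_atLeast0)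
    finally show ?case using elim by (simp add: diff_divide_distrib)
  qed
  from Lim_transform_eventually[OF lim this] show ?thesis .
qed simp

text \<open>
  Moving the axes to row \<open>q\<close> and column \<open>p\<close> removes only finitely many terms from the averages.
\<close>

lemma bdry_limit:
  assumes A: "mean_time (\<lambda>i. a i + z) A" and B: "mean_time (\<lambda>j. b j - z) B" and u: "u \<ge> 0" and v: "v \<ge> 0"
  shows "AE E in expo_field (\<lambda>_. 1).
    (\<lambda>k. slpp (bdry a b z p q E) (scaled k u - p) (scaled k v - q) / (real k)\<^sup>2) \<longlonglongrightarrow> u * A + v * B"
proof -
  obtain d e where d: "d > 0" "\<And>i. a i + z \<ge> d" and e: "e > 0" "\<And>j. b j - z \<ge> e"
    using A B unfolding mean_time_def by auto
  define x where "x i = a (i + p) + z" for i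
  define y where "y j = b (j + q) - z" for j
  have xp: "x i > 0" and yp: "y i > 0" for i
    using d(1) d(2)[of "i + p"] e(1) e(2)[of "i + q"] by (auto simp: x_def y_def)
  have bd: "real (scaled k w - l) \<le> (u + v) * (real k)\<^sup>2" if "0 \<le> w" "w \<le> u + v" for w k l
  proof -
    have "real (scaled k w - l) \<le> real (scaled k w)" by simp
    also have "\<dots> \<le> real (k\<^sup>2) * w" using that by simp
    also have "\<dots> \<le> real (k\<^sup>2) * (u + v)" using that by (intro mult_left_mono) auto
    finally show ?thesis by (simp add: mult.commute)
  qed
  have "AE V in expo_field (rate x y). (\<lambda>k. slpp V (scaled k u - p) (scaled k v - q) / (real k)\<^sup>2) \<longlonglongrightarrow> u * A + v * B"
  proof (rule slpp_limit_squares)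
    show "min d e > 0" using d e by simp
    show "x i \<ge> min d e" for i using d(2)[of "i + p"] by (simp add: x_def min.coboundedI1)
    show "y i \<ge> min d e" for i using e(2)[of "i + q"] by (simp add: y_def min.coboundedI2)
    show "real (scaled k u - p) \<le> (u + v) * (real k)\<^sup>2" "real (scaled k v - q) \<le> (u + v) * (real k)\<^sup>2" for k
      using bd[OF u] bd[OF v] u v by auto
    show "(\<lambda>k. (\<Sum>i<scaled k u - p. 1 / x i) / (real k)\<^sup>2) \<longlonglongrightarrow> u * A"
      unfolding x_def by (rule mean_time_scaled[OF A u])
    show "(\<lambda>k. (\<Sum>i<scaled k v - q. 1 / y i) / (real k)\<^sup>2) \<longlonglongrightarrow> v * B"
      unfolding y_def by (rule mean_time_scaled[OF B v])
  qed
  then have "AE E in expo_field (\<lambda>_. 1). (\<lambda>k. slpp (\<lambda>l. E (fst l + p, snd l + q) / rate x y l)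
      (scaled k u - p) (scaled k v - q) / (real k)\<^sup>2) \<longlonglongrightarrow> u * A + v * B"
    by (intro AE_expo_field_rescale rate_pos xp yp) (auto simp: inj_def)
  moreover have "(\<lambda>l. E (fst l + p, snd l + q) / rate x y l) = bdry a b z p q E" for E
    by (auto simp: bdry_def x_def[abs_def] y_def[abs_def] fun_eq_iff)
  ultimately show ?thesis by simp
qed

lemma AE_expo_field_nonneg: "AE E in expo_field (\<lambda>_. 1). \<forall>k::nat \<times> nat. E k \<ge> 0"
proof -
  have "AE v in expo 1. v \<ge> 0"
    unfolding expo_def by (subst AE_density) (auto simp: exponential_density_def)
  then have "AE E in expo_field (\<lambda>_. 1). E k \<ge> 0" for k :: "nat \<times> nat"
    unfolding expo_field_def by (intro AE_PiM_component prob_space_expo) auto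
  then show ?thesis by (simp add: AE_all_countable)
qed

lemma mean_time_pos: "mean_time c A \<Longrightarrow> c i > 0"
  by (auto simp: mean_time_def intro: less_le_trans)

lemma bdry_nonneg:
  assumes "mean_time (\<lambda>i. a i + z) A" "mean_time (\<lambda>j. b j - z) B" "\<forall>k. E k \<ge> 0"
  shows "bdry a b z p q E k \<ge> 0"
  unfolding bdry_def using assms mean_time_pos[OF assms(1)] mean_time_pos[OF assms(2)]
  by (auto intro!: divide_nonneg_pos rate_pos split: prod.splits)

lemma weights_bdry: "(\<lambda>(i, j). bdry a b z 0 0 E (Suc i, Suc j)) = weights a b E"
  by (auto simp: bdry_simps)

text \<open>
  The boundary weights are nonnegative, so adding them increases the last-passage time.
\<close>

lemma quenched_upper_bound:
  assumes A: "mean_time (\<lambda>i. a i + z) A" and B: "mean_time (\<lambda>j. b j - z) B" and s: "s \<ge> 0" and t: "t \<ge> 0"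
    and G: "AE E in expo_field (\<lambda>_. 1).
      (\<lambda>k. ennreal (lpp (weights a b E) (scaled k s) (scaled k t) / (real k)\<^sup>2)) \<longlonglongrightarrow> G"
  shows "G \<le> ennreal (s * A + t * B)"
proof -
  interpret prob_space "expo_field (\<lambda>_::nat \<times> nat. 1)" by (rule prob_space_expo_field) simp
  have "AE E in expo_field (\<lambda>_::nat \<times> nat. 1). G \<le> ennreal (s * A + t * B)"
    using G AE_expo_field_nonneg bdry_limit[OF A B s t, of 0 0]
  proof eventually_elim
    case (elim E)
    have "ennreal (lpp (weights a b E) (scaled k s) (scaled k t) / (real k)\<^sup>2) \<le>
        ennreal (slpp (bdry a b z 0 0 E) (scaled k s) (scaled k t) / (real k)\<^sup>2)" for k
      using lpp_le_slpp[of "bdry a b z 0 0 E" "scaled k s" "scaled k t"] bdry_nonneg[OF A B elim(2)]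
      unfolding weights_bdry by (intro ennreal_leI divide_right_mono) auto
    moreover have "(\<lambda>k. ennreal (slpp (bdry a b z 0 0 E) (scaled k s) (scaled k t) / (real k)\<^sup>2)) \<longlonglongrightarrow> ennreal (s * A + t * B)"
      using elim(3) by (intro tendsto_ennrealI) simp
    ultimately show ?case using elim(1) by (intro LIMSEQ_le) auto
  qed
  then show ?thesis by simp
qed

text \<open>
  The limit of \<open>slpp_exit_bound_interior\<close> for the parameters \<open>z1 \<le> z \<le> z2\<close>, with the exits from
  the row and the column cut at \<open>u\<close> and \<open>v\<close> after scaling.
\<close>

lemma quenched_interior_bound:
  assumes A: "mean_time (\<lambda>i. a i + z) A" and B: "mean_time (\<lambda>j. b j - z) B"
    and A1: "mean_time (\<lambda>i. a i + z1) A1" and B1: "mean_time (\<lambda>j. b j - z1) B1"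
    and A2: "mean_time (\<lambda>i. a i + z2) A2" and B2: "mean_time (\<lambda>j. b j - z2) B2"
    and z: "z1 \<le> z" "z \<le> z2"
    and st: "s \<ge> 0" "t \<ge> 0" and uv: "u \<ge> 0" "v \<ge> 0"
    and G: "AE E in expo_field (\<lambda>_. 1).
      (\<lambda>k. lpp (weights a b E) (scaled k s) (scaled k t) / (real k)\<^sup>2) \<longlonglongrightarrow> G"
  shows "s * A + t * B \<le> max (max (G + u * A) ((s * A1 + t * B1) + (u * A - u * A1)))
                             (max (G + v * B) ((s * A2 + t * B2) + (v * B - v * B2)))"
proof -
  interpret prob_space "expo_field (\<lambda>_::nat \<times> nat. 1)" by (rule prob_space_expo_field) simp
  note ap = mean_time_pos[OF A] mean_time_pos[OF A1] mean_time_pos[OF A2]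
    mean_time_pos[OF B] mean_time_pos[OF B1] mean_time_pos[OF B2]
  have "AE E in expo_field (\<lambda>_::nat \<times> nat. 1). 
      s * A + t * B \<le> max (max (G + u * A) ((s * A1 + t * B1) + (u * A - u * A1)))
                             (max (G + v * B) ((s * A2 + t * B2) + (v * B - v * B2)))"
    using G AE_expo_field_nonneg bdry_limit[OF A B st, of 0 0] bdry_limit[OF A1 B1 st, of 0 0] bdry_limit[OF A2 B2 st, of 0 0]
      bdry_limit[OF A B uv(1) order_refl, of 0 0] bdry_limit[OF A1 B1 uv(1) order_refl, of 0 0]
      bdry_limit[OF A B order_refl uv(2), of 0 0] bdry_limit[OF A2 B2 order_refl uv(2), of 0 0]
  proof eventually_elim
    case (elim E)
    define V V1 V2 where "V = bdry a b z 0 0 E" and "V1 = bdry a b z1 0 0 E" and "V2 = bdry a b z2 0 0 E"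
    define L where "L X k = X (scaled k s) (scaled k t) / (real k)\<^sup>2" for X :: "nat \<Rightarrow> nat \<Rightarrow> real" and k
    define S where "S X k = slpp X (scaled k u) 0 / (real k)\<^sup>2" for X k
    define T where "T X k = slpp X 0 (scaled k v) / (real k)\<^sup>2" for X k
    define U where "U k = max (max (L (lpp (weights a b E)) k + S V k) (L (slpp V1) k + (S V k - S V1 k)))
        (max (L (lpp (weights a b E)) k + T V k) (L (slpp V2) k + (T V k - T V2 k)))" for k
    note lims = elim[folded V_def V1_def V2_def, simplified]
    show ?case
    proof (rule LIMSEQ_le)
      show "L (slpp V) \<longlonglongrightarrow> s * A + t * B"
        using lims by (simp add: L_def[abs_def])
      show "U \<longlonglongrightarrow> max (max (G + u * A) ((s * A1 + t * B1) + (u * A - u * A1)))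
                             (max (G + v * B) ((s * A2 + t * B2) + (v * B - v * B2)))"
        unfolding U_def L_def S_def T_def using lims by (intro tendsto_max tendsto_add tendsto_diff) simp_all
      show "\<exists>N. \<forall>k\<ge>N. L (slpp V) k \<le> U k"
      proof (intro exI allI impI)
        fix k :: nat
        have "slpp V (scaled k s) (scaled k t) \<le>
            max (max (lpp (weights a b E) (scaled k s) (scaled k t) + slpp V (scaled k u) 0)
                 (slpp V1 (scaled k s) (scaled k t) + (slpp V (scaled k u) 0 - slpp V1 (scaled k u) 0)))
                (max (lpp (weights a b E) (scaled k s) (scaled k t) + slpp V 0 (scaled k v))
                 (slpp V2 (scaled k s) (scaled k t) + (slpp V 0 (scaled k v) - slpp V2 0 (scaled k v))))"
          unfolding weights_bdry[of a b z E, symmetric, folded V_def]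
        proof (rule slpp_exit_bound_interior)
          show "V k \<ge> 0" "V1 k \<ge> 0" "V2 k \<ge> 0" for k
            unfolding V_def V1_def V2_def using bdry_nonneg A B A1 B1 A2 B2 elim(2) by blast+
          show "V (Suc i, 0) \<le> V1 (Suc i, 0)" for i
            unfolding V_def V1_def bdry_simps using elim(2) z ap[of i] by (intro divide_left_mono) auto
          show "V (0, Suc i) \<le> V2 (0, Suc i)" for i
            unfolding V_def V2_def bdry_simps using elim(2) z ap[of i] by (intro divide_left_mono) auto
        qed (simp_all add: V_def V1_def V2_def bdry_simps)
        from divide_right_mono[OF this, of "(real k)\<^sup>2"]
        show "L (slpp V) k \<le> U k" unfolding U_def L_def S_def T_def
          by (simp only: max_divide_distrib_right zero_le_power2 if_True add_divide_distrib diff_divide_distrib)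
      qed
    qed
  qed
  then show ?thesis by simp
qed

text \<open>
  The limit of \<open>slpp_exit_bound_column\<close> with column \<open>p\<close> of the quadrant as boundary column.
\<close>

lemma quenched_column_bound:
  assumes A: "mean_time (\<lambda>i. a i + z) A" and B: "mean_time (\<lambda>j. b j - z) B"
    and A1: "mean_time (\<lambda>i. a i + z1) A1" and B1: "mean_time (\<lambda>j. b j - z1) B1"
    and z: "z1 \<le> z" and ab: "\<And>i j. a i + b j > 0"
    and c: "c \<ge> 1" and col: "\<And>j. a p + b j \<le> c * (b j - z)"
    and st: "s > 0" "t > 0" and u: "u \<ge> 0"
    and G: "AE E in expo_field (\<lambda>_. 1).
      (\<lambda>k. lpp (weights a b E) (scaled k s) (scaled k t) / (real k)\<^sup>2) \<longlonglongrightarrow> G"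
  shows "s * A + t * B \<le> max (max (G + u * A) ((s * A1 + t * B1) + (u * A - u * A1))) (c * G)"
proof -
  interpret prob_space "expo_field (\<lambda>_::nat \<times> nat. 1)" by (rule prob_space_expo_field) simp
  have st': "s \<ge> 0" "t \<ge> 0" using st by auto
  note ap = mean_time_pos[OF A] mean_time_pos[OF A1] mean_time_pos[OF B] mean_time_pos[OF B1]
  have "AE E in expo_field (\<lambda>_::nat \<times> nat. 1). 
      s * A + t * B \<le> max (max (G + u * A) ((s * A1 + t * B1) + (u * A - u * A1))) (c * G)"
    using G AE_expo_field_nonneg bdry_limit[OF A B st', of "Suc p" 0] bdry_limit[OF A1 B1 st', of "Suc p" 0]
      bdry_limit[OF A B u order_refl, of "Suc p" 0] bdry_limit[OF A1 B1 u order_refl, of "Suc p" 0]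
  proof eventually_elim
    case (elim E)
    define V V1 where "V = bdry a b z (Suc p) 0 E" and "V1 = bdry a b z1 (Suc p) 0 E"
    define R where "R k = max (max (lpp (weights a b E) (scaled k s) (scaled k t) / (real k)\<^sup>2 + slpp V (scaled k u - Suc p) 0 / (real k)\<^sup>2)
            (slpp V1 (scaled k s - Suc p) (scaled k t) / (real k)\<^sup>2 + (slpp V (scaled k u - Suc p) 0 / (real k)\<^sup>2 - slpp V1 (scaled k u - Suc p) 0 / (real k)\<^sup>2)))
          (c * (lpp (weights a b E) (scaled k s) (scaled k t) / (real k)\<^sup>2))" for k
    note lims = elim[folded V_def V1_def, simplified]
    have top: "\<forall>\<^sub>F k in sequentially. scaled k s \<ge> Suc p"
    proof -
      have "filterlim (\<lambda>k. (real k)\<^sup>2 * s) at_top sequentially" using st by real_asymp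
      then have "\<forall>\<^sub>F k in sequentially. (real k)\<^sup>2 * s \<ge> real (Suc p)" by (simp add: filterlim_at_top)
      then show ?thesis by eventually_elim (simp add: le_nat_floor)
    qed
    show ?case
    proof (rule tendsto_le)
      show "(\<lambda>k. slpp V (scaled k s - Suc p) (scaled k t) / (real k)\<^sup>2) \<longlonglongrightarrow> s * A + t * B"
        using lims by simp
      show "R \<longlonglongrightarrow> max (max (G + u * A) ((s * A1 + t * B1) + (u * A - u * A1))) (c * G)"
        unfolding R_def using lims by (intro tendsto_max tendsto_add tendsto_diff tendsto_mult tendsto_const) simp_all
      show "\<forall>\<^sub>F k in sequentially. slpp V (scaled k s - Suc p) (scaled k t) / (real k)\<^sup>2 \<le> R k"
        using top
      proof eventually_elim
        case (elim k)
        have eq: "scaled k s - Suc p + Suc p = scaled k s" using elim by simp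
        have "slpp V (scaled k s - Suc p) (scaled k t) \<le>
            max (max (lpp (weights a b E) (scaled k s - Suc p + Suc p) (scaled k t) + slpp V (scaled k u - Suc p) 0)
                 (slpp V1 (scaled k s - Suc p) (scaled k t) + (slpp V (scaled k u - Suc p) 0 - slpp V1 (scaled k u - Suc p) 0)))
                (c * lpp (weights a b E) (scaled k s - Suc p + Suc p) (scaled k t))"
        proof (rule slpp_exit_bound_column)
          show "V k \<ge> 0" "V1 k \<ge> 0" for k
            unfolding V_def V1_def using bdry_nonneg[OF A B] bdry_nonneg[OF A1 B1] lims(2) by auto
          show "weights a b E k \<ge> 0" for k
            unfolding weights_def using lims(2) ab by (auto split: prod.splits intro!: divide_nonneg_pos)
          show "V (Suc i, 0) \<le> V1 (Suc i, 0)" for i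
            unfolding V_def V1_def bdry_simps using lims(2) z ap[of "i + Suc p"] by (intro divide_left_mono) auto
          show "V (0, Suc j) \<le> c * weights a b E (p, j)" for j
          proof -
            have "E (Suc p, Suc j) * (a p + b j) \<le> E (Suc p, Suc j) * (c * (b j - z))"
              using col lims(2) by (intro mult_left_mono) auto
            then show ?thesis
              unfolding V_def bdry_simps weights_def using ab[of p j] ap(3)[of j] 
              by (simp add: field_simps)
          qed
        qed (simp_all add: V_def V1_def bdry_simps c)
        from divide_right_mono[OF this[unfolded eq], of "(real k)\<^sup>2"]
        show ?case unfolding R_def
          by (simp only: max_divide_distrib_right zero_le_power2 if_True add_divide_distrib diff_divide_distrib times_divide_eq_right)
      qed
    qed simp
  qed
  then show ?thesis by simp
qed

text \<open>
  Exchanging rows and columns turns bounds for columns into bounds for rows.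
\<close>

lemma quenched_transpose:
  assumes G: "AE E in expo_field (\<lambda>_. 1).
      (\<lambda>k. lpp (weights a b E) (scaled k s) (scaled k t) / (real k)\<^sup>2) \<longlonglongrightarrow> G"
  shows "AE E in expo_field (\<lambda>_. 1).
      (\<lambda>k. lpp (weights b a E) (scaled k t) (scaled k s) / (real k)\<^sup>2) \<longlonglongrightarrow> G"
proof -
  have "AE E in expo_field (\<lambda>_. 1).
      (\<lambda>k. lpp (weights a b (\<lambda>l. E (prod.swap l) / 1)) (scaled k s) (scaled k t) / (real k)\<^sup>2) \<longlonglongrightarrow> G"
    by (rule AE_expo_field_rescale[OF _ _ G]) auto
  moreover have "lpp (weights a b (\<lambda>l. E (prod.swap l) / 1)) m n = lpp (weights b a E) n m" for E m n
    by (subst lpp_transpose[symmetric]) (simp add: weights_def case_prod_beta' add.commute)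
  ultimately show ?thesis by simp
qed

section \<open>Birkhoff's theorem for bounded functions\<close>

definition orbit_sum :: "('a \<Rightarrow> 'a) \<Rightarrow> ('a \<Rightarrow> real) \<Rightarrow> nat \<Rightarrow> 'a \<Rightarrow> real" where
  "orbit_sum T f n x = (\<Sum>i<n. f ((T ^^ i) x))"

lemma orbit_sum_add: "orbit_sum T f (m + n) x = orbit_sum T f m x + orbit_sum T f n ((T ^^ m) x)"
proof (induction n)
  case (Suc n)
  have "(T ^^ (m + n)) x = (T ^^ n) ((T ^^ m) x)"
    by (subst add.commute) (simp add: funpow_add)
  with Suc show ?case by (simp add: orbit_sum_def)
qed (simp add: orbit_sum_def)

lemma orbit_sum_Suc: "orbit_sum T f (Suc n) x = f x + orbit_sum T f n (T x)"
  using orbit_sum_add[of T f 1 n x] by (simp add: orbit_sum_def)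

locale measure_preserving_map = prob_space M for M :: "'a measure" +
  fixes T :: "'a \<Rightarrow> 'a"
  assumes meas_T [measurable]: "T \<in> measurable M M" and distr_T: "distr M M T = M"
begin

lemma T_space: "x \<in> space M \<Longrightarrow> T x \<in> space M"
  using meas_T by (rule measurable_space)

lemma funpow_space: "x \<in> space M \<Longrightarrow> (T ^^ i) x \<in> space M"
  by (induction i) (auto simp: T_space)

lemma measurable_funpow [measurable]: "T ^^ i \<in> measurable M M"
proof (induction i)
  case (Suc i)
  then show ?case using measurable_comp[OF Suc meas_T] by simp
qed (simp add: id_def)

lemma distr_funpow: "distr M M (T ^^ i) = M"
proof (induction i)
  case (Suc i)
  have "distr M M (T ^^ Suc i) = distr (distr M M (T ^^ i)) M T"
    by (subst distr_distr) auto
  with Suc show ?case by (simp only: distr_T)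
qed (simp add: distr_id2 id_def)

lemma integral_funpow:
  fixes f :: "'a \<Rightarrow> real"
  assumes [measurable]: "f \<in> borel_measurable M"
  shows "expectation (\<lambda>x. f ((T ^^ i) x)) = expectation f"
  using integral_distr[of "T ^^ i" M M f] by (simp add: distr_funpow)

lemma measurable_orbit_sum [measurable]:
  assumes [measurable]: "f \<in> borel_measurable M"
  shows "orbit_sum T f n \<in> borel_measurable M"
  unfolding orbit_sum_def[abs_def] by measurable

text \<open>
  A covering argument in the manner of Kamae, Katznelson and Weiss. If almost every orbit has a stretch
  starting at its initial point on which the average is at least \<open>c\<close>, an orbit segment can be cut into
  such stretches, and the integral of \<open>f\<close> is at least \<open>c\<close>. Points whose stretch is longer than \<open>L\<close>
  are repaired by adding \<open>c\<close> to \<open>f\<close>, which changes the integral by little when \<open>L\<close> is large.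
\<close>

lemma integral_ge_of_frequent_averages:
  fixes f :: "'a \<Rightarrow> real"
  assumes f [measurable]: "f \<in> borel_measurable M" and bd: "\<And>x. x \<in> space M \<Longrightarrow> 0 \<le> f x \<and> f x \<le> K"
    and c: "c > 0" and AE: "AE x in M. \<exists>n\<ge>1. orbit_sum T f n x \<ge> c * real n"
  shows "expectation f \<ge> c"
proof -
  define h where "h L x \<longleftrightarrow> (\<exists>n. 1 \<le> n \<and> n \<le> L \<and> orbit_sum T f n x \<ge> c * real n)" for L x
  have [measurable]: "Measurable.pred M (h L)" for L unfolding h_def by measurable
  define f' where "f' L x = f x + (if h L x then 0 else c)" for L x
  have [measurable]: "f' L \<in> borel_measurable M" for L unfolding f'_def[abs_def] by measurable
  have f'_bd: "0 \<le> f' L x \<and> f' L x \<le> K + c" if "x \<in> space M" for L x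
    using bd[OF that] c by (auto simp: f'_def)
  have int_f: "integrable M f" using bd by (intro integrable_const_bound[of _ K]) auto
  have int_f': "integrable M (f' L)" for L using f'_bd by (intro integrable_const_bound[of _ "K + c"]) auto
  have cover: "orbit_sum T (f' L) n x \<ge> c * (real n - real L)" if "x \<in> space M" for n L x
    using that
  proof (induction n arbitrary: x rule: less_induct)
    case (less n)
    have f'_nonneg: "orbit_sum T (f' L) m y \<ge> 0" if "y \<in> space M" for m y
      unfolding orbit_sum_def using that f'_bd funpow_space by (intro sum_nonneg) auto
    show ?case
    proof (cases "n \<le> L")
      case True
      then have "c * (real n - real L) \<le> 0" using c by (simp add: mult_le_0_iff)
      with f'_nonneg[OF less.prems, of n] show ?thesis by simp
    next
      case False
      \<comment> \<open>The first stretch: a good one of length at most \<open>L\<close>, or a single repaired point.\<close>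
      obtain p where p: "1 \<le> p" "p \<le> n" "orbit_sum T (f' L) p x \<ge> c * real p"
      proof (cases "h L x")
        case True
        then obtain p where p: "1 \<le> p" "p \<le> L" "orbit_sum T f p x \<ge> c * real p" by (auto simp: h_def)
        have "orbit_sum T f p x \<le> orbit_sum T (f' L) p x"
          unfolding orbit_sum_def f'_def using c by (intro sum_mono) auto
        with p False show ?thesis by (intro that[of p]) auto
      next
        case False
        have "f' L x \<ge> c" using False bd[OF less.prems] by (simp add: f'_def)
        with \<open>\<not> n \<le> L\<close> show ?thesis by (intro that[of 1]) (auto simp: orbit_sum_def)
      qed
      have "c * (real (n - p) - real L) \<le> orbit_sum T (f' L) (n - p) ((T ^^ p) x)"
        using p False by (intro less.IH funpow_space less.prems) auto
      moreover have "orbit_sum T (f' L) n x = orbit_sum T (f' L) p x + orbit_sum T (f' L) (n - p) ((T ^^ p) x)"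
        using orbit_sum_add[of T "f' L" p "n - p" x] p by simp
      ultimately show ?thesis using p by (simp add: of_nat_diff algebra_simps)
    qed
  qed
  have ge: "c \<le> expectation (f' L)" for L
  proof -
    have mean: "c * (1 - real L * inverse (real n)) \<le> expectation (f' L)" if "n \<ge> 1" for n
    proof -
      have "c * (real n - real L) = expectation (\<lambda>x. c * (real n - real L))" by (simp add: prob_space)
      also have "\<dots> \<le> expectation (orbit_sum T (f' L) n)"
      proof (rule integral_mono)
        show "integrable M (orbit_sum T (f' L) n)"
          unfolding orbit_sum_def
          by (intro Bochner_Integration.integrable_sum integrable_const_bound[of _ "K + c"])
            (use f'_bd funpow_space in auto)
      qed (use cover in auto)
      also have "\<dots> = (\<Sum>i<n. expectation (\<lambda>x. f' L ((T ^^ i) x)))"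
        unfolding orbit_sum_def
        by (intro Bochner_Integration.integral_sum integrable_const_bound[of _ "K + c"])
            (use f'_bd funpow_space in auto)
      also have "\<dots> = real n * expectation (f' L)" by (simp add: integral_funpow)
      finally show ?thesis using that by (simp add: field_simps)
    qed
    have "(\<lambda>n. c * (1 - real L * inverse (real n))) \<longlonglongrightarrow> c * (1 - real L * 0)"
      by (intro tendsto_intros LIMSEQ_inverse_real_of_nat lim_inverse_n)
    then show ?thesis using mean by (intro LIMSEQ_le_const2[of _ c]) auto
  qed
  have "(\<lambda>L. prob {x \<in> space M. \<not> h L x}) \<longlonglongrightarrow> prob (\<Inter>L. {x \<in> space M. \<not> h L x})"
    by (intro finite_Lim_measure_decseq) (auto simp: decseq_def h_def)
  also have "prob (\<Inter>L. {x \<in> space M. \<not> h L x}) = 0"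
  proof -
    have "AE x in M. x \<notin> (\<Inter>L. {x \<in> space M. \<not> h L x})"
      using AE by eventually_elim (auto simp: h_def)
    moreover have "(\<Inter>L. {x \<in> space M. \<not> h L x}) \<in> events" by measurable
    ultimately show ?thesis by (subst prob_eq_0) auto
  qed
  finally have lim: "(\<lambda>L. prob {x \<in> space M. \<not> h L x}) \<longlonglongrightarrow> 0" .
  have split: "expectation (f' L) = expectation f + c * prob {x \<in> space M. \<not> h L x}" for L
  proof -
    have "expectation (f' L) = expectation (\<lambda>x. f x + c * indicator {x \<in> space M. \<not> h L x} x)"
      by (intro Bochner_Integration.integral_cong) (auto simp: f'_def indicator_def)
    also have "\<dots> = expectation f + c * prob {x \<in> space M. \<not> h L x}"
      using int_f by (subst Bochner_Integration.integral_add) (auto simp: emeasure_eq_measure)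
    finally show ?thesis .
  qed
  have "(\<lambda>L. expectation f + c * prob {x \<in> space M. \<not> h L x}) \<longlonglongrightarrow> expectation f + c * 0"
    by (intro tendsto_intros lim)
  then show ?thesis using ge by (intro LIMSEQ_le_const[of _ "expectation f"]) (auto simp: split)
qed

end

lemma ergodic_measure_preserving: 
  "prob_space M \<Longrightarrow> ergodic M T \<Longrightarrow> measure_preserving_map M T"
  by (simp add: ergodic_def preserves_measure_def measure_preserving_map_def measure_preserving_map_axioms_def)

text \<open>
  The set of points where the averages exceed some level above \<open>d\<close> infinitely often is strictly
  invariant, hence of measure 0 or 1, and \<open>integral_ge_of_frequent_averages\<close> excludes measure 1.
\<close>

lemma ergodic_averages_upper:
  fixes f :: "'a \<Rightarrow> real"
  assumes M: "prob_space M" and T: "ergodic M T" and f: "f \<in> borel_measurable M"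
    and bd: "\<And>x. x \<in> space M \<Longrightarrow> 0 \<le> f x \<and> f x \<le> K" and c: "c > integral\<^sup>L M f"
  shows "AE x in M. \<forall>\<^sub>F n in sequentially. orbit_sum T f n x \<le> c * real n"
proof -
  interpret measure_preserving_map M T by (rule ergodic_measure_preserving[OF M T])
  note f[measurable]
  have Ef: "expectation f \<ge> 0" using bd by (intro integral_nonneg_AE) auto
  define e where "e = (c - expectation f) / 2"
  have e: "e > 0" using c by (simp add: e_def)
  define d where "d = expectation f + e"
  have d: "d > 0" "d > expectation f" "d < c" using e Ef by (auto simp: d_def e_def field_simps)
  define Q where "Q x \<longleftrightarrow> (\<exists>j::nat. \<forall>N. \<exists>n. n \<ge> N \<and> orbit_sum T f n x > (d + 1 / real (Suc j)) * real n)" for x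
  define B where "B = {x \<in> space M. Q x}"
  have [measurable]: "B \<in> sets M" unfolding B_def Q_def by measurable
  have shift: "Q (T x) \<longleftrightarrow> Q x" if x: "x \<in> space M" for x
  proof -
    \<comment> \<open>The levels \<open>d + 1 / Suc j\<close> are lowered by one step to absorb the term by which the orbit sums of \<open>x\<close>
      and \<open>T x\<close> differ.\<close>
    have large: "\<exists>N0. \<forall>n\<ge>N0. (1 / real (Suc j) - 1 / real (Suc (Suc j))) * real n \<ge> C" for j C
    proof -
      have "1 / real (Suc (Suc j)) < 1 / real (Suc j)" by (rule divide_strict_left_mono) auto
      then have p: "1 / real (Suc j) - 1 / real (Suc (Suc j)) > 0" by simp
      obtain N0 where "real N0 > C / (1 / real (Suc j) - 1 / real (Suc (Suc j)))" using reals_Archimedean2 by blast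
      then have N0: "(1 / real (Suc j) - 1 / real (Suc (Suc j))) * real N0 \<ge> C" using p by (simp add: field_simps)
      have "(1 / real (Suc j) - 1 / real (Suc (Suc j))) * real n \<ge> C" if "n \<ge> N0" for n
        using N0 mult_left_mono[of "real N0" "real n" "1 / real (Suc j) - 1 / real (Suc (Suc j))"] that p by linarith
      then show ?thesis by blast
    qed
    show ?thesis
    proof
      assume "Q (T x)"
      then obtain j where j: "\<And>N. \<exists>n\<ge>N. orbit_sum T f n (T x) > (d + 1 / real (Suc j)) * real n" by (auto simp: Q_def)
      obtain N0 where N0: "\<And>n. n \<ge> N0 \<Longrightarrow> (1 / real (Suc j) - 1 / real (Suc (Suc j))) * real n \<ge> d + 1"
        using large by blast
      have "\<exists>n\<ge>N. orbit_sum T f n x > (d + 1 / real (Suc (Suc j))) * real n" for N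
      proof -
        obtain n where n: "n \<ge> max N N0" "orbit_sum T f n (T x) > (d + 1 / real (Suc j)) * real n" using j by blast
        have "orbit_sum T f (Suc n) x \<ge> orbit_sum T f n (T x)"
          using bd[OF x] by (simp add: orbit_sum_Suc)
        moreover have "1 / real (Suc (Suc j)) \<le> 1" by simp
        ultimately have "orbit_sum T f (Suc n) x > (d + 1 / real (Suc (Suc j))) * real (Suc n)"
          using n(2) N0[of n] n(1)
          by (simp only: of_nat_Suc[of n] distrib_left left_diff_distrib distrib_right mult_1_right max.bounded_iff True_implies_equals)
        then show ?thesis using n by (intro exI[of _ "Suc n"]) auto
      qed
      then show "Q x" unfolding Q_def by blast
    next
      assume "Q x"
      then obtain j where j: "\<And>N. \<exists>n\<ge>N. orbit_sum T f n x > (d + 1 / real (Suc j)) * real n" by (auto simp: Q_def)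
      obtain N0 where N0: "\<And>n. n \<ge> N0 \<Longrightarrow> (1 / real (Suc j) - 1 / real (Suc (Suc j))) * real n \<ge> K"
        using large by blast
      have "\<exists>n\<ge>N. orbit_sum T f n (T x) > (d + 1 / real (Suc (Suc j))) * real n" for N
      proof -
        obtain m where m: "m \<ge> Suc (max N N0)" "orbit_sum T f m x > (d + 1 / real (Suc j)) * real m" using j by blast
        then obtain n where n: "m = Suc n" by (cases m) auto
        have "orbit_sum T f n (T x) \<ge> orbit_sum T f m x - K"
          using bd[OF x] by (simp add: orbit_sum_Suc n)
        moreover have "d + 1 / real (Suc j) \<ge> 0" using d by simp
        ultimately have "orbit_sum T f n (T x) > (d + 1 / real (Suc (Suc j))) * real n"
          using m N0[of n] unfolding n by (simp only: of_nat_Suc[of n] distrib_left left_diff_distrib distrib_right) simp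
        then show ?thesis using n m by (intro exI[of _ n]) auto
      qed
      then show "Q (T x)" unfolding Q_def by blast
    qed
  qed
  have "T -` B \<inter> space M = B" using shift T_space by (auto simp: B_def)
  with T have "prob B = 0 \<or> prob B = 1" by (auto simp: ergodic_def)
  moreover have "prob B \<noteq> 1"
  proof
    assume "prob B = 1"
    then have "AE x in M. x \<in> B" by (subst (asm) prob_eq_1) auto
    then have "AE x in M. \<exists>n\<ge>1. orbit_sum T f n x \<ge> d * real n"
    proof eventually_elim
      case (elim x)
      then obtain j n where n: "n \<ge> 1" "orbit_sum T f n x > (d + 1 / real (Suc j)) * real n"
        unfolding B_def Q_def by blast
      have "d * real n \<le> (d + 1 / real (Suc j)) * real n" by (intro mult_right_mono) auto
      also note n(2)
      finally show ?case using n(1) by (intro exI[of _ n]) simp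
    qed
    from integral_ge_of_frequent_averages[OF f bd d(1) this] d(2) show False by simp
  qed
  ultimately have "AE x in M. x \<notin> B" by (subst prob_eq_0[symmetric]) auto
  then show ?thesis
    using AE_space
  proof eventually_elim
    case (elim x)
    obtain j where j: "d + 1 / real (Suc j) < c"
      using reals_Archimedean[of "c - d"] d by (auto simp: inverse_eq_divide algebra_simps)
    from elim obtain N where "\<And>n. n \<ge> N \<Longrightarrow> orbit_sum T f n x \<le> (d + 1 / real (Suc j)) * real n"
      unfolding B_def Q_def by (auto simp: not_less)
    moreover have "(d + 1 / real (Suc j)) * real n \<le> c * real n" for n using j by (intro mult_right_mono) auto
    ultimately show ?case unfolding eventually_sequentially by (meson order_trans)
  qed
qed

text \<open>
  Upper bounds for the averages of \<open>f\<close> and of \<open>K - f\<close>.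
\<close>

theorem birkhoff_bounded:
  fixes f :: "'a \<Rightarrow> real"
  assumes M: "prob_space M" and T: "ergodic M T" and f: "f \<in> borel_measurable M"
    and bd: "\<And>x. x \<in> space M \<Longrightarrow> 0 \<le> f x \<and> f x \<le> K"
  shows "AE x in M. (\<lambda>n. orbit_sum T f n x / real n) \<longlonglongrightarrow> integral\<^sup>L M f"
proof -
  interpret prob_space M by (rule M)
  have int: "integrable M f" using bd f by (intro integrable_const_bound[of _ K]) auto
  define I where "I = integral\<^sup>L M f"
  have "AE x in M. \<forall>\<^sub>F n in sequentially. orbit_sum T f n x \<le> (I + 1 / real (Suc j)) * real n" for j
    by (rule ergodic_averages_upper[OF M T f bd]) (auto simp: I_def)
  moreover have "AE x in M. \<forall>\<^sub>F n in sequentially. orbit_sum T (\<lambda>x. K - f x) n x \<le> (K - I + 1 / real (Suc j)) * real n" for j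
  proof (rule ergodic_averages_upper[OF M T, where K=K])
    show "integral\<^sup>L M (\<lambda>x. K - f x) < K - I + 1 / real (Suc j)"
      using int by (simp add: I_def prob_space)
  qed (use f bd in auto)
  ultimately have "AE x in M. \<forall>j. (\<forall>\<^sub>F n in sequentially. orbit_sum T f n x \<le> (I + 1 / real (Suc j)) * real n) \<and>
     (\<forall>\<^sub>F n in sequentially. orbit_sum T (\<lambda>x. K - f x) n x \<le> (K - I + 1 / real (Suc j)) * real n)"
    by (simp add: AE_all_countable)
  then show ?thesis unfolding I_def[symmetric]
  proof eventually_elim
    case (elim x)
    have *: "orbit_sum T (\<lambda>x. K - f x) n x = K * real n - orbit_sum T f n x" for n
      by (simp add: orbit_sum_def sum_subtractf)
    show ?case
    proof (rule order_tendstoI)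
      fix a assume "a < I"
      then obtain j where j: "1 / real (Suc j) < I - a"
        using reals_Archimedean[of "I - a"] by (auto simp: inverse_eq_divide)
      show "\<forall>\<^sub>F n in sequentially. a < orbit_sum T f n x / real n"
        using elim[rule_format, of j, THEN conjunct2] eventually_gt_at_top[of 0]
      proof eventually_elim
        case (elim n)
        then have "(I - 1 / real (Suc j)) * real n \<le> orbit_sum T f n x" unfolding * by (simp add: algebra_simps)
        then have "I - 1 / real (Suc j) \<le> orbit_sum T f n x / real n" using elim by (simp add: field_simps)
        then show ?case using j by simp
      qed
    next
      fix a assume "a > I"
      then obtain j where j: "1 / real (Suc j) < a - I"
        using reals_Archimedean[of "a - I"] by (auto simp: inverse_eq_divide)
      show "\<forall>\<^sub>F n in sequentially. orbit_sum T f n x / real n < a"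
        using elim[rule_format, of j, THEN conjunct1] eventually_gt_at_top[of 0]
      proof eventually_elim
        case (elim n)
        then have "orbit_sum T f n x / real n \<le> I + 1 / real (Suc j)" by (simp add: field_simps)
        then show ?case using j by simp
      qed
    qed
  qed
qed

section \<open>Inverse moments of a law that is bounded below\<close>

lemma inverse_diff_product:
  fixes x :: real
  assumes "x + z \<noteq> 0" "x + w \<noteq> 0"
  shows "1 / (x + w) - 1 / (x + z) = (z - w) * (1 / ((x + z) * (x + w)))"
  using assms by (simp add: field_simps)

lemma mult_le_sum_squares: "0 \<le> p \<Longrightarrow> 0 \<le> q \<Longrightarrow> p * q \<le> p * p + q * q" for p q :: real
proof -
  assume pq: "0 \<le> p" "0 \<le> q"
  then have "2 * p * q \<le> p * p + q * q" using sum_squares_bound[of p q] by (simp add: power2_eq_square)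
  moreover have "0 \<le> p * q" using pq by simp
  ultimately show ?thesis by linarith
qed

lemma inverse_ennreal_sq: "u > 0 \<Longrightarrow> inverse (ennreal u ^ 2) = ennreal (1 / (u * u))"
  by (simp add: power2_eq_square ennreal_mult''[symmetric] inverse_ennreal inverse_eq_divide del: ennreal_mult'')

text \<open>
  The law of \<open>a\<close> or of \<open>b\<close>. Below, \<open>R\<close> is the inverse moment of the shifted variable and \<open>Q\<close> gives, up to
  sign, its difference quotients. A shift is admissible (\<open>adm\<close>) if the second inverse moment is finite:
  this holds to the right of \<open>- e\<close>, and at \<open>- e\<close> itself when \<open>edge_moment\<close> is finite.
\<close>

locale edge_law = prob_space \<eta> for \<eta> :: "real measure" +
  fixes e :: real
  assumes sets_law [measurable_cong]: "sets \<eta> = sets borel" and AE_edge: "AE x in \<eta>. x \<ge> e"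
begin

definition edge_moment :: ennreal where
  "edge_moment = (\<integral>\<^sup>+x. inverse (ennreal (x - e) ^ 2) \<partial>\<eta>)"

definition adm :: "real \<Rightarrow> bool" where
  "adm z \<longleftrightarrow> z > - e \<or> z = - e \<and> edge_moment < \<infinity>"

definition R :: "real \<Rightarrow> real" where
  "R z = (\<integral>x. 1 / (x + z) \<partial>\<eta>)"

definition Q :: "real \<Rightarrow> real \<Rightarrow> real" where
  "Q z w = (\<integral>x. 1 / ((x + z) * (x + w)) \<partial>\<eta>)"

lemma adm_interior: "z > - e \<Longrightarrow> adm z"
  by (simp add: adm_def)

lemma adm_ge: "adm z \<Longrightarrow> z \<ge> - e"
  by (auto simp: adm_def)

lemma adm_mono: "adm z \<Longrightarrow> z \<le> w \<Longrightarrow> adm w"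
  by (auto simp: adm_def)

lemma measurable_id_law [measurable]: "(\<lambda>x. x) \<in> borel_measurable \<eta>"
  by (simp cong: measurable_cong_sets add: sets_law)

lemma AE_pos: assumes "adm z" shows "AE x in \<eta>. x + z > 0"
proof (cases "z > - e")
  case True
  show ?thesis using AE_edge by eventually_elim (use True in simp)
next
  case False
  with assms have z: "z = - e" "edge_moment < \<infinity>" by (auto simp: adm_def)
  then have "AE x in \<eta>. inverse (ennreal (x - e) ^ 2) \<noteq> \<infinity>"
    unfolding edge_moment_def by (intro nn_integral_noteq_infinite) auto
  then show ?thesis
  proof eventually_elim
    case (elim x)
    show ?case
    proof (rule ccontr)
      assume "\<not> x + z > 0"
      then have "ennreal (x - e) = 0" using z by (simp add: ennreal_neg)
      with elim show False by simp
    qed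
  qed
qed

lemma square_integrable: assumes "adm z" shows "integrable \<eta> (\<lambda>x. 1 / ((x + z) * (x + z)))"
proof (cases "z > - e")
  case True
  have b: "AE x in \<eta>. norm (1 / ((x + z) * (x + z))) \<le> 1 / ((z + e) * (z + e))"
    using AE_edge by eventually_elim (use True in \<open>auto intro!: divide_left_mono mult_mono mult_pos_pos\<close>)
  show ?thesis by (rule integrable_const_bound[OF b]) measurable
next
  case False
  with assms have z: "z = - e" "edge_moment < \<infinity>" by (auto simp: adm_def)
  have "(\<integral>\<^sup>+x. ennreal (norm (1 / ((x + z) * (x + z)))) \<partial>\<eta>) = edge_moment"
    unfolding edge_moment_def
  proof (rule nn_integral_cong_AE)
    show "AE x in \<eta>. ennreal (norm (1 / ((x + z) * (x + z)))) = inverse (ennreal (x - e) ^ 2)"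
      using AE_pos[OF assms] by eventually_elim (use z in \<open>simp add: inverse_ennreal_sq\<close>)
  qed
  then show ?thesis using z by (intro integrableI_bounded) auto
qed

lemma product_integrable: assumes "adm z" "adm w" shows "integrable \<eta> (\<lambda>x. 1 / ((x + z) * (x + w)))"
proof (rule Bochner_Integration.integrable_bound)
  show "integrable \<eta> (\<lambda>x. 1 / ((x + z) * (x + z)) + 1 / ((x + w) * (x + w)))"
    by (intro Bochner_Integration.integrable_add square_integrable assms)
  show "AE x in \<eta>. norm (1 / ((x + z) * (x + w))) \<le> norm (1 / ((x + z) * (x + z)) + 1 / ((x + w) * (x + w)))"
    using AE_pos[OF assms(1)] AE_pos[OF assms(2)]
  proof eventually_elim
    case (elim x)
    have "1 / (x + z) * (1 / (x + w)) \<le> 1 / (x + z) * (1 / (x + z)) + 1 / (x + w) * (1 / (x + w))"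
      using elim by (intro mult_le_sum_squares) auto
    then show ?case using elim by simp
  qed
qed measurable

lemma inverse_integrable: assumes "adm z" shows "integrable \<eta> (\<lambda>x. 1 / (x + z))"
proof (rule Bochner_Integration.integrable_bound)
  show "integrable \<eta> (\<lambda>x. 1 + 1 / ((x + z) * (x + z)))"
    by (intro Bochner_Integration.integrable_add square_integrable assms) simp
  show "AE x in \<eta>. norm (1 / (x + z)) \<le> norm (1 + 1 / ((x + z) * (x + z)))"
    using AE_pos[OF assms(1)]
  proof eventually_elim
    case (elim x)
    have "1 * (1 / (x + z)) \<le> 1 * 1 + 1 / (x + z) * (1 / (x + z))"
      using elim by (intro mult_le_sum_squares) auto
    then show ?case using elim by simp
  qed
qed measurable

lemma nn_integral_R: assumes "adm z" shows "(\<integral>\<^sup>+x. inverse (ennreal (x + z)) \<partial>\<eta>) = ennreal (R z)"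
proof -
  have "(\<integral>\<^sup>+x. inverse (ennreal (x + z)) \<partial>\<eta>) = (\<integral>\<^sup>+x. ennreal (1 / (x + z)) \<partial>\<eta>)"
    by (rule nn_integral_cong_AE, use AE_pos[OF assms] in eventually_elim)
      (simp add: inverse_ennreal inverse_eq_divide)
  also have "\<dots> = ennreal (R z)" unfolding R_def
    by (rule nn_integral_eq_integral[OF inverse_integrable[OF assms]], use AE_pos[OF assms] in eventually_elim) simp
  finally show ?thesis .
qed

lemma nn_integral_Q: assumes "adm z" shows "(\<integral>\<^sup>+x. inverse (ennreal (x + z) ^ 2) \<partial>\<eta>) = ennreal (Q z z)"
proof -
  have "(\<integral>\<^sup>+x. inverse (ennreal (x + z) ^ 2) \<partial>\<eta>) = (\<integral>\<^sup>+x. ennreal (1 / ((x + z) * (x + z))) \<partial>\<eta>)"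
    by (rule nn_integral_cong_AE, use AE_pos[OF assms] in eventually_elim) (simp add: inverse_ennreal_sq)
  also have "\<dots> = ennreal (Q z z)" unfolding Q_def
    by (rule nn_integral_eq_integral[OF square_integrable[OF assms]], use AE_pos[OF assms] in eventually_elim) simp
  finally show ?thesis .
qed

lemma edge_moment_Q: "adm (- e) \<Longrightarrow> edge_moment = ennreal (Q (- e) (- e))"
  using nn_integral_Q[of "- e"] by (simp add: edge_moment_def)

lemma edge_moment_infinite: "\<not> adm (- e) \<Longrightarrow> edge_moment = \<infinity>"
  using top.not_eq_extremum[of edge_moment] by (auto simp: adm_def)

lemma R_nonneg: assumes "adm z" shows "R z \<ge> 0"
  unfolding R_def by (intro integral_nonneg_AE, use AE_pos[OF assms] in eventually_elim) simp

lemma R_diff: assumes "adm z" "adm w" shows "R w - R z = (z - w) * Q z w"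
proof -
  have "R w - R z = (\<integral>x. 1 / (x + w) - 1 / (x + z) \<partial>\<eta>)"
    unfolding R_def using assms inverse_integrable by (subst Bochner_Integration.integral_diff) auto
  also have "\<dots> = (\<integral>x. (z - w) * (1 / ((x + z) * (x + w))) \<partial>\<eta>)"
  proof (rule integral_cong_AE)
    show "AE x in \<eta>. 1 / (x + w) - 1 / (x + z) = (z - w) * (1 / ((x + z) * (x + w)))"
      using AE_pos[OF assms(1)] AE_pos[OF assms(2)] by eventually_elim (simp add: inverse_diff_product)
  qed measurable
  also have "\<dots> = (z - w) * Q z w" unfolding Q_def by (rule integral_mult_right_zero)
  finally show ?thesis .
qed

lemma Q_commute: "Q z w = Q w z"
  by (simp add: Q_def mult.commute)

lemma Q_pos: assumes "adm z" "adm w" shows "Q z w > 0"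
proof -
  have "(\<integral>x. 0 \<partial>\<eta>) < Q z w" unfolding Q_def
    by (rule integral_less_AE_space[OF _ product_integrable[OF assms]])
      (simp, use AE_pos[OF assms(1)] AE_pos[OF assms(2)] in \<open>eventually_elim, simp\<close>, simp add: emeasure_space_1)
  then show ?thesis by simp
qed

lemma Q_strict_antimono: assumes "adm z" "adm w" "z < z'" shows "Q z' w < Q z w"
  unfolding Q_def
proof (rule integral_less_AE_space)
  have z': "adm z'" using assms adm_mono by fastforce
  show "integrable \<eta> (\<lambda>x. 1 / ((x + z') * (x + w)))" "integrable \<eta> (\<lambda>x. 1 / ((x + z) * (x + w)))"
    using product_integrable z' assms by auto
  show "AE x in \<eta>. 1 / ((x + z') * (x + w)) < 1 / ((x + z) * (x + w))"
    using AE_pos[OF assms(1)] AE_pos[OF assms(2)] AE_pos[OF z']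
    by eventually_elim (use assms in \<open>auto intro!: divide_strict_left_mono mult_strict_right_mono mult_pos_pos\<close>)
qed (simp add: emeasure_space_1)

lemma Q_antimono: "adm z \<Longrightarrow> adm w \<Longrightarrow> z \<le> z' \<Longrightarrow> Q z' w \<le> Q z w"
  using Q_strict_antimono[of z w z'] by (cases "z = z'") auto

lemma Q_antimono2: assumes "adm z" "adm w" "z \<le> z'" "w \<le> w'" shows "Q z' w' \<le> Q z w"
proof -
  have "Q z' w' \<le> Q z w'" by (rule Q_antimono[OF assms(1) adm_mono[OF assms(2,4)] assms(3)])
  also have "\<dots> \<le> Q z w" using Q_antimono[OF assms(2,1,4)] by (simp add: Q_commute)
  finally show ?thesis .
qed

text \<open>
  Away from the end point the integrands have uniformly bounded difference quotients.
\<close>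

lemma Q_lipschitz:
  assumes d: "d > 0" and z: "z \<ge> d - e" and w: "w \<ge> d - e" and w': "w' \<ge> d - e"
  shows "\<bar>Q z w - Q z w'\<bar> \<le> \<bar>w - w'\<bar> / (d * d * d)"
proof -
  have a: "adm z" "adm w" "adm w'" using d z w w' by (auto intro!: adm_interior)
  have "Q z w - Q z w' = (\<integral>x. 1 / ((x + z) * (x + w)) - 1 / ((x + z) * (x + w')) \<partial>\<eta>)"
    unfolding Q_def using a product_integrable by (subst Bochner_Integration.integral_diff) auto
  also have "\<bar>\<dots>\<bar> \<le> (\<integral>x. \<bar>w - w'\<bar> / (d * d * d) \<partial>\<eta>)"
  proof (rule integral_abs_bound[THEN order_trans], rule integral_mono_AE)
    show "integrable \<eta> (\<lambda>x. \<bar>1 / ((x + z) * (x + w)) - 1 / ((x + z) * (x + w'))\<bar>)"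
      using a product_integrable by (intro integrable_abs Bochner_Integration.integrable_diff) auto
    show "AE x in \<eta>. \<bar>1 / ((x + z) * (x + w)) - 1 / ((x + z) * (x + w'))\<bar> \<le> \<bar>w - w'\<bar> / (d * d * d)"
      using AE_edge
    proof eventually_elim
      case (elim x)
      have g: "x + z \<ge> d" "x + w \<ge> d" "x + w' \<ge> d" using elim z w w' by auto
      have "1 / (p * a) - 1 / (p * b) = (b - a) / (p * a * b)" if "p \<noteq> 0" "a \<noteq> 0" "b \<noteq> 0" for p a b :: real
        using that by (simp add: field_simps)
      from this[of "x + z" "x + w" "x + w'"]
      have "1 / ((x + z) * (x + w)) - 1 / ((x + z) * (x + w')) = (w' - w) / ((x + z) * (x + w) * (x + w'))"
        using g d by simp
      also have "\<bar>\<dots>\<bar> = \<bar>w - w'\<bar> / ((x + z) * (x + w) * (x + w'))"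
        using g d by (simp add: abs_divide abs_mult abs_minus_commute)
      also have "\<dots> \<le> \<bar>w - w'\<bar> / (d * d * d)"
        using g d by (intro divide_left_mono mult_mono mult_pos_pos) auto
      finally show ?case .
    qed
  qed simp
  also have "\<dots> = \<bar>w - w'\<bar> / (d * d * d)" by (simp add: prob_space)
  finally show ?thesis .
qed

lemma Q_tendsto:
  assumes "z > - e" shows "((\<lambda>w. Q z w) \<longlongrightarrow> Q z z) (at z)"
proof -
  define d where "d = (z + e) / 2"
  have d: "d > 0" "z > d - e" using assms by (auto simp: d_def field_simps)
  have "((\<lambda>w. \<bar>w - z\<bar> / (d * d * d)) \<longlongrightarrow> \<bar>z - z\<bar> / (d * d * d)) (at z)"
    using d by (intro tendsto_intros) auto
  then have lim: "((\<lambda>w. \<bar>w - z\<bar> / (d * d * d)) \<longlongrightarrow> 0) (at z)" by simp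
  have "\<forall>\<^sub>F w in at z. w > d - e" using d by (intro order_tendstoD(1)[OF tendsto_ident_at]) auto
  then have "\<forall>\<^sub>F w in at z. norm (Q z w - Q z z) \<le> \<bar>w - z\<bar> / (d * d * d)"
    by eventually_elim (use d Q_lipschitz[of d z] in auto)
  from Lim_null_comparison[OF this lim] show ?thesis by (simp add: LIM_zero_iff)
qed

lemma Q_diagonal_continuous: "continuous_on {- e<..} (\<lambda>z. Q z z)"
proof (rule continuous_at_imp_continuous_on, intro ballI)
  fix z assume "z \<in> {- e<..}"
  then have z: "z > - e" by simp
  define d where "d = (z + e) / 2"
  have d: "d > 0" "z > d - e" using z by (auto simp: d_def field_simps)
  have "((\<lambda>w. 2 * (\<bar>w - z\<bar> / (d * d * d))) \<longlongrightarrow> 2 * (\<bar>z - z\<bar> / (d * d * d))) (at z)"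
    using d by (intro tendsto_intros) auto
  then have lim: "((\<lambda>w. 2 * (\<bar>w - z\<bar> / (d * d * d))) \<longlongrightarrow> 0) (at z)" by simp
  have "\<forall>\<^sub>F w in at z. w > d - e" using d by (intro order_tendstoD(1)[OF tendsto_ident_at]) auto
  then have "\<forall>\<^sub>F w in at z. norm (Q w w - Q z z) \<le> 2 * (\<bar>w - z\<bar> / (d * d * d))"
  proof eventually_elim
    case (elim w)
    then have "\<bar>Q w w - Q w z\<bar> \<le> \<bar>w - z\<bar> / (d * d * d)" "\<bar>Q z w - Q z z\<bar> \<le> \<bar>w - z\<bar> / (d * d * d)"
      using d Q_lipschitz[of d w w z] Q_lipschitz[of d z w z] by auto
    then show ?case using Q_commute[of z w] by simp
  qed
  from Lim_null_comparison[OF this lim] show "isCont (\<lambda>z. Q z z) z" by (simp add: isCont_def LIM_zero_iff)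
qed

text \<open>
  At an admissible end point the limit is one-sided; it follows from \<open>R_diff\<close>, because there \<open>Q\<close> is
  bounded by its value at the end point.
\<close>

lemma R_tendsto:
  assumes "adm z" shows "(R \<longlongrightarrow> R z) (at z within {- e..})"
proof -
  obtain z0 where z0: "adm z0" "z0 \<le> z" "\<forall>\<^sub>F w in at z within {- e..}. w \<ge> z0"
  proof (cases "z > - e")
    case True
    show ?thesis
    proof (rule that[of "(z - e) / 2"])
      have "\<forall>\<^sub>F w in at z within {- e..}. w > (z - e) / 2"
        using True by (intro order_tendstoD(1)[OF tendsto_ident_at]) auto
      then show "\<forall>\<^sub>F w in at z within {- e..}. w \<ge> (z - e) / 2" by eventually_elim simp
    qed (use True in \<open>auto intro!: adm_interior\<close>)
  next
    case False
    then have "z = - e" using assms adm_ge by fastforce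
    then show ?thesis using assms by (intro that[of z]) (auto simp: eventually_at_filter)
  qed
  have "((\<lambda>w. \<bar>z - w\<bar> * Q z0 z0) \<longlongrightarrow> \<bar>z - z\<bar> * Q z0 z0) (at z within {- e..})" by (intro tendsto_intros)
  then have lim: "((\<lambda>w. \<bar>z - w\<bar> * Q z0 z0) \<longlongrightarrow> 0) (at z within {- e..})" by simp
  have "\<forall>\<^sub>F w in at z within {- e..}. norm (R w - R z) \<le> \<bar>z - w\<bar> * Q z0 z0"
    using z0(3)
  proof eventually_elim
    case (elim w)
    have w: "adm w" using z0 elim adm_mono by blast
    have "Q z w \<le> Q z0 z0" using Q_antimono2[of z0 z0 z w] z0 elim by simp
    moreover have "Q z w > 0" using Q_pos assms w by simp
    ultimately show ?case using R_diff[OF assms w] by (simp add: abs_mult mult_left_mono)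
  qed
  from Lim_null_comparison[OF this lim] show ?thesis by (simp add: LIM_zero_iff)
qed

text \<open>
  Fatou's lemma transports bounds on second inverse moments to the end point.
\<close>

lemma edge_moment_le:
  assumes C: "\<And>z. - e < z \<Longrightarrow> z < - e + d \<Longrightarrow> Q z z \<le> C" and d: "d > 0"
  shows "edge_moment \<le> ennreal C"
proof -
  \<comment> \<open>The shift by 2 keeps the points inside the interval.\<close>
  define z where "z n = - e + d / real (n + 2)" for n
  have z: "z n > - e" "z n < - e + d" for n
    using d divide_strict_left_mono[of 1 "real (n + 2)" d] by (auto simp: z_def)
  have zlim: "z \<longlonglongrightarrow> - e"
  proof -
    have "(\<lambda>n. d / real (n + 2)) \<longlonglongrightarrow> 0"
      by (rule LIMSEQ_ignore_initial_segment[OF lim_const_over_n])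
    then have "(\<lambda>n. - e + d / real (n + 2)) \<longlonglongrightarrow> - e + 0" by (intro tendsto_intros)
    then show ?thesis by (simp add: z_def[abs_def])
  qed
  have "(\<lambda>n. inverse (ennreal (x + z n) ^ 2)) \<longlonglongrightarrow> inverse (ennreal (x - e) ^ 2)" for x
  proof -
    have inv: "continuous_on UNIV (inverse :: ennreal \<Rightarrow> ennreal)"
      by (intro continuous_on_inverse_ennreal continuous_on_id)
    have "(\<lambda>n. x + z n) \<longlonglongrightarrow> x + - e" by (intro tendsto_intros zlim)
    then have "(\<lambda>n. inverse (ennreal (x + z n) * ennreal (x + z n))) \<longlonglongrightarrow> inverse (ennreal (x + - e) * ennreal (x + - e))"
      by (intro continuous_on_tendsto_compose[OF inv] tendsto_mult_ennreal tendsto_ennrealI) auto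
    then show ?thesis by (simp add: power2_eq_square)
  qed
  then have "edge_moment = (\<integral>\<^sup>+x. liminf (\<lambda>n. inverse (ennreal (x + z n) ^ 2)) \<partial>\<eta>)"
    unfolding edge_moment_def by (intro nn_integral_cong lim_imp_Liminf[symmetric]) auto
  also have "\<dots> \<le> liminf (\<lambda>n. \<integral>\<^sup>+x. inverse (ennreal (x + z n) ^ 2) \<partial>\<eta>)"
    by (intro nn_integral_liminf) measurable
  also have "\<dots> = liminf (\<lambda>n. ennreal (Q (z n) (z n)))"
    using nn_integral_Q[OF adm_interior[OF z(1)]] by simp
  also have "\<dots> \<le> liminf (\<lambda>n. ennreal C)"
    using C z by (intro Liminf_mono always_eventually allI ennreal_leI) auto
  also have "\<dots> = ennreal C" by (simp add: Liminf_const)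
  finally show ?thesis .
qed

end

section \<open>The variational problem\<close>

text \<open>
  The laws of \<open>a\<close> and \<open>b\<close>, with the objective \<open>h\<close> of the variational problem below. As a function of
  \<open>z\<close> it has the derivative \<open>F\<close>, which is strictly increasing. An end point of the interval \<open>I\<close> is
  admissible when the corresponding second inverse moment is finite; then \<open>h\<close> and \<open>F\<close> extend to it.
\<close>

locale law_pair = A: edge_law \<alpha> a0 + B: edge_law \<beta> b0 for \<alpha> :: "real measure" and a0 :: real and \<beta> :: "real measure" and b0 :: real +
  assumes edges: "a0 + b0 > 0"
begin

definition adm :: "real \<Rightarrow> bool" where
  "adm z \<longleftrightarrow> A.adm z \<and> B.adm (- z)"

definition h :: "real \<Rightarrow> real \<Rightarrow> real \<Rightarrow> real" where
  "h s t z = s * A.R z + t * B.R (- z)"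

definition F :: "real \<Rightarrow> real \<Rightarrow> real \<Rightarrow> real" where
  "F s t z = t * B.Q (- z) (- z) - s * A.Q z z"

abbreviation I :: "real set" where "I \<equiv> {- a0<..<b0}"

definition \<gamma> :: "real \<Rightarrow> real \<Rightarrow> real" where
  "\<gamma> s t = (INF z\<in>I. h s t z)"

lemma I_nonempty: "I \<noteq> {}"
  using edges by (auto simp: greaterThanLessThan_empty_iff)

lemma adm_I: "z \<in> I \<Longrightarrow> adm z"
  by (auto simp: adm_def intro: A.adm_interior B.adm_interior)

lemma adm_bounds: "adm z \<Longrightarrow> - a0 \<le> z \<and> z \<le> b0"
  using A.adm_ge[of z] B.adm_ge[of "- z"] by (auto simp: adm_def)

lemma adm_left: "A.adm (- a0) \<Longrightarrow> adm (- a0)"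
  using edges by (auto simp: adm_def intro: B.adm_interior)

lemma h_nonneg: "adm z \<Longrightarrow> s \<ge> 0 \<Longrightarrow> t \<ge> 0 \<Longrightarrow> h s t z \<ge> 0"
  by (auto simp: h_def adm_def A.R_nonneg B.R_nonneg)

lemma h_diff: "adm z \<Longrightarrow> adm w \<Longrightarrow> h s t w - h s t z = (w - z) * (t * B.Q (- z) (- w) - s * A.Q z w)"
proof -
  assume "adm z" "adm w"
  then have "A.R w - A.R z = (z - w) * A.Q z w" "B.R (- w) - B.R (- z) = (w - z) * B.Q (- z) (- w)"
    using A.R_diff[of z w] B.R_diff[of "- z" "- w"] by (auto simp: adm_def)
  moreover have "h s t w - h s t z = s * (A.R w - A.R z) + t * (B.R (- w) - B.R (- z))"
    by (simp add: h_def algebra_simps)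
  ultimately show ?thesis by (simp only:) (simp add: algebra_simps)
qed

text \<open>
  The difference quotient of \<open>h\<close> between \<open>z\<close> and \<open>w\<close> is strictly larger than \<open>F\<close> at \<open>z\<close>.
\<close>

lemma h_above:
  assumes "adm z" "adm w" "z < w" "F s t z \<ge> 0" "s > 0" "t > 0"
  shows "h s t z < h s t w"
proof -
  have "t * B.Q (- z) (- z) < t * B.Q (- w) (- z)"
    using assms by (intro mult_strict_left_mono B.Q_strict_antimono) (auto simp: adm_def)
  moreover have "s * A.Q w z < s * A.Q z z"
    using assms by (intro mult_strict_left_mono A.Q_strict_antimono) (auto simp: adm_def)
  ultimately have "t * B.Q (- z) (- w) - s * A.Q z w > 0"
    using assms(4) by (simp add: F_def A.Q_commute[of z w] B.Q_commute[of "- z" "- w"])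
  then have "(w - z) * (t * B.Q (- z) (- w) - s * A.Q z w) > 0" using assms(3) by simp
  then show ?thesis using h_diff[OF assms(1,2), of s t] by simp
qed

lemma h_below:
  assumes "adm z" "adm w" "w < z" "F s t z \<le> 0" "s > 0" "t > 0"
  shows "h s t z < h s t w"
proof -
  have "t * B.Q (- w) (- z) < t * B.Q (- z) (- z)"
    using assms by (intro mult_strict_left_mono B.Q_strict_antimono) (auto simp: adm_def)
  moreover have "s * A.Q z z < s * A.Q w z"
    using assms by (intro mult_strict_left_mono A.Q_strict_antimono) (auto simp: adm_def)
  ultimately have "t * B.Q (- z) (- w) - s * A.Q z w < 0"
    using assms(4) by (simp add: F_def A.Q_commute[of z w] B.Q_commute[of "- z" "- w"])
  then have "(w - z) * (t * B.Q (- z) (- w) - s * A.Q z w) > 0" using assms(3) by (simp add: mult_neg_neg)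
  then show ?thesis using h_diff[OF assms(1,2), of s t] by simp
qed

lemma F_strict_mono:
  assumes "adm z" "adm w" "z < w" "s > 0" "t > 0" shows "F s t z < F s t w"
proof -
  have "t * B.Q (- z) (- z) < t * B.Q (- w) (- z)" "t * B.Q (- z) (- w) < t * B.Q (- w) (- w)"
    using assms by (auto intro!: mult_strict_left_mono B.Q_strict_antimono simp: adm_def)
  moreover have "s * A.Q w z < s * A.Q z z" "s * A.Q w w < s * A.Q z w"
    using assms by (auto intro!: mult_strict_left_mono A.Q_strict_antimono simp: adm_def)
  ultimately show ?thesis by (simp add: F_def A.Q_commute[of z w] B.Q_commute[of "- z" "- w"])
qed

lemma F_continuous: "continuous_on I (F s t)"
proof -
  have "continuous_on I (\<lambda>z. A.Q z z)"
    by (rule continuous_on_subset[OF A.Q_diagonal_continuous]) auto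
  moreover have "continuous_on I (\<lambda>z. B.Q (- z) (- z))"
    by (rule continuous_on_compose2[OF B.Q_diagonal_continuous, of _ uminus]) (auto intro: continuous_intros)
  ultimately show ?thesis unfolding F_def[abs_def] by (intro continuous_intros)
qed

lemma \<gamma>_le: "z \<in> I \<Longrightarrow> s \<ge> 0 \<Longrightarrow> t \<ge> 0 \<Longrightarrow> \<gamma> s t \<le> h s t z"
proof -
  assume z: "z \<in> I" and st: "s \<ge> 0" "t \<ge> 0"
  have "bdd_below (h s t ` I)"
    by (rule bdd_belowI2) (rule h_nonneg[OF adm_I st])
  then show ?thesis unfolding \<gamma>_def using z by (rule cINF_lower)
qed

lemma \<gamma>_nonneg: "s \<ge> 0 \<Longrightarrow> t \<ge> 0 \<Longrightarrow> \<gamma> s t \<ge> 0"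
  unfolding \<gamma>_def by (rule cINF_greatest[OF I_nonempty]) (rule h_nonneg[OF adm_I])

lemma h_tendsto:
  assumes "adm z" shows "((h s t) \<longlongrightarrow> h s t z) (at z within {- a0..b0})"
proof -
  have 1: "(A.R \<longlongrightarrow> A.R z) (at z within {- a0..b0})"
    by (rule tendsto_within_subset[OF A.R_tendsto]) (use assms in \<open>auto simp: adm_def\<close>)
  have "((\<lambda>w. B.R (- w)) \<longlongrightarrow> B.R (- z)) (at z within {- a0..b0})"
  proof (rule filterlim_compose[OF B.R_tendsto])
    show "B.adm (- z)" using assms by (simp add: adm_def)
    show "filterlim uminus (at (- z) within {- b0..}) (at z within {- a0..b0})"
      by (auto simp: filterlim_at eventually_at_filter intro!: tendsto_intros)
  qed
  with 1 show ?thesis unfolding h_def[abs_def] by (intro tendsto_intros)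
qed

lemma within_I_nontrivial: "- a0 \<le> z \<Longrightarrow> z \<le> b0 \<Longrightarrow> at z within I \<noteq> bot"
proof -
  assume z: "- a0 \<le> z" "z \<le> b0"
  have "z islimpt I"
  proof (cases "z < b0")
    case True
    show ?thesis by (rule islimpt_subset[OF islimpt_greaterThanLessThan1[OF True]]) (use z in auto)
  next
    case False
    then show ?thesis using z edges islimpt_greaterThanLessThan2[of "- a0" b0] by simp
  qed
  then show ?thesis by (simp add: trivial_limit_within)
qed

text \<open>
  The infimum runs over the open interval; an admissible end point is reached by continuity of \<open>h\<close>.
\<close>

lemma \<gamma>_le_adm:
  assumes z: "adm z" and st: "s \<ge> 0" "t \<ge> 0"
  shows "\<gamma> s t \<le> h s t z"
proof (rule tendsto_le)
  show "((h s t) \<longlongrightarrow> h s t z) (at z within I)"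
    by (rule tendsto_within_subset[OF h_tendsto[OF z]]) auto
  show "at z within I \<noteq> bot" using adm_bounds[OF z] by (intro within_I_nontrivial) auto
  show "((\<lambda>_. \<gamma> s t) \<longlongrightarrow> \<gamma> s t) (at z within I)" by simp
  show "\<forall>\<^sub>F w in at z within I. \<gamma> s t \<le> h s t w"
    unfolding eventually_at_filter using \<gamma>_le st by (intro always_eventually) blast
qed

lemma \<gamma>_eqI:
  assumes "adm z" "s \<ge> 0" "t \<ge> 0" "\<And>w. w \<in> I \<Longrightarrow> h s t z \<le> h s t w"
  shows "\<gamma> s t = h s t z"
proof (rule antisym)
  show "h s t z \<le> \<gamma> s t" unfolding \<gamma>_def using I_nonempty assms by (intro cINF_greatest) auto
qed (rule \<gamma>_le_adm[OF assms(1-3)])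

text \<open>
  The sign change of \<open>F\<close>, phrased so that it also makes sense when \<open>F\<close> has a constant sign on the
  open interval and the sign change sits at an end point.
\<close>

definition critical :: "real \<Rightarrow> real \<Rightarrow> real \<Rightarrow> bool" where
  "critical s t z \<longleftrightarrow> adm z \<and> (\<forall>w\<in>I. (w < z \<longleftrightarrow> F s t w < 0) \<and> (z < w \<longleftrightarrow> F s t w > 0))"

lemma critical_zero:
  assumes "z \<in> I" "F s t z = 0" "s > 0" "t > 0"
  shows "critical s t z"
  unfolding critical_def
proof (intro conjI ballI)
  show z: "adm z" by (rule adm_I[OF assms(1)])
  fix w assume "w \<in> I"
  then have "w < z \<Longrightarrow> F s t w < 0" "z < w \<Longrightarrow> F s t w > 0"
    using F_strict_mono[of z w s t] F_strict_mono[of w z s t] z adm_I[of w] assms by auto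
  then show "w < z \<longleftrightarrow> F s t w < 0" "z < w \<longleftrightarrow> F s t w > 0"
    using assms(2) by (cases w z rule: linorder_cases; simp)+
qed

text \<open>
  Nonnegativity of \<open>F\<close> bounds the second inverse moment of \<open>\<alpha>\<close> by that of \<open>\<beta>\<close>, which stays bounded near
  \<open>- a0\<close> because \<open>a0 + b0 > 0\<close>. Fatou's lemma makes the end point admissible.
\<close>

lemma left_adm_of_F_pos:
  assumes st: "s > 0" "t > 0" and F: "\<And>w. w \<in> I \<Longrightarrow> F s t w \<ge> 0"
  shows "A.adm (- a0)" "s * A.Q (- a0) (- a0) \<le> t * B.Q a0 a0"
proof -
  have bound: "A.edge_moment \<le> ennreal (t / s * B.Q (- v) (- v))" if v: "v \<in> I" for v
  proof (rule A.edge_moment_le)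
    show "v + a0 > 0" using v by simp
    fix z assume z: "- a0 < z" "z < - a0 + (v + a0)"
    have zI: "z \<in> I" using z v by simp
    have "s * A.Q z z \<le> t * B.Q (- z) (- z)" using F[OF zI] by (simp add: F_def)
    also have "\<dots> \<le> t * B.Q (- v) (- v)"
      using adm_I[OF v] adm_I[OF zI] z st by (intro mult_left_mono B.Q_antimono2) (auto simp: adm_def)
    finally show "A.Q z z \<le> t / s * B.Q (- v) (- v)" using st by (simp add: field_simps)
  qed
  from I_nonempty obtain v0 where v0: "v0 \<in> I" by blast
  show adm: "A.adm (- a0)" using bound[OF v0] le_less_trans[OF _ ennreal_less_top] by (auto simp: A.adm_def)
  have le: "s * A.Q (- a0) (- a0) \<le> t * B.Q (- v) (- v)" if v: "v \<in> I" for v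
  proof -
    have "B.Q (- v) (- v) > 0" using adm_I[OF v] by (auto simp: adm_def intro: B.Q_pos)
    then have "A.Q (- a0) (- a0) \<le> t / s * B.Q (- v) (- v)"
      using bound[OF v] st by (simp add: A.edge_moment_Q[OF adm])
    then show ?thesis using st by (simp add: field_simps)
  qed
  have "((\<lambda>v. t * B.Q (- v) (- v)) \<longlongrightarrow> t * B.Q (- (- a0)) (- (- a0))) (at (- a0) within I)"
  proof (intro tendsto_intros)
    have "continuous (at (- a0) within {..<b0}) (\<lambda>v. B.Q (- v) (- v))"
    proof -
      have "continuous_on {..<b0} (\<lambda>v. B.Q (- v) (- v))"
        by (rule continuous_on_compose2[OF B.Q_diagonal_continuous, of _ uminus]) (auto intro: continuous_intros)
      then show ?thesis using edges by (simp add: continuous_on_eq_continuous_within)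
    qed
    then show "((\<lambda>v. B.Q (- v) (- v)) \<longlongrightarrow> B.Q (- (- a0)) (- (- a0))) (at (- a0) within I)"
      unfolding continuous_within by (rule tendsto_within_subset) auto
  qed
  then have lim: "((\<lambda>v. t * B.Q (- v) (- v)) \<longlongrightarrow> t * B.Q a0 a0) (at (- a0) within I)" by simp
  show "s * A.Q (- a0) (- a0) \<le> t * B.Q a0 a0"
  proof (rule tendsto_le[OF _ lim tendsto_const])
    show "at (- a0) within I \<noteq> bot" using edges by (intro within_I_nontrivial) auto
    show "\<forall>\<^sub>F v in at (- a0) within I. s * A.Q (- a0) (- a0) \<le> t * B.Q (- v) (- v)"
      unfolding eventually_at_filter by (rule always_eventually) (use le in blast)
  qed
qed

lemma critical_left:
  assumes st: "s > 0" "t > 0" and F: "\<And>w. w \<in> I \<Longrightarrow> F s t w > 0"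
  shows "critical s t (- a0)"
  unfolding critical_def
proof (intro conjI ballI)
  show "adm (- a0)" by (rule adm_left[OF left_adm_of_F_pos(1)[OF st less_imp_le[OF F]]])
  fix w assume w: "w \<in> I"
  then show "w < - a0 \<longleftrightarrow> F s t w < 0" "- a0 < w \<longleftrightarrow> F s t w > 0" using F[OF w] by auto
qed

lemma F_cases:
  obtains (zero) z where "z \<in> I" "F s t z = 0" | (pos) "\<And>w. w \<in> I \<Longrightarrow> F s t w > 0"
    | (neg) "\<And>w. w \<in> I \<Longrightarrow> F s t w < 0"
proof -
  have "\<exists>z\<in>I. F s t z = 0" if "v \<in> I" "F s t v \<le> 0" "w \<in> I" "F s t w \<ge> 0" for v w
  proof -
    have "connected (F s t ` I)" by (intro connected_continuous_image F_continuous) simp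
    then have "0 \<in> F s t ` I"
      by (rule connectedD_interval[of _ "F s t v" "F s t w"]) (use that in auto)
    then show ?thesis by auto
  qed
  note ivt = this
  show ?thesis
  proof (cases "\<exists>z\<in>I. F s t z = 0")
    case True
    then show ?thesis using zero by blast
  next
    case False
    show ?thesis
    proof (cases "\<exists>v\<in>I. F s t v \<le> 0")
      case True
      then obtain v where v: "v \<in> I" "F s t v \<le> 0" by blast
      show ?thesis
      proof (rule neg, rule ccontr)
        fix w assume "w \<in> I" "\<not> F s t w < 0"
        with ivt[OF v, of w] False show False by auto
      qed
    next
      case False
      then show ?thesis by (intro pos) (auto simp: not_le)
    qed
  qed
qed

text \<open>
  At an interior point this is strict convexity. At an end point the inequality holds for nearby
  interior points in place of \<open>z\<close>, and then for \<open>z\<close> by continuity.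
\<close>

lemma critical_min:
  assumes c: "critical s t z" and st: "s > 0" "t > 0" and w: "w \<in> I"
  shows "h s t z \<le> h s t w"
proof (cases "w = z")
  case False
  have z: "adm z" using c by (simp add: critical_def)
  show ?thesis
  proof (cases "z \<in> I")
    case True
    have "(z < z \<longleftrightarrow> F s t z < 0) \<and> (z < z \<longleftrightarrow> F s t z > 0)" using c True unfolding critical_def by blast
    then have "F s t z = 0" by auto
    with False show ?thesis using h_above[of z w s t] h_below[of z w s t] z adm_I[OF w] st
      by (cases w z rule: linorder_cases) auto
  next
    case False
    with adm_bounds[OF z] have "z = - a0 \<or> z = b0" by auto
    moreover have "h s t v < h s t w" if "v \<in> I" "v < w" "z = - a0" for v
    proof -
      have "F s t v > 0" using c that unfolding critical_def by auto
      then show ?thesis using h_above[of v w s t] that w adm_I st by auto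
    qed
    moreover have "h s t v < h s t w" if "v \<in> I" "v > w" "z = b0" for v
    proof -
      have "F s t v < 0" using c that unfolding critical_def by auto
      then show ?thesis using h_below[of v w s t] that w adm_I st by auto
    qed
    ultimately have ev: "\<forall>\<^sub>F v in at z within I. h s t v \<le> h s t w"
    proof (elim disjE)
      assume *: "\<And>v. v \<in> I \<Longrightarrow> v < w \<Longrightarrow> z = - a0 \<Longrightarrow> h s t v < h s t w" and z: "z = - a0"
      have "\<forall>\<^sub>F v in at z within I. v < w" using w z by (intro order_tendstoD(2)[OF tendsto_ident_at]) auto
      moreover have "\<forall>\<^sub>F v in at z within I. v \<in> I" by (auto simp: eventually_at_filter)
      ultimately show ?thesis by eventually_elim (use * z in \<open>auto intro: less_imp_le\<close>)
    next
      assume *: "\<And>v. v \<in> I \<Longrightarrow> v > w \<Longrightarrow> z = b0 \<Longrightarrow> h s t v < h s t w" and z: "z = b0"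
      have "\<forall>\<^sub>F v in at z within I. v > w" using w z by (intro order_tendstoD(1)[OF tendsto_ident_at]) auto
      moreover have "\<forall>\<^sub>F v in at z within I. v \<in> I" by (auto simp: eventually_at_filter)
      ultimately show ?thesis by eventually_elim (use * z in \<open>auto intro: less_imp_le\<close>)
    qed
    show ?thesis
    proof (rule tendsto_le)
      show "((h s t) \<longlongrightarrow> h s t z) (at z within I)"
        by (rule tendsto_within_subset[OF h_tendsto[OF z]]) auto
      show "at z within I \<noteq> bot" using adm_bounds[OF z] by (intro within_I_nontrivial) auto
    qed (use ev in auto)
  qed
qed simp

lemma \<gamma>_critical: "critical s t z \<Longrightarrow> s > 0 \<Longrightarrow> t > 0 \<Longrightarrow> \<gamma> s t = h s t z"
  by (rule \<gamma>_eqI) (auto simp: critical_def[of s t z] intro: critical_min)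

end

text \<open>
  Exchanging the two laws replaces \<open>z\<close> by \<open>- z\<close>.
\<close>

lemma (in law_pair) swap: "law_pair \<beta> b0 \<alpha> a0"
  by unfold_locales (use edges in simp)

lemma (in law_pair) swap_simps:
  "law_pair.adm \<beta> b0 \<alpha> a0 z \<longleftrightarrow> adm (- z)"
  "law_pair.h \<beta> \<alpha> s t z = h t s (- z)"
  "law_pair.F \<beta> \<alpha> s t z = - F t s (- z)"
proof -
  interpret swap: law_pair \<beta> b0 \<alpha> a0 by (rule swap)
  show "swap.adm z \<longleftrightarrow> adm (- z)" by (auto simp: swap.adm_def adm_def)
  show "swap.h s t z = h t s (- z)" by (auto simp: swap.h_def h_def)
  show "swap.F s t z = - F t s (- z)" by (auto simp: swap.F_def F_def)
qed

section \<open>Flat parts, strict concavity and the gradient\<close>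

context law_pair
begin

definition c1 :: ennreal where
  "c1 = ennreal (B.Q a0 a0) / A.edge_moment"

definition c2 :: ennreal where
  "c2 = B.edge_moment / ennreal (A.Q b0 b0)"

lemma B_adm_a0: "B.adm a0" and A_adm_b0: "A.adm b0"
  using edges by (auto intro: A.adm_interior B.adm_interior)

text \<open>
  The critical direction \<open>c1\<close> is where the derivative of \<open>h\<close> vanishes at the left end point; it is 0
  if that end point is not admissible.
\<close>

lemma le_c1_iff:
  assumes "s > 0" "t > 0"
  shows "ennreal (s / t) \<le> c1 \<longleftrightarrow> A.adm (- a0) \<and> s * A.Q (- a0) (- a0) \<le> t * B.Q a0 a0"
proof (cases "A.adm (- a0)")
  case True
  have p: "A.Q (- a0) (- a0) > 0" "B.Q a0 a0 > 0"
    using A.Q_pos B.Q_pos True B_adm_a0 by auto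
  have "c1 = ennreal (B.Q a0 a0 / A.Q (- a0) (- a0))"
    using p by (simp add: c1_def A.edge_moment_Q[OF True] divide_ennreal)
  then have "ennreal (s / t) \<le> c1 \<longleftrightarrow> s / t \<le> B.Q a0 a0 / A.Q (- a0) (- a0)"
    using p by (simp add: ennreal_le_iff)
  also have "\<dots> \<longleftrightarrow> s * A.Q (- a0) (- a0) \<le> t * B.Q a0 a0"
    using p assms by (simp add: field_simps)
  finally show ?thesis using True by simp
next
  case False
  then have "c1 = 0" by (simp add: c1_def A.edge_moment_infinite)
  then show ?thesis using False assms by (simp add: ennreal_le_iff2 not_le)
qed

lemma ge_c2_iff:
  assumes "s > 0" "t > 0"
  shows "c2 \<le> ennreal (s / t) \<longleftrightarrow> B.adm (- b0) \<and> t * B.Q (- b0) (- b0) \<le> s * A.Q b0 b0"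
proof (cases "B.adm (- b0)")
  case True
  have p: "B.Q (- b0) (- b0) > 0" "A.Q b0 b0 > 0"
    using A.Q_pos B.Q_pos True A_adm_b0 by auto
  have "c2 = ennreal (B.Q (- b0) (- b0) / A.Q b0 b0)"
    using p by (simp add: c2_def B.edge_moment_Q[OF True] divide_ennreal)
  then have "c2 \<le> ennreal (s / t) \<longleftrightarrow> B.Q (- b0) (- b0) / A.Q b0 b0 \<le> s / t"
    using p assms by (simp add: ennreal_le_iff)
  also have "\<dots> \<longleftrightarrow> t * B.Q (- b0) (- b0) \<le> s * A.Q b0 b0"
    using p assms by (simp add: field_simps)
  finally show ?thesis using True by simp
next
  case False
  then have "c2 = \<infinity>" by (simp add: c2_def B.edge_moment_infinite ennreal_top_divide)
  then show ?thesis using False by (simp add: top_unique)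
qed

lemma adm_right: "B.adm (- b0) \<Longrightarrow> adm b0"
  using A_adm_b0 by (simp add: adm_def)

text \<open>
  The derivative of \<open>h\<close> is nonnegative at the left end point, so \<open>h\<close> is minimal there.
\<close>

lemma \<gamma>_left_flat:
  assumes st: "s > 0" "t > 0" and le: "ennreal (s / t) \<le> c1"
  shows "adm (- a0)" "\<gamma> s t = h s t (- a0)"
proof -
  have *: "A.adm (- a0)" "s * A.Q (- a0) (- a0) \<le> t * B.Q a0 a0" using le le_c1_iff[OF st] by auto
  show adm: "adm (- a0)" by (rule adm_left[OF *(1)])
  show "\<gamma> s t = h s t (- a0)"
  proof (rule \<gamma>_eqI[OF adm])
    fix w assume w: "w \<in> I"
    show "h s t (- a0) \<le> h s t w"
      using h_above[OF adm adm_I[OF w], of s t] w st *(2) by (simp add: F_def)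
  qed (use st in auto)
qed

lemma \<gamma>_right_flat:
  assumes st: "s > 0" "t > 0" and le: "c2 \<le> ennreal (s / t)"
  shows "adm b0" "\<gamma> s t = h s t b0"
proof -
  have *: "B.adm (- b0)" "t * B.Q (- b0) (- b0) \<le> s * A.Q b0 b0" using le ge_c2_iff[OF st] by auto
  show adm: "adm b0" by (rule adm_right[OF *(1)])
  show "\<gamma> s t = h s t b0"
  proof (rule \<gamma>_eqI[OF adm])
    fix w assume w: "w \<in> I"
    show "h s t b0 \<le> h s t w"
      using h_below[OF adm adm_I[OF w], of s t] w st *(2) by (simp add: F_def)
  qed (use st in auto)
qed

lemma right_adm_of_F_neg:
  assumes st: "s > 0" "t > 0" and F: "\<And>w. w \<in> I \<Longrightarrow> F s t w \<le> 0"
  shows "B.adm (- b0)" "t * B.Q (- b0) (- b0) \<le> s * A.Q b0 b0"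
proof -
  interpret swap: law_pair \<beta> b0 \<alpha> a0 by (rule swap)
  have "swap.F t s w \<ge> 0" if "w \<in> swap.I" for w
    using F[of "- w"] that by (simp add: swap_simps)
  from swap.left_adm_of_F_pos[OF st(2,1) this]
  show "B.adm (- b0)" "t * B.Q (- b0) (- b0) \<le> s * A.Q b0 b0" by auto
qed

lemma critical_right:
  assumes st: "s > 0" "t > 0" and F: "\<And>w. w \<in> I \<Longrightarrow> F s t w < 0"
  shows "critical s t b0"
  unfolding critical_def
proof (intro conjI ballI)
  show "adm b0" by (rule adm_right[OF right_adm_of_F_neg(1)[OF st less_imp_le[OF F]]])
  fix w assume w: "w \<in> I"
  then show "w < b0 \<longleftrightarrow> F s t w < 0" "b0 < w \<longleftrightarrow> F s t w > 0" using F[OF w] by auto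
qed

lemma ex_critical: "s > 0 \<Longrightarrow> t > 0 \<Longrightarrow> \<exists>z. critical s t z"
proof (rule F_cases[of s t])
  assume st: "s > 0" "t > 0"
  show "\<exists>z. critical s t z" if "z \<in> I" "F s t z = 0" for z using critical_zero[OF that st] ..
  show "\<exists>z. critical s t z" if "\<And>w. w \<in> I \<Longrightarrow> F s t w > 0" using critical_left[OF st that] ..
  show "\<exists>z. critical s t z" if "\<And>w. w \<in> I \<Longrightarrow> F s t w < 0" using critical_right[OF st that] ..
qed

lemma interior_zero:
  assumes st: "s > 0" "t > 0" and c: "c1 < ennreal (s / t)" "ennreal (s / t) < c2"
  shows "\<exists>z\<in>I. F s t z = 0"
proof (rule F_cases[of s t])
  assume "\<And>w. w \<in> I \<Longrightarrow> F s t w > 0"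
  then have "ennreal (s / t) \<le> c1" using left_adm_of_F_pos[OF st] le_c1_iff[OF st] by (simp add: less_imp_le)
  with c show ?thesis by simp
next
  assume "\<And>w. w \<in> I \<Longrightarrow> F s t w < 0"
  then have "c2 \<le> ennreal (s / t)" using right_adm_of_F_neg[OF st] ge_c2_iff[OF st] by (simp add: less_imp_le)
  with c show ?thesis by simp
qed blast

text \<open>
  Any direction for which the minimiser is interior lies strictly between the two.
\<close>

lemma c1_less_c2: "c1 < c2"
proof -
  obtain z where z: "z \<in> I" using I_nonempty by blast
  define s where "s = B.Q (- z) (- z)"
  define t where "t = A.Q z z"
  have az: "A.adm z" "B.adm (- z)" using adm_I[OF z] by (auto simp: adm_def)
  have st: "s > 0" "t > 0" using az A.Q_pos B.Q_pos by (auto simp: s_def t_def)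
  have "\<not> ennreal (s / t) \<le> c1"
  proof
    assume "ennreal (s / t) \<le> c1"
    then have *: "A.adm (- a0)" "s * A.Q (- a0) (- a0) \<le> t * B.Q a0 a0" using le_c1_iff[OF st] by auto
    have "t \<le> A.Q (- a0) z" unfolding t_def using z by (intro A.Q_antimono *(1) az(1)) auto
    also have "A.Q (- a0) z < A.Q (- a0) (- a0)"
      unfolding A.Q_commute[of "- a0" z] using z by (intro A.Q_strict_antimono *(1)) auto
    finally have "t < A.Q (- a0) (- a0)" .
    moreover have "B.Q a0 a0 \<le> s"
      unfolding s_def using z by (intro B.Q_antimono2 az) auto
    ultimately have tA: "t < A.Q (- a0) (- a0)" "B.Q a0 a0 \<le> s" by auto
    have "t * B.Q a0 a0 < s * A.Q (- a0) (- a0)"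
      using st B.Q_pos[OF B_adm_a0 B_adm_a0] mult_less_le_imp_less[OF tA] by (simp add: mult.commute)
    with *(2) show False by simp
  qed
  moreover have "\<not> c2 \<le> ennreal (s / t)"
  proof
    assume "c2 \<le> ennreal (s / t)"
    then have *: "B.adm (- b0)" "t * B.Q (- b0) (- b0) \<le> s * A.Q b0 b0" using ge_c2_iff[OF st] by auto
    have "s \<le> B.Q (- b0) (- z)" unfolding s_def using z by (intro B.Q_antimono *(1) az(2)) auto
    also have "B.Q (- b0) (- z) < B.Q (- b0) (- b0)"
      unfolding B.Q_commute[of "- b0" "- z"] using z by (intro B.Q_strict_antimono *(1)) auto
    finally have "s < B.Q (- b0) (- b0)" .
    moreover have "A.Q b0 b0 \<le> t"
      unfolding t_def using z by (intro A.Q_antimono2 az) auto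
    ultimately have sB: "s < B.Q (- b0) (- b0)" "A.Q b0 b0 \<le> t" by auto
    have "s * A.Q b0 b0 < t * B.Q (- b0) (- b0)"
      using st A.Q_pos[OF A_adm_b0 A_adm_b0] mult_less_le_imp_less[OF sB] by (simp add: mult.commute)
    with *(2) show False by simp
  qed
  ultimately show ?thesis by (meson less_trans not_le)
qed

text \<open>
  The minimiser \<open>z\<close> of the intermediate direction competes in both of the other problems, and \<open>h\<close> is
  linear in the direction. Equality would make \<open>z\<close> optimal for both directions, but the zero of \<open>F\<close>
  determines the ratio \<open>s / t\<close>.
\<close>

lemma \<gamma>_strictly_concave:
  assumes c: "0 < c" "c < 1" and p: "s1 > 0" "t1 > 0" "s2 > 0" "t2 > 0"
    and r1: "c1 < ennreal (s1 / t1)" "ennreal (s1 / t1) < c2"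
    and r2: "c1 < ennreal (s2 / t2)" "ennreal (s2 / t2) < c2"
    and np: "\<And>k. (s1, t1) \<noteq> (k * s2, k * t2)"
  shows "\<gamma> (c * s1 + (1 - c) * s2) (c * t1 + (1 - c) * t2) > c * \<gamma> s1 t1 + (1 - c) * \<gamma> s2 t2"
proof -
  define s where "s = c * s1 + (1 - c) * s2"
  define t where "t = c * t1 + (1 - c) * t2"
  have st: "s > 0" "t > 0" using c p by (auto simp: s_def t_def intro!: add_pos_pos)
  obtain z1 z2 where z1: "z1 \<in> I" "F s1 t1 z1 = 0" and z2: "z2 \<in> I" "F s2 t2 z2 = 0"
    using interior_zero[OF p(1,2) r1] interior_zero[OF p(3,4) r2] by blast
  have Fmix: "F s t w = c * F s1 t1 w + (1 - c) * F s2 t2 w" for w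
    by (simp add: F_def s_def t_def algebra_simps)
  have hmix: "h s t w = c * h s1 t1 w + (1 - c) * h s2 t2 w" for w
    by (simp add: h_def s_def t_def algebra_simps)
  have mono: "F s1 t1 v \<le> F s1 t1 w" "F s2 t2 v \<le> F s2 t2 w" if "v \<in> I" "w \<in> I" "v \<le> w" for v w
    using that F_strict_mono[OF adm_I adm_I, of v w s1 t1] F_strict_mono[OF adm_I adm_I, of v w s2 t2] p
    by (cases "v = w"; auto)+
  have I12: "min z1 z2 \<in> I" "max z1 z2 \<in> I" using z1 z2 by (auto simp: min_def max_def)
  have lo: "F s t (min z1 z2) \<le> 0"
    unfolding Fmix using mono[OF I12(1) z1(1)] mono[OF I12(1) z2(1)] z1 z2 c
    by (intro add_nonpos_nonpos mult_nonneg_nonpos) auto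
  have hi: "F s t (max z1 z2) \<ge> 0"
    unfolding Fmix using mono[OF z1(1) I12(2)] mono[OF z2(1) I12(2)] z1 z2 c
    by (intro add_nonneg_nonneg mult_nonneg_nonneg) auto
  obtain z where z: "z \<in> I" "F s t z = 0"
  proof (rule F_cases[of s t])
    assume "\<And>w. w \<in> I \<Longrightarrow> F s t w > 0"
    with lo I12 show ?thesis by (metis not_le)
  next
    assume "\<And>w. w \<in> I \<Longrightarrow> F s t w < 0"
    with hi I12 show ?thesis by (metis not_le)
  qed blast
  have "\<gamma> s t = h s t z" by (rule \<gamma>_critical[OF critical_zero[OF z st] st])
  moreover have "\<gamma> s1 t1 = h s1 t1 z1" "\<gamma> s2 t2 = h s2 t2 z2"
    using \<gamma>_critical[OF critical_zero] z1 z2 p by auto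
  moreover have le: "h s1 t1 z1 \<le> h s1 t1 z" "z \<noteq> z1 \<Longrightarrow> h s1 t1 z1 < h s1 t1 z"
    using h_above[OF adm_I adm_I, OF z1(1) z(1), of s1 t1] h_below[OF adm_I adm_I, OF z1(1) z(1), of s1 t1] z1(2) p
    by (cases z z1 rule: linorder_cases; auto)+
  moreover have le2: "h s2 t2 z2 \<le> h s2 t2 z" "z \<noteq> z2 \<Longrightarrow> h s2 t2 z2 < h s2 t2 z"
    using h_above[OF adm_I adm_I, OF z2(1) z(1), of s2 t2] h_below[OF adm_I adm_I, OF z2(1) z(1), of s2 t2] z2(2) p
    by (cases z z2 rule: linorder_cases; auto)+
  moreover have "z \<noteq> z1 \<or> z \<noteq> z2"
  proof (rule ccontr)
    assume "\<not> (z \<noteq> z1 \<or> z \<noteq> z2)"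
    then have e: "t1 * B.Q (- z) (- z) = s1 * A.Q z z" "t2 * B.Q (- z) (- z) = s2 * A.Q z z"
      using z1(2) z2(2) by (auto simp: F_def)
    have q: "A.Q z z > 0" "B.Q (- z) (- z) > 0" using adm_I[OF z(1)] by (auto simp: adm_def intro: A.Q_pos B.Q_pos)
    define r where "r = B.Q (- z) (- z) / A.Q z z"
    have "s1 = r * t1" "s2 = r * t2" using e q by (auto simp: r_def field_simps)
    then have "(s1, t1) = ((t1 / t2) * s2, (t1 / t2) * t2)" using p by simp
    then show False using np by blast
  qed
  ultimately have "c * \<gamma> s1 t1 + (1 - c) * \<gamma> s2 t2 < \<gamma> s t"
    using c unfolding hmix
    by (smt (verit, best) mult_left_mono mult_strict_left_mono)
  then show ?thesis by (simp add: s_def t_def)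
qed

definition \<zeta> :: "real \<times> real \<Rightarrow> real" where
  "\<zeta> p = (SOME z. critical (fst p) (snd p) z)"

lemma \<zeta>_critical: "fst p > 0 \<Longrightarrow> snd p > 0 \<Longrightarrow> critical (fst p) (snd p) (\<zeta> p)"
  unfolding \<zeta>_def using ex_critical by (rule someI_ex)

abbreviation quadrant :: "(real \<times> real) set" where
  "quadrant \<equiv> {0<..} \<times> {0<..}"

lemma open_quadrant: "open quadrant"
  by (intro open_Times) auto

text \<open>
  For fixed \<open>w\<close> the derivative \<open>F\<close> at \<open>w\<close> is linear in the direction, so \<open>w < \<zeta> q\<close> and \<open>\<zeta> q < w\<close> are
  open conditions on \<open>q\<close>.
\<close>

lemma \<zeta>_tendsto:
  assumes p: "p \<in> quadrant"
  shows "(\<zeta> \<longlongrightarrow> \<zeta> p) (at p)"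
proof -
  have cp: "critical (fst p) (snd p) (\<zeta> p)" using p by (intro \<zeta>_critical) auto
  then have bp: "- a0 \<le> \<zeta> p" "\<zeta> p \<le> b0" using adm_bounds by (auto simp: critical_def)
  have near: "\<forall>\<^sub>F q in at p. q \<in> quadrant"
    using p open_quadrant by (rule eventually_at_in_open'[rotated])
  have cq: "critical (fst q) (snd q) (\<zeta> q)" "- a0 \<le> \<zeta> q" "\<zeta> q \<le> b0" if "q \<in> quadrant" for q
  proof -
    show c: "critical (fst q) (snd q) (\<zeta> q)" using that by (intro \<zeta>_critical) auto
    then show "- a0 \<le> \<zeta> q" "\<zeta> q \<le> b0" using adm_bounds by (auto simp: critical_def)
  qed
  have Flim: "((\<lambda>q. F (fst q) (snd q) w) \<longlongrightarrow> F (fst p) (snd p) w) (at p)" for w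
    unfolding F_def by (intro tendsto_intros)
  show ?thesis
  proof (rule order_tendstoI)
    fix l assume l: "l < \<zeta> p"
    show "\<forall>\<^sub>F q in at p. l < \<zeta> q"
    proof (cases "l < - a0")
      case True
      show ?thesis using near by eventually_elim (use True cq in fastforce)
    next
      case False
      obtain w where w: "l < w" "w < \<zeta> p" using l dense by blast
      have wI: "w \<in> I" using w False bp by auto
      have "F (fst p) (snd p) w < 0" using cp w wI by (simp add: critical_def)
      from order_tendstoD(2)[OF Flim this] near show ?thesis
      proof eventually_elim
        case (elim q)
        then have "w < \<zeta> q" using cq(1)[of q] wI unfolding critical_def by blast
        with w show ?case by simp
      qed
    qed
  next
    fix l assume l: "\<zeta> p < l"
    show "\<forall>\<^sub>F q in at p. \<zeta> q < l"
    proof (cases "l > b0")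
      case True
      show ?thesis using near by eventually_elim (use True cq in fastforce)
    next
      case False
      obtain w where w: "w < l" "\<zeta> p < w" using l dense by blast
      have wI: "w \<in> I" using w False bp by auto
      have "F (fst p) (snd p) w > 0" using cp w wI by (simp add: critical_def)
      from order_tendstoD(1)[OF Flim this] near show ?thesis
      proof eventually_elim
        case (elim q)
        then have "\<zeta> q < w" using cq(1)[of q] wI unfolding critical_def by blast
        with w show ?case by simp
      qed
    qed
  qed
qed

lemma gradient_tendsto:
  assumes p: "p \<in> quadrant"
  shows "((\<lambda>q. A.R (\<zeta> q)) \<longlongrightarrow> A.R (\<zeta> p)) (at p)" "((\<lambda>q. B.R (- \<zeta> q)) \<longlongrightarrow> B.R (- \<zeta> p)) (at p)"
proof -
  have near: "\<forall>\<^sub>F q in at p. q \<in> quadrant"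
    using p open_quadrant by (rule eventually_at_in_open'[rotated])
  have adm: "adm (\<zeta> q)" if "q \<in> quadrant" for q
    using \<zeta>_critical[of q] that by (auto simp: critical_def)
  show "((\<lambda>q. A.R (\<zeta> q)) \<longlongrightarrow> A.R (\<zeta> p)) (at p)"
  proof (rule continuous_within_tendsto_compose[where f=A.R and x=\<zeta> and S="{- a0..}"])
    show "continuous (at (\<zeta> p) within {- a0..}) A.R"
      using A.R_tendsto adm[OF p] by (simp add: adm_def continuous_within)
    show "\<forall>\<^sub>F q in at p. \<zeta> q \<in> {- a0..}"
      using near by eventually_elim (use adm adm_bounds in fastforce)
  qed (rule \<zeta>_tendsto[OF p])
  show "((\<lambda>q. B.R (- \<zeta> q)) \<longlongrightarrow> B.R (- \<zeta> p)) (at p)"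
  proof (rule continuous_within_tendsto_compose[where f=B.R and x="\<lambda>q. - \<zeta> q" and S="{- b0..}"])
    show "continuous (at (- \<zeta> p) within {- b0..}) B.R"
      using B.R_tendsto adm[OF p] by (simp add: adm_def continuous_within)
    show "\<forall>\<^sub>F q in at p. - \<zeta> q \<in> {- b0..}"
      using near by eventually_elim (use adm adm_bounds in fastforce)
  qed (intro tendsto_minus \<zeta>_tendsto[OF p])
qed

text \<open>
  Both \<open>\<gamma> q \<le> D p \<bullet> q\<close> and \<open>\<gamma> q = D q \<bullet> q\<close> hold for the candidate gradient \<open>D\<close>. The error of the linear
  approximation at \<open>p\<close> is therefore between \<open>(D q - D p) \<bullet> (q - p)\<close> and 0, and \<open>D\<close> is continuous.
\<close>

lemma \<gamma>_continuously_differentiable: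
  assumes G: "\<And>s t. s > 0 \<Longrightarrow> t > 0 \<Longrightarrow> G (s, t) = \<gamma> s t"
  shows "continuously_differentiable_on G quadrant"
proof -
  define D :: "real \<times> real \<Rightarrow> (real \<times> real) \<Rightarrow>\<^sub>L real" where "D p = A.R (\<zeta> p) *\<^sub>R fst_blinfun + B.R (- \<zeta> p) *\<^sub>R snd_blinfun" for p
  have D: "blinfun_apply (D p) v = A.R (\<zeta> p) * fst v + B.R (- \<zeta> p) * snd v" for p v
    by (simp add: D_def blinfun.bilinear_simps)
  have crit: "critical (fst q) (snd q) (\<zeta> q)" if "q \<in> quadrant" for q
    using that by (intro \<zeta>_critical) auto
  have Gq: "G q = blinfun_apply (D q) q" if q: "q \<in> quadrant" for q
    using G[of "fst q" "snd q"] \<gamma>_critical[OF crit[OF q]] q by (auto simp: D h_def mult.commute)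
  have Gle: "G r \<le> blinfun_apply (D q) r" if q: "q \<in> quadrant" and r: "r \<in> quadrant" for q r
    using G[of "fst r" "snd r"] \<gamma>_le_adm[of "\<zeta> q" "fst r" "snd r"] crit[OF q] r
    by (auto simp: D h_def mult.commute critical_def)
  have D_tendsto: "(D \<longlongrightarrow> D p) (at p)" if "p \<in> quadrant" for p
    unfolding D_def[abs_def] by (intro tendsto_intros gradient_tendsto that)
  have deriv: "(G has_derivative blinfun_apply (D p)) (at p)" if p: "p \<in> quadrant" for p
    unfolding has_derivative_at_alt
  proof (intro conjI allI impI)
    show "bounded_linear (blinfun_apply (D p))" by (rule blinfun.bounded_linear_right)
    fix e :: real assume e: "e > 0"
    have "\<forall>\<^sub>F q in at p. dist (D q) (D p) < e" using D_tendsto[OF p] e by (rule tendstoD)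
    moreover have "\<forall>\<^sub>F q in at p. q \<in> quadrant"
      using p open_quadrant by (rule eventually_at_in_open'[rotated])
    ultimately have "\<forall>\<^sub>F q in at p. norm (D q - D p) \<le> e \<and> q \<in> quadrant"
      by eventually_elim (simp add: dist_norm)
    then obtain d where d: "d > 0" "\<And>q. q \<noteq> p \<Longrightarrow> dist q p < d \<Longrightarrow> norm (D q - D p) \<le> e \<and> q \<in> quadrant"
      unfolding eventually_at by blast
    show "\<exists>d>0. \<forall>q. norm (q - p) < d \<longrightarrow> norm (G q - G p - blinfun_apply (D p) (q - p)) \<le> e * norm (q - p)"
    proof (intro exI[of _ d] conjI allI impI d(1))
      fix q assume q: "norm (q - p) < d"
      show "norm (G q - G p - blinfun_apply (D p) (q - p)) \<le> e * norm (q - p)"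
      proof (cases "q = p")
        case False
        with d(2)[of q] q have b: "norm (D q - D p) \<le> e" "q \<in> quadrant" by (auto simp: dist_norm)
        have "G q - G p - blinfun_apply (D p) (q - p) \<le> 0"
          using Gle[OF p b(2)] Gq[OF p] by (simp add: blinfun.bilinear_simps)
        moreover have "G q - G p - blinfun_apply (D p) (q - p) \<ge> blinfun_apply (D q - D p) (q - p)"
          using Gle[OF b(2) p] Gq[OF b(2)] by (simp add: blinfun.bilinear_simps)
        moreover have "norm (blinfun_apply (D q - D p) (q - p)) \<le> norm (D q - D p) * norm (q - p)"
          by (rule norm_blinfun)
        moreover have "norm (D q - D p) * norm (q - p) \<le> e * norm (q - p)"
          using b by (intro mult_right_mono) auto
        ultimately show ?thesis by simp
      qed simp
    qed
  qed
  show ?thesis unfolding continuously_differentiable_on_def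
  proof (intro exI[of _ D] conjI ballI)
    show "continuous_on quadrant D"
      by (rule continuous_at_imp_continuous_on) (use D_tendsto in \<open>auto simp: isCont_def\<close>)
  qed (use deriv in auto)
qed

end

section \<open>From exit bounds to the minimum\<close>

lemma le_of_all_slopes:
  fixes x K :: real
  assumes "\<And>u. u > 0 \<Longrightarrow> x \<le> y + u * K"
  shows "x \<le> y"
proof (rule field_le_epsilon)
  fix e :: real assume e: "e > 0"
  have "x \<le> y + e / (\<bar>K\<bar> + 1) * K" using e by (intro assms) (simp add: add_nonneg_pos)
  also have "e / (\<bar>K\<bar> + 1) * K \<le> e / (\<bar>K\<bar> + 1) * (\<bar>K\<bar> + 1)"
    using e by (intro mult_left_mono) auto
  also have "\<dots> = e" by (simp add: add_nonneg_pos[THEN less_imp_neq, symmetric])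
  finally show "x \<le> y + e" by simp
qed

context law_pair
begin

text \<open>
  To first order in \<open>z - z'\<close> the left-hand side falls short of \<open>h s t z\<close> by
  \<open>(z - z') * (F s t z + u * A.Q z z)\<close>, and the second factor is positive.
\<close>

lemma row_exit_gain:
  assumes z: "z \<in> I" and F: "F s t z \<ge> 0" and u: "u > 0"
  shows "\<exists>z'\<in>I. z' \<le> z \<and> h s t z' + (u * A.R z - u * A.R z') < h s t z"
proof -
  have az: "A.adm z" "B.adm (- z)" using adm_I[OF z] by (auto simp: adm_def)
  have "((\<lambda>w. A.Q z w) \<longlongrightarrow> A.Q z z) (at_left z)"
    by (rule tendsto_within_subset[OF A.Q_tendsto]) (use z in auto)
  moreover have "((\<lambda>w. B.Q (- z) (- w)) \<longlongrightarrow> B.Q (- z) (- z)) (at_left z)"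
  proof (rule filterlim_compose[OF B.Q_tendsto])
    show "filterlim uminus (at (- z)) (at_left z)"
      by (auto simp: filterlim_at eventually_at_filter intro!: tendsto_intros)
  qed (use z in simp)
  ultimately have "((\<lambda>w. t * B.Q (- z) (- w) - s * A.Q z w + u * A.Q z w) \<longlongrightarrow>
      t * B.Q (- z) (- z) - s * A.Q z z + u * A.Q z z) (at_left z)"
    by (intro tendsto_intros)
  moreover have "t * B.Q (- z) (- z) - s * A.Q z z + u * A.Q z z > 0"
    using F u A.Q_pos[OF az(1) az(1)] by (simp add: F_def add_nonneg_pos)
  ultimately have "\<forall>\<^sub>F w in at_left z. t * B.Q (- z) (- w) - s * A.Q z w + u * A.Q z w > 0"
    by (rule order_tendstoD(1))
  moreover have "\<forall>\<^sub>F w in at_left z. w > - a0 \<and> w < z"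
    using z by (auto simp: eventually_at_left[of "- a0"] intro!: exI[of _ "- a0"])
  ultimately have "\<forall>\<^sub>F w in at_left z. w > - a0 \<and> w < z \<and> t * B.Q (- z) (- w) - s * A.Q z w + u * A.Q z w > 0"
    by eventually_elim simp
  then obtain w where w: "w > - a0" "w < z" "t * B.Q (- z) (- w) - s * A.Q z w + u * A.Q z w > 0"
    using eventually_happens' trivial_limit_at_left_real by blast
  have wI: "w \<in> I" using w z by simp
  have aw: "A.adm w" using adm_I[OF wI] by (auto simp: adm_def)
  have "h s t w - h s t z + (u * A.R z - u * A.R w) = (w - z) * (t * B.Q (- z) (- w) - s * A.Q z w + u * A.Q z w)"
    unfolding h_diff[OF adm_I[OF z] adm_I[OF wI]] right_diff_distrib[symmetric] A.R_diff[OF aw az(1)]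
    by (simp add: algebra_simps A.Q_commute[of w z])
  also have "\<dots> < 0" using w by (simp add: mult_neg_pos)
  finally show ?thesis using wI w by (intro bexI[of _ w]) auto
qed

lemma column_exit_gain:
  assumes z: "z \<in> I" and F: "F s t z \<le> 0" and v: "v > 0"
  shows "\<exists>z'\<in>I. z \<le> z' \<and> h s t z' + (v * B.R (- z) - v * B.R (- z')) < h s t z"
proof -
  interpret swap: law_pair \<beta> b0 \<alpha> a0 by (rule swap)
  obtain w where "w \<in> swap.I" "w \<le> - z" "swap.h t s w + (v * B.R (- z) - v * B.R w) < swap.h t s (- z)"
    using swap.row_exit_gain[of "- z" t s v] z F v by (auto simp: swap_simps)
  then show ?thesis by (intro bexI[of _ "- w"]) (auto simp: swap_simps)
qed

lemma le_via_limit: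
  fixes x G :: real and c :: "real \<Rightarrow> real"
  assumes le: "\<And>z. z \<in> I \<Longrightarrow> x \<le> c z * G" and z0: "- a0 \<le> z0" "z0 \<le> b0"
    and lim: "(c \<longlongrightarrow> 1) (at z0 within I)"
  shows "x \<le> G"
proof (rule tendsto_le)
  show "at z0 within I \<noteq> bot" by (rule within_I_nontrivial[OF z0])
  show "((\<lambda>z. c z * G) \<longlongrightarrow> G) (at z0 within I)"
    using tendsto_mult_right[OF lim, of G] by simp
  show "\<forall>\<^sub>F z in at z0 within I. x \<le> c z * G"
    unfolding eventually_at_filter by (rule always_eventually) (use le in blast)
qed (rule tendsto_const)

text \<open>
  \<open>int\<close>, \<open>col\<close> and \<open>row\<close> are the bounds from the three kinds of systems. If \<open>F\<close> vanishes at an interior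
  point, late exits are excluded on both sides there. If \<open>F\<close> is positive, only those from the row are,
  and \<open>col\<close> is used near the left end point, where its constant tends to 1. If \<open>F\<close> is negative, the
  roles of row and column are exchanged.
\<close>

lemma lower_bound_of_exits:
  assumes st: "s > 0" "t > 0" and G: "G \<ge> 0"
    and int: "\<And>z z1 z2 u v. z \<in> I \<Longrightarrow> z1 \<in> I \<Longrightarrow> z2 \<in> I \<Longrightarrow> z1 \<le> z \<Longrightarrow> z \<le> z2 \<Longrightarrow> u \<ge> 0 \<Longrightarrow> v \<ge> 0 \<Longrightarrow>
      h s t z \<le> max (max (G + u * A.R z) (h s t z1 + (u * A.R z - u * A.R z1)))
                    (max (G + v * B.R (- z)) (h s t z2 + (v * B.R (- z) - v * B.R (- z2))))"
    and col: "\<And>z z1 u. z \<in> I \<Longrightarrow> z1 \<in> I \<Longrightarrow> z1 \<le> z \<Longrightarrow> u \<ge> 0 \<Longrightarrow>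
      h s t z \<le> max (max (G + u * A.R z) (h s t z1 + (u * A.R z - u * A.R z1))) ((1 + 2 * (a0 + z) / (b0 - z)) * G)"
    and row: "\<And>z z2 v. z \<in> I \<Longrightarrow> z2 \<in> I \<Longrightarrow> z \<le> z2 \<Longrightarrow> v \<ge> 0 \<Longrightarrow>
      h s t z \<le> max (max (G + v * B.R (- z)) (h s t z2 + (v * B.R (- z) - v * B.R (- z2)))) ((1 + 2 * (b0 - z) / (a0 + z)) * G)"
  shows "\<gamma> s t \<le> G"
proof (rule F_cases[of s t])
  fix z assume z: "z \<in> I" "F s t z = 0"
  have nn: "A.R z \<ge> 0" "B.R (- z) \<ge> 0"
    using adm_I[OF z(1)] by (auto simp: adm_def A.R_nonneg B.R_nonneg)
  have "h s t z \<le> G + u * (A.R z + B.R (- z))" if u: "u > 0" for u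
  proof -
    obtain z1 where z1: "z1 \<in> I" "z1 \<le> z" "h s t z1 + (u * A.R z - u * A.R z1) < h s t z"
      using row_exit_gain[OF z(1) _ u, of s t] z(2) by auto
    obtain z2 where z2: "z2 \<in> I" "z \<le> z2" "h s t z2 + (u * B.R (- z) - u * B.R (- z2)) < h s t z"
      using column_exit_gain[OF z(1) _ u, of s t] z(2) by auto
    have "h s t z \<le> max (G + u * A.R z) (G + u * B.R (- z))"
      using int[OF z(1) z1(1) z2(1) z1(2) z2(2), of u u] z1(3) z2(3) u by (auto simp: le_max_iff_disj)
    also have "\<dots> \<le> G + u * (A.R z + B.R (- z))"
      using u nn by (simp add: mult_left_mono)
    finally show ?thesis .
  qed
  then have "h s t z \<le> G" by (rule le_of_all_slopes)
  with \<gamma>_le[OF z(1)] st show ?thesis by (meson less_imp_le order_trans)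
next
  assume F: "\<And>w. w \<in> I \<Longrightarrow> F s t w > 0"
  show ?thesis
  proof (rule le_via_limit[of _ "\<lambda>z. 1 + 2 * (a0 + z) / (b0 - z)"])
    fix z assume z: "z \<in> I"
    let ?c = "1 + 2 * (a0 + z) / (b0 - z)"
    have c: "?c * G \<ge> G" using z G by (simp add: mult_le_cancel_right1)
    have nn: "A.R z \<ge> 0" using adm_I[OF z] by (auto simp: adm_def A.R_nonneg)
    have "h s t z \<le> ?c * G + u * A.R z" if u: "u > 0" for u
    proof -
      obtain z1 where z1: "z1 \<in> I" "z1 \<le> z" "h s t z1 + (u * A.R z - u * A.R z1) < h s t z"
        using row_exit_gain[OF z less_imp_le[OF F[OF z]] u] by auto
      have "h s t z \<le> max (G + u * A.R z) (?c * G)"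
        using col[OF z z1(1,2), of u] z1(3) u by (auto simp: le_max_iff_disj)
      moreover have "u * A.R z \<ge> 0" using u nn by simp
      ultimately show ?thesis using c by linarith
    qed
    then have "h s t z \<le> ?c * G" by (rule le_of_all_slopes)
    with \<gamma>_le[OF z] st show "\<gamma> s t \<le> ?c * G" by (meson less_imp_le order_trans)
  next
    have "((\<lambda>z. 1 + 2 * (a0 + z) / (b0 - z)) \<longlongrightarrow> 1 + 2 * (a0 + - a0) / (b0 - - a0)) (at (- a0) within I)"
      using edges by (intro tendsto_intros) auto
    then show "((\<lambda>z. 1 + 2 * (a0 + z) / (b0 - z)) \<longlongrightarrow> 1) (at (- a0) within I)" by simp
  qed (use edges in auto)
next
  assume F: "\<And>w. w \<in> I \<Longrightarrow> F s t w < 0"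
  show ?thesis
  proof (rule le_via_limit[of _ "\<lambda>z. 1 + 2 * (b0 - z) / (a0 + z)"])
    fix z assume z: "z \<in> I"
    let ?c = "1 + 2 * (b0 - z) / (a0 + z)"
    have c: "?c * G \<ge> G" using z G by (simp add: mult_le_cancel_right1)
    have nn: "B.R (- z) \<ge> 0" using adm_I[OF z] by (auto simp: adm_def B.R_nonneg)
    have "h s t z \<le> ?c * G + u * B.R (- z)" if u: "u > 0" for u
    proof -
      obtain z2 where z2: "z2 \<in> I" "z \<le> z2" "h s t z2 + (u * B.R (- z) - u * B.R (- z2)) < h s t z"
        using column_exit_gain[OF z less_imp_le[OF F[OF z]] u] by auto
      have "h s t z \<le> max (G + u * B.R (- z)) (?c * G)"
        using row[OF z z2(1,2), of u] z2(3) u by (auto simp: le_max_iff_disj)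
      moreover have "u * B.R (- z) \<ge> 0" using u nn by simp
      ultimately show ?thesis using c by linarith
    qed
    then have "h s t z \<le> ?c * G" by (rule le_of_all_slopes)
    with \<gamma>_le[OF z] st show "\<gamma> s t \<le> ?c * G" by (meson less_imp_le order_trans)
  next
    have "((\<lambda>z. 1 + 2 * (b0 - z) / (a0 + z)) \<longlongrightarrow> 1 + 2 * (b0 - b0) / (a0 + b0)) (at b0 within I)"
      using edges by (intro tendsto_intros) auto
    then show "((\<lambda>z. 1 + 2 * (b0 - z) / (a0 + z)) \<longlongrightarrow> 1) (at b0 within I)" by simp
  qed (use edges in auto)
qed

end


section \<open>Stationary sequences and their left endpoints\<close>

text \<open>
  The complement of the support is covered by countably many null sets of a basis.
\<close>

lemma AE_in_support:
  fixes \<eta> :: "'a::second_countable_topology measure"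
  assumes sets: "sets \<eta> = sets borel"
  shows "AE x in \<eta>. x \<in> support \<eta>"
proof -
  obtain B :: "'a set set" where B: "countable B" "topological_basis B" using ex_countable_basis by blast
  define N where "N = \<Union> {b \<in> B. emeasure \<eta> b = 0}"
  have "N \<in> null_sets \<eta>" unfolding N_def
    using B topological_basis_open[OF B(2)] sets by (intro null_sets_UN'[of _ "\<lambda>x. x", simplified]) auto
  moreover have "x \<in> N" if "x \<notin> support \<eta>" for x
  proof -
    have "\<exists>U. open U \<and> x \<in> U \<and> \<not> emeasure \<eta> U > 0" using that unfolding support_def by blast
    then obtain U where "open U" "x \<in> U" "\<not> emeasure \<eta> U > 0" by blast
    then have U: "open U" "x \<in> U" "emeasure \<eta> U = 0" by (auto simp: not_gr_zero)
    obtain b where b: "b \<in> B" "x \<in> b" "b \<subseteq> U" using topological_basisE[OF B(2) U(1,2)] by blast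
    have "emeasure \<eta> b \<le> emeasure \<eta> U" using b U sets by (intro emeasure_mono) auto
    then show ?thesis using b U by (auto simp: N_def)
  qed
  ultimately show ?thesis by (intro AE_I'[of N]) auto
qed

text \<open>
  The support is nonempty and contained in the nonnegative half-line, so its infimum is a lower bound
  for almost every value, and every neighbourhood of it is charged.
\<close>

lemma left_endpoint_edge_law:
  assumes p: "prob_space \<eta>" and sets: "sets \<eta> = sets borel" and pos: "AE x in \<eta>. x > 0"
  shows "edge_law \<eta> (left_endpoint \<eta>)" "e > 0 \<Longrightarrow> emeasure \<eta> {..<left_endpoint \<eta> + e} > 0"
proof -
  interpret prob_space \<eta> by (rule p)
  have S: "AE x in \<eta>. x \<in> support \<eta>" by (rule AE_in_support[OF sets])
  then have ne: "support \<eta> \<noteq> {}" by (auto simp: AE_const)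
  have "x \<ge> 0" if "x \<in> support \<eta>" for x
  proof (rule ccontr)
    assume "\<not> x \<ge> 0"
    then have "emeasure \<eta> {..<0} > 0" using that by (auto simp: support_def)
    moreover have "AE x in \<eta>. x \<notin> {..<0}" using pos by eventually_elim auto
    then have "emeasure \<eta> {..<0} = 0" using sets by (subst (asm) AE_iff_measurable[OF _ refl]) (auto simp: space_borel sets_eq_imp_space_eq[OF sets] lessThan_def)
    ultimately show False by simp
  qed
  then have bdd: "bdd_below (support \<eta>)" by (rule bdd_belowI)
  show "edge_law \<eta> (left_endpoint \<eta>)"
  proof (unfold_locales)
    show "AE x in \<eta>. left_endpoint \<eta> \<le> x"
      using S by eventually_elim (auto simp: left_endpoint_def intro: cInf_lower bdd)
  qed (rule sets)
  assume e: "e > 0"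
  obtain x where "x \<in> support \<eta>" "x < left_endpoint \<eta> + e"
    using cInf_lessD[OF ne, of "left_endpoint \<eta> + e"] e by (auto simp: left_endpoint_def)
  then show "emeasure \<eta> {..<left_endpoint \<eta> + e} > 0" by (auto simp: support_def)
qed

lemma AE_all_orbit:
  assumes M: "prob_space M" and T: "ergodic M T" and P: "AE x in M. P x"
  shows "AE x in M. \<forall>i. P ((T ^^ i) x)"
proof -
  interpret measure_preserving_map M T by (rule ergodic_measure_preserving[OF M T])
  have "AE x in M. P ((T ^^ i) x)" for i
    by (rule AE_distrD[of "T ^^ i" M M P], rule measurable_funpow, subst distr_funpow, rule P)
  then show ?thesis by (simp add: AE_all_countable)
qed

text \<open>
  Birkhoff's theorem for \<open>1 / (X + z)\<close>, which is bounded once \<open>X\<close> is replaced by its maximum with \<open>e\<close>.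
\<close>

lemma stationary_mean_time:
  assumes M: "prob_space M" and T: "ergodic M T" and X [measurable]: "X \<in> borel_measurable M"
    and e: "AE x in M. X x \<ge> e" and z: "z > - e"
  shows "AE x in M. mean_time (\<lambda>i. X ((T ^^ i) x) + z) (\<integral>y. 1 / (y + z) \<partial>distr M borel X)"
proof -
  define f where "f x = 1 / (max e (X x) + z)" for x
  have [measurable]: "f \<in> borel_measurable M" unfolding f_def[abs_def] by measurable
  have "0 \<le> f x \<and> f x \<le> 1 / (e + z)" for x
    using z by (auto simp: f_def intro!: divide_left_mono mult_pos_pos)
  then have "AE x in M. (\<lambda>n. orbit_sum T f n x / real n) \<longlonglongrightarrow> integral\<^sup>L M f"
    by (intro birkhoff_bounded[OF M T, of f "1 / (e + z)"]) auto
  moreover have "integral\<^sup>L M f = (\<integral>y. 1 / (y + z) \<partial>distr M borel X)"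
  proof -
    have "integral\<^sup>L M f = (\<integral>x. 1 / (X x + z) \<partial>M)"
    proof (rule integral_cong_AE)
      show "AE x in M. f x = 1 / (X x + z)" using e by eventually_elim (simp add: f_def max_absorb2)
    qed measurable
    then show ?thesis by (subst integral_distr) auto
  qed
  ultimately have "AE x in M. (\<lambda>n. orbit_sum T f n x / real n) \<longlonglongrightarrow> (\<integral>y. 1 / (y + z) \<partial>distr M borel X)" by simp
  with AE_all_orbit[OF M T e] show ?thesis
  proof eventually_elim
    case (elim x)
    have "orbit_sum T f n x = (\<Sum>i<n. 1 / (X ((T ^^ i) x) + z))" for n
      unfolding orbit_sum_def f_def using elim(1) by (simp add: max_absorb2)
    moreover have "\<exists>\<delta>>0. \<forall>i. \<delta> \<le> X ((T ^^ i) x) + z"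
      using z elim(1) by (intro exI[of _ "e + z"]) auto
    ultimately show ?case using elim(2) by (simp add: mean_time_def)
  qed
qed

text \<open>
  A set of positive measure is visited with positive frequency.
\<close>

lemma ergodic_visits:
  assumes M: "prob_space M" and T: "ergodic M T" and [measurable]: "Measurable.pred M P"
    and pos: "emeasure M {x \<in> space M. P x} > 0"
  shows "AE x in M. \<exists>i. P ((T ^^ i) x)"
proof -
  interpret prob_space M by (rule M)
  interpret measure_preserving_map M T by (rule ergodic_measure_preserving[OF M T])
  define f :: "'a \<Rightarrow> real" where "f x = (if P x then 1 else 0)" for x
  have [measurable]: "f \<in> borel_measurable M" unfolding f_def[abs_def] by measurable
  have "AE x in M. (\<lambda>n. orbit_sum T f n x / real n) \<longlonglongrightarrow> integral\<^sup>L M f"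
    by (intro birkhoff_bounded[OF M T, of f 1]) (auto simp: f_def)
  moreover have "integral\<^sup>L M f = prob {x \<in> space M. P x}"
  proof -
    have "integral\<^sup>L M f = (\<integral>x. indicator {x \<in> space M. P x} x \<partial>M)"
      by (intro Bochner_Integration.integral_cong) (auto simp: f_def)
    then show ?thesis by simp
  qed
  ultimately have "AE x in M. (\<lambda>n. orbit_sum T f n x / real n) \<longlonglongrightarrow> prob {x \<in> space M. P x}" by simp
  then show ?thesis
  proof eventually_elim
    case (elim x)
    show ?case
    proof (rule ccontr)
      assume "\<not> (\<exists>i. P ((T ^^ i) x))"
      then have "(\<lambda>n. orbit_sum T f n x / real n) = (\<lambda>_. 0)" by (auto simp: orbit_sum_def f_def)
      with elim have "(\<lambda>_::nat. 0) \<longlonglongrightarrow> prob {x \<in> space M. P x}" by simp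
      then have "prob {x \<in> space M. P x} = 0" by (simp add: LIMSEQ_const_iff)
      with pos show False by (simp add: emeasure_eq_measure)
    qed
  qed
qed

section \<open>Exponential weights in an ergodic environment\<close>

lemma environment_space:
  assumes "environment \<mu>"
  shows "space \<mu> = {\<omega>. (\<forall>i. fst \<omega> i > 0) \<and> (\<forall>j. snd \<omega> j > 0)}"
proof -
  have "sets \<mu> = sets (pos_seq \<Otimes>\<^sub>M pos_seq)" using assms by (simp add: environment_def)
  then have "space \<mu> = space (pos_seq \<Otimes>\<^sub>M pos_seq)" by (rule sets_eq_imp_space_eq)
  then show ?thesis
    by (auto simp: space_pair_measure pos_seq_def space_PiM space_restrict_space PiE_def Pi_def mem_Times_iff)
qed

lemma environment_measurable:
  assumes "environment \<mu>"
  shows "(\<lambda>\<omega>. fst \<omega> i) \<in> borel_measurable \<mu>" "(\<lambda>\<omega>. snd \<omega> j) \<in> borel_measurable \<mu>"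
proof -
  have s: "sets \<mu> = sets (pos_seq \<Otimes>\<^sub>M pos_seq)" using assms by (simp add: environment_def)
  have c: "(\<lambda>x. x i) \<in> borel_measurable pos_seq" for i
  proof -
    have "(\<lambda>x. x i) \<in> measurable pos_seq (restrict_space borel {0<..})"
      unfolding pos_seq_def by (rule measurable_component_singleton) simp
    then show ?thesis using measurable_restrict_space2_iff by blast
  qed
  have "(\<lambda>\<omega>. fst \<omega> i) \<in> borel_measurable (pos_seq \<Otimes>\<^sub>M pos_seq)"
    by (rule measurable_compose[OF measurable_fst c])
  then show "(\<lambda>\<omega>. fst \<omega> i) \<in> borel_measurable \<mu>" by (simp cong: measurable_cong_sets add: s)
  have "(\<lambda>\<omega>. snd \<omega> j) \<in> borel_measurable (pos_seq \<Otimes>\<^sub>M pos_seq)"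
    by (rule measurable_compose[OF measurable_snd c])
  then show "(\<lambda>\<omega>. snd \<omega> j) \<in> borel_measurable \<mu>" by (simp cong: measurable_cong_sets add: s)
qed

abbreviation joint_shift :: "env \<Rightarrow> env" where
  "joint_shift \<equiv> map_prod (shift (Suc 0)) (shift (Suc 0))"

lemma joint_shift_funpow: "(joint_shift ^^ n) \<omega> = (shift n (fst \<omega>), shift n (snd \<omega>))"
  by (induction n) (auto simp: shift_def)

lemma quenched_law_eq_expo_field: "quenched_law \<omega> = expo_field (\<lambda>(i, j). fst \<omega> i + snd \<omega> j)"
  unfolding quenched_law_def expo_field_def expo_def by (intro PiM_cong) (auto split: prod.split)

text \<open>
  The first row and column of the field are left free for boundary weights.
\<close>

lemma quenched_law_eq_distr:
  assumes "\<And>i. fst \<omega> i > 0" "\<And>j. snd \<omega> j > 0"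
  shows "quenched_law \<omega> = distr (expo_field (\<lambda>_. 1)) (PiM UNIV (\<lambda>_. borel)) (weights (fst \<omega>) (snd \<omega>))"
proof -
  have "distr (expo_field (\<lambda>_. 1)) (PiM UNIV (\<lambda>_. borel))
      (\<lambda>E k. E (Suc (fst k), Suc (snd k)) / (case k of (i, j) \<Rightarrow> fst \<omega> i + snd \<omega> j)) = quenched_law \<omega>"
    unfolding quenched_law_eq_expo_field
    by (rule distr_expo_field_rescale) (auto simp: inj_def assms add_pos_pos)
  moreover have "(\<lambda>E k. E (Suc (fst k), Suc (snd k)) / (case k of (i, j) \<Rightarrow> fst \<omega> i + snd \<omega> j)) = weights (fst \<omega>) (snd \<omega>)"
    by (auto simp: weights_def fun_eq_iff)
  ultimately show ?thesis by simp
qed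

lemma measurable_weights:
  "weights a b \<in> measurable (expo_field (\<lambda>_. 1)) (PiM UNIV (\<lambda>_. borel))"
  by (rule measurable_PiM_single') (auto simp: space_PiM weights_def split: prod.split)

lemma quenched_law_kernel:
  assumes \<mu>: "environment \<mu>"
  shows "quenched_law \<in> measurable \<mu> (subprob_algebra (PiM UNIV (\<lambda>_. borel)))"
proof -
  interpret P: prob_space "expo_field (\<lambda>_::nat \<times> nat. 1)" by (rule prob_space_expo_field) simp
  note environment_measurable[OF \<mu>, measurable]
  have "(\<lambda>\<omega>. distr (expo_field (\<lambda>_. 1)) (PiM UNIV (\<lambda>_. borel)) (weights (fst \<omega>) (snd \<omega>)))
      \<in> measurable \<mu> (subprob_algebra (PiM UNIV (\<lambda>_. borel)))"
  proof (rule measurable_distr2)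
    show "(\<lambda>_. expo_field (\<lambda>_. 1)) \<in> measurable \<mu> (subprob_algebra (expo_field (\<lambda>_::nat \<times> nat. 1)))"
      by (rule measurable_const) (simp add: space_subprob_algebra P.subprob_space_axioms)
    have "(\<lambda>v. weights (fst (fst v)) (snd (fst v)) (snd v)) \<in> measurable (\<mu> \<Otimes>\<^sub>M expo_field (\<lambda>_. 1)) (PiM UNIV (\<lambda>_. borel))"
    proof (rule measurable_PiM_single')
      fix k :: "nat \<times> nat"
      show "(\<lambda>v. weights (fst (fst v)) (snd (fst v)) (snd v) k) \<in> borel_measurable (\<mu> \<Otimes>\<^sub>M expo_field (\<lambda>_. 1))"
        unfolding weights_def by (cases k) simp
    qed (auto simp: space_PiM)
    then show "case_prod (\<lambda>\<omega>. weights (fst \<omega>) (snd \<omega>)) \<in> measurable (\<mu> \<Otimes>\<^sub>M expo_field (\<lambda>_. 1)) (PiM UNIV (\<lambda>_. borel))"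
      by (simp add: case_prod_beta')
  qed
  then show ?thesis
    by (rule measurable_cong[THEN iffD1, rotated])
      (auto simp: environment_space[OF \<mu>] quenched_law_eq_distr)
qed

text \<open>
  The event need not be measurable, so the statement is applied to a null set that contains its complement.
\<close>

lemma AE_weight_law:
  assumes \<mu>: "environment \<mu>" and Q: "AE W in weight_law \<mu>. Q W"
  shows "AE \<omega> in \<mu>. AE E in expo_field (\<lambda>_. 1). Q (weights (fst \<omega>) (snd \<omega>) E)"
proof -
  interpret prob_space \<mu> using \<mu> by (simp add: environment_def)
  note K = quenched_law_kernel[OF \<mu>]
  have sets: "sets (weight_law \<mu>) = sets (PiM UNIV (\<lambda>_. borel))"
    unfolding weight_law_def by (rule sets_bind[OF sets_kernel[OF K] not_empty])
  have space: "space (weight_law \<mu>) = UNIV"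
    using sets_eq_imp_space_eq[OF sets] by (simp add: space_PiM)
  obtain N where N: "{W \<in> space (weight_law \<mu>). \<not> Q W} \<subseteq> N" "N \<in> null_sets (weight_law \<mu>)"
    using Q by (auto elim!: AE_E simp: null_sets_def)
  have [measurable]: "N \<in> sets (PiM UNIV (\<lambda>_. borel))" using N(2) sets by auto
  have "AE W in weight_law \<mu>. W \<notin> N" by (rule AE_not_in[OF N(2)])
  then have "AE \<omega> in \<mu>. AE W in quenched_law \<omega>. W \<notin> N"
    unfolding weight_law_def by (subst (asm) AE_bind[OF K]) auto
  then show ?thesis
    using AE_space
  proof eventually_elim
    case (elim \<omega>)
    then have "AE W in distr (expo_field (\<lambda>_. 1)) (PiM UNIV (\<lambda>_. borel)) (weights (fst \<omega>) (snd \<omega>)). W \<notin> N"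
      by (subst quenched_law_eq_distr[symmetric]) (auto simp: environment_space[OF \<mu>])
    then have "AE E in expo_field (\<lambda>_. 1). weights (fst \<omega>) (snd \<omega>) E \<notin> N"
      by (rule AE_distrD[OF measurable_weights])
    then show ?case by eventually_elim (use N space in auto)
  qed
qed

lemma environment_edge_law:
  assumes \<mu>: "environment \<mu>"
  shows "edge_law (law_a \<mu>) (left_endpoint (law_a \<mu>))" "edge_law (law_b \<mu>) (left_endpoint (law_b \<mu>))"
    and "e > 0 \<Longrightarrow> emeasure (law_a \<mu>) {..<left_endpoint (law_a \<mu>) + e} > 0"
    and "e > 0 \<Longrightarrow> emeasure (law_b \<mu>) {..<left_endpoint (law_b \<mu>) + e} > 0"
proof -
  interpret prob_space \<mu> using \<mu> by (simp add: environment_def)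
  note environment_measurable[OF \<mu>, measurable]
  have a: "prob_space (law_a \<mu>)" "sets (law_a \<mu>) = sets borel" "AE x in law_a \<mu>. x > 0"
    unfolding law_a_def by (auto intro!: prob_space_distr simp: AE_distr_iff environment_space[OF \<mu>] intro!: AE_I2)
  have b: "prob_space (law_b \<mu>)" "sets (law_b \<mu>) = sets borel" "AE x in law_b \<mu>. x > 0"
    unfolding law_b_def by (auto intro!: prob_space_distr simp: AE_distr_iff environment_space[OF \<mu>] intro!: AE_I2)
  show "edge_law (law_a \<mu>) (left_endpoint (law_a \<mu>))" "edge_law (law_b \<mu>) (left_endpoint (law_b \<mu>))"
    and "e > 0 \<Longrightarrow> emeasure (law_a \<mu>) {..<left_endpoint (law_a \<mu>) + e} > 0"
    and "e > 0 \<Longrightarrow> emeasure (law_b \<mu>) {..<left_endpoint (law_b \<mu>) + e} > 0"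
    using left_endpoint_edge_law[OF a] left_endpoint_edge_law[OF b] by auto
qed

text \<open>
  Every inequality obtained in a fixed environment involves deterministic quantities only, so it is
  enough that almost every environment satisfies the finitely many conditions on it.
\<close>

theorem shape_function_variational_formula:
  assumes \<mu>: "environment \<mu>" and shape: "is_shape_function \<mu> g"
    and lp: "law_pair (law_a \<mu>) (left_endpoint (law_a \<mu>)) (law_b \<mu>) (left_endpoint (law_b \<mu>))"
    and st: "s > 0" "t > 0"
  shows "g s t = ennreal (law_pair.\<gamma> (law_a \<mu>) (left_endpoint (law_a \<mu>)) (law_b \<mu>) (left_endpoint (law_b \<mu>)) s t)"
proof -
  define a0 b0 where "a0 = left_endpoint (law_a \<mu>)" and "b0 = left_endpoint (law_b \<mu>)"
  interpret law_pair "law_a \<mu>" a0 "law_b \<mu>" b0 using lp by (simp add: a0_def b0_def)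
  interpret M: prob_space \<mu> using \<mu> by (simp add: environment_def)
  have erg: "ergodic \<mu> joint_shift" using \<mu> by (simp add: environment_def)
  note meas = environment_measurable[OF \<mu>]
  note meas[measurable]
  have "AE W in weight_law \<mu>. \<forall>s>0. \<forall>t>0.
        (\<lambda>n. ennreal (lpp W (nat \<lfloor>real n * s\<rfloor>) (nat \<lfloor>real n * t\<rfloor>) / real n)) \<longlonglongrightarrow> g s t"
    using shape by (simp add: is_shape_function_def)
  then have "AE W in weight_law \<mu>. (\<lambda>k. ennreal (lpp W (scaled k s) (scaled k t) / (real k)\<^sup>2)) \<longlonglongrightarrow> g s t"
  proof eventually_elim
    case (elim W)
    \<comment> \<open>The limit is taken along the squares, as in \<open>slpp_limit_squares\<close>.\<close>
    have "filterlim (\<lambda>k::nat. k\<^sup>2) sequentially sequentially"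
      by (rule filterlim_at_top_mono[OF filterlim_ident]) (simp add: power2_eq_square le_square)
    from filterlim_compose[OF elim[rule_format, OF st] this] show ?case by simp
  qed
  from AE_weight_law[OF \<mu> this]
  have lim: "AE \<omega> in \<mu>. AE E in expo_field (\<lambda>_. 1).
      (\<lambda>k. ennreal (lpp (weights (fst \<omega>) (snd \<omega>) E) (scaled k s) (scaled k t) / (real k)\<^sup>2)) \<longlonglongrightarrow> g s t" .
  have edge_a: "AE \<omega> in \<mu>. fst \<omega> 0 \<ge> a0"
    using A.AE_edge unfolding law_a_def by (subst (asm) AE_distr_iff) auto
  have edge_b: "AE \<omega> in \<mu>. snd \<omega> 0 \<ge> b0"
    using B.AE_edge unfolding law_b_def by (subst (asm) AE_distr_iff) auto
  have means: "AE \<omega> in \<mu>. mean_time (\<lambda>i. fst \<omega> i + z) (A.R z) \<and> mean_time (\<lambda>j. snd \<omega> j - z) (B.R (- z))"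
    if z: "z \<in> I" for z
  proof -
    have "AE \<omega> in \<mu>. mean_time (\<lambda>i. fst ((joint_shift ^^ i) \<omega>) 0 + z) (A.R z)"
      unfolding A.R_def unfolding law_a_def
      by (rule stationary_mean_time[OF M.prob_space_axioms erg meas(1) edge_a]) (use z in simp)
    moreover have "AE \<omega> in \<mu>. mean_time (\<lambda>i. snd ((joint_shift ^^ i) \<omega>) 0 + - z) (B.R (- z))"
      unfolding B.R_def unfolding law_b_def
      by (rule stationary_mean_time[OF M.prob_space_axioms erg meas(2) edge_b]) (use z in simp)
    ultimately show ?thesis by eventually_elim (simp add: joint_shift_funpow shift_def)
  qed
  have upper: "g s t \<le> ennreal (h s t z)" if z: "z \<in> I" for z
  proof -
    have "AE \<omega> in \<mu>. g s t \<le> ennreal (h s t z)"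
      using lim means[OF z] by eventually_elim (use st in \<open>auto simp: h_def intro!: quenched_upper_bound\<close>)
    then show ?thesis by simp
  qed
  from I_nonempty obtain z0 where "z0 \<in> I" by blast
  from upper[OF this] have fin: "g s t < \<infinity>" by (rule le_less_trans) simp
  define G where "G = enn2real (g s t)"
  have G: "g s t = ennreal G" "G \<ge> 0" using fin by (auto simp: G_def less_top)
  have "G \<le> h s t z" if z: "z \<in> I" for z
    using upper[OF z] h_nonneg[OF adm_I[OF z], of s t] st unfolding G(1) by (simp add: ennreal_le_iff)
  then have le: "G \<le> \<gamma> s t" unfolding \<gamma>_def by (intro cINF_greatest[OF I_nonempty])
  have pos: "AE \<omega> in \<mu>. (\<forall>i. fst \<omega> i > 0) \<and> (\<forall>j. snd \<omega> j > 0)"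
    by (rule AE_I2) (simp add: environment_space[OF \<mu>])
  have limG: "AE \<omega> in \<mu>. AE E in expo_field (\<lambda>_. 1).
      (\<lambda>k. lpp (weights (fst \<omega>) (snd \<omega>) E) (scaled k s) (scaled k t) / (real k)\<^sup>2) \<longlonglongrightarrow> G"
    using lim pos
  proof eventually_elim
    case (elim \<omega>)
    show ?case using elim(1) AE_expo_field_nonneg
    proof eventually_elim
      fix E :: "nat \<times> nat \<Rightarrow> real" assume *: "\<forall>k. E k \<ge> 0"
        "(\<lambda>k. ennreal (lpp (weights (fst \<omega>) (snd \<omega>) E) (scaled k s) (scaled k t) / (real k)\<^sup>2)) \<longlonglongrightarrow> g s t"
      have "weights (fst \<omega>) (snd \<omega>) E k \<ge> 0" for k
        unfolding weights_def using * elim(2) by (auto split: prod.split intro!: divide_nonneg_pos add_pos_pos)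
      then have "lpp (weights (fst \<omega>) (snd \<omega>) E) m n \<ge> 0" for m n by (rule lpp_nonneg)
      then show "(\<lambda>k. lpp (weights (fst \<omega>) (snd \<omega>) E) (scaled k s) (scaled k t) / (real k)\<^sup>2) \<longlonglongrightarrow> G"
        using *(2) unfolding G(1) by (subst (asm) tendsto_ennreal_iff) (auto simp: G(2))
    qed
  qed
  have all_a: "AE \<omega> in \<mu>. \<forall>i. fst \<omega> i \<ge> a0"
    using AE_all_orbit[OF M.prob_space_axioms erg edge_a] by (simp add: joint_shift_funpow shift_def)
  have all_b: "AE \<omega> in \<mu>. \<forall>i. snd \<omega> i \<ge> b0"
    using AE_all_orbit[OF M.prob_space_axioms erg edge_b] by (simp add: joint_shift_funpow shift_def)
  have visit_a: "AE \<omega> in \<mu>. \<exists>i. fst \<omega> i < a0 + e" if e: "e > 0" for e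
  proof -
    have "emeasure (law_a \<mu>) {..<a0 + e} > 0" unfolding a0_def by (rule environment_edge_law(3)[OF \<mu> e])
    also have "emeasure (law_a \<mu>) {..<a0 + e} = emeasure \<mu> {\<omega> \<in> space \<mu>. fst \<omega> 0 < a0 + e}"
      unfolding law_a_def by (subst emeasure_distr) (auto intro!: arg_cong[where f="emeasure \<mu>"])
    finally have "AE \<omega> in \<mu>. \<exists>i. fst ((joint_shift ^^ i) \<omega>) 0 < a0 + e"
      by (intro ergodic_visits[OF M.prob_space_axioms erg]) auto
    then show ?thesis by (simp add: joint_shift_funpow shift_def)
  qed
  have visit_b: "AE \<omega> in \<mu>. \<exists>i. snd \<omega> i < b0 + e" if e: "e > 0" for e
  proof -
    have "emeasure (law_b \<mu>) {..<b0 + e} > 0" unfolding b0_def by (rule environment_edge_law(4)[OF \<mu> e])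
    also have "emeasure (law_b \<mu>) {..<b0 + e} = emeasure \<mu> {\<omega> \<in> space \<mu>. snd \<omega> 0 < b0 + e}"
      unfolding law_b_def by (subst emeasure_distr) (auto intro!: arg_cong[where f="emeasure \<mu>"])
    finally have "AE \<omega> in \<mu>. \<exists>i. snd ((joint_shift ^^ i) \<omega>) 0 < b0 + e"
      by (intro ergodic_visits[OF M.prob_space_axioms erg]) auto
    then show ?thesis by (simp add: joint_shift_funpow shift_def)
  qed
  \<comment> \<open>The rate \<open>x + y\<close> exceeds the boundary rate \<open>y - z\<close> by \<open>x + z < 2 * (x0 + z)\<close>, and the boundary rate
    is at least \<open>y0 - z\<close>; the constant is one plus the quotient.\<close>
  have column: "x + y \<le> (1 + 2 * (x0 + z) / (y0 - z)) * (y - z)"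
    if "x < x0 + (x0 + z)" "y0 \<le> y" "x0 + z > 0" "y0 - z > 0" for x y x0 y0 z :: real
  proof -
    have "2 * (x0 + z) / (y0 - z) * (y0 - z) \<le> 2 * (x0 + z) / (y0 - z) * (y - z)"
      using that by (intro mult_left_mono) auto
    moreover have "2 * (x0 + z) / (y0 - z) * (y0 - z) = 2 * (x0 + z)" using that by simp
    moreover define w where "w = 2 * (x0 + z) / (y0 - z) * (y - z)"
    ultimately have "2 * (x0 + z) \<le> w" by simp
    then have "x + y \<le> 1 * (y - z) + w" using that by simp
    then show ?thesis by (simp only: distrib_right w_def)
  qed
  have "\<gamma> s t \<le> G"
  proof (rule lower_bound_of_exits[OF st G(2)], goal_cases)
    case (1 z z1 z2 u v)
    have "AE \<omega> in \<mu>. h s t z \<le> max (max (G + u * A.R z) (h s t z1 + (u * A.R z - u * A.R z1)))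
                    (max (G + v * B.R (- z)) (h s t z2 + (v * B.R (- z) - v * B.R (- z2))))"
      using limG means[OF 1(1)] means[OF 1(2)] means[OF 1(3)]
    proof eventually_elim
      case (elim \<omega>)
      show ?case unfolding h_def
        by (rule quenched_interior_bound[where a="fst \<omega>" and b="snd \<omega>" and z=z and ?z1.0=z1 and ?z2.0=z2])
          (use elim 1 st in auto)
    qed
    then show ?case by simp
  next
    case (2 z z1 u)
    then have e: "a0 + z > 0" "b0 - z > 0" by auto
    have "AE \<omega> in \<mu>. h s t z \<le> max (max (G + u * A.R z) (h s t z1 + (u * A.R z - u * A.R z1)))
        ((1 + 2 * (a0 + z) / (b0 - z)) * G)"
      using limG means[OF 2(1)] means[OF 2(2)] pos all_b visit_a[OF e(1)]
    proof eventually_elim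
      case (elim \<omega>)
      then obtain p where p: "fst \<omega> p < a0 + (a0 + z)" by blast
      show ?case unfolding h_def
      proof (rule quenched_column_bound[where a="fst \<omega>" and b="snd \<omega>" and z=z and ?z1.0=z1 and p=p])
        show "fst \<omega> p + snd \<omega> j \<le> (1 + 2 * (a0 + z) / (b0 - z)) * (snd \<omega> j - z)" for j
          using p elim(5) e by (intro column) auto
        show "fst \<omega> i + snd \<omega> j > 0" for i j using elim(4) by (auto intro: add_pos_pos)
      qed (use elim 2 st e in auto)
    qed
    then show ?case by simp
  next
    case (3 z z2 v)
    then have e: "a0 + z > 0" "b0 - z > 0" by auto
    have "AE \<omega> in \<mu>. h s t z \<le> max (max (G + v * B.R (- z)) (h s t z2 + (v * B.R (- z) - v * B.R (- z2))))
        ((1 + 2 * (b0 - z) / (a0 + z)) * G)"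
      using limG means[OF 3(1)] means[OF 3(2)] pos all_a visit_b[OF e(2)]
    proof eventually_elim
      case (elim \<omega>)
      then obtain p where p: "snd \<omega> p < b0 + (b0 - z)" by blast
      \<comment> \<open>The bound for a row is the bound for a column in the transposed system with parameter \<open>- z\<close>.\<close>
      have "t * B.R (- z) + s * A.R z \<le> max (max (G + v * B.R (- z)) ((t * B.R (- z2) + s * A.R z2) + (v * B.R (- z) - v * B.R (- z2))))
        ((1 + 2 * (b0 + - z) / (a0 - - z)) * G)"
      proof (rule quenched_column_bound[where a="snd \<omega>" and b="fst \<omega>" and z="- z" and ?z1.0="- z2" and p=p])
        show "snd \<omega> p + fst \<omega> j \<le> (1 + 2 * (b0 + - z) / (a0 - - z)) * (fst \<omega> j - - z)" for j
          using p elim(5) e by (intro column) auto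
        show "snd \<omega> i + fst \<omega> j > 0" for i j using elim(4) by (auto intro: add_pos_pos)
      qed (use elim 3 st e quenched_transpose[OF elim(1)] in auto)
      then show ?case by (simp add: h_def add.commute)
    qed
    then show ?case by simp
  qed
  with le have "G = \<gamma> s t" by simp
  with G(1) show ?thesis by (simp add: a0_def b0_def)
qed

theorem corollary2p3:
  fixes \<mu> :: "env measure"
    and g :: "real \<Rightarrow> real \<Rightarrow> ennreal"
    and \<alpha>\<^sub>0 \<beta>\<^sub>0 :: real
    and c\<^sub>1 c\<^sub>2 :: ennreal
  assumes env: "environment \<mu>"
    and shape: "is_shape_function \<mu> g"
    and \<alpha>\<^sub>0: "\<alpha>\<^sub>0 = left_endpoint (law_a \<mu>)"
    and \<beta>\<^sub>0: "\<beta>\<^sub>0 = left_endpoint (law_b \<mu>)"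
    and pos: "\<alpha>\<^sub>0 + \<beta>\<^sub>0 > 0"
    and c\<^sub>1: "c\<^sub>1 = (\<integral>\<^sup>+\<omega>. inverse (ennreal (snd \<omega> 0 + \<alpha>\<^sub>0) ^ 2) \<partial>\<mu>) /
                   (\<integral>\<^sup>+\<omega>. inverse (ennreal (fst \<omega> 0 - \<alpha>\<^sub>0) ^ 2) \<partial>\<mu>)"
    and c\<^sub>2: "c\<^sub>2 = (\<integral>\<^sup>+\<omega>. inverse (ennreal (snd \<omega> 0 - \<beta>\<^sub>0) ^ 2) \<partial>\<mu>) /
                   (\<integral>\<^sup>+\<omega>. inverse (ennreal (fst \<omega> 0 + \<beta>\<^sub>0) ^ 2) \<partial>\<mu>)"
  shows "c\<^sub>1 < c\<^sub>2 \<and>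
         (\<forall>s t. s > 0 \<and> t > 0 \<and> ennreal (s / t) \<le> c\<^sub>1 \<longrightarrow>
           g s t = ennreal s * (\<integral>\<^sup>+\<omega>. inverse (ennreal (fst \<omega> 0 - \<alpha>\<^sub>0)) \<partial>\<mu>) +
                   ennreal t * (\<integral>\<^sup>+\<omega>. inverse (ennreal (snd \<omega> 0 + \<alpha>\<^sub>0)) \<partial>\<mu>)) \<and>
         (\<forall>s t. s > 0 \<and> t > 0 \<and> ennreal (s / t) \<ge> c\<^sub>2 \<longrightarrow>
           g s t = ennreal s * (\<integral>\<^sup>+\<omega>. inverse (ennreal (fst \<omega> 0 + \<beta>\<^sub>0)) \<partial>\<mu>) +
                   ennreal t * (\<integral>\<^sup>+\<omega>. inverse (ennreal (snd \<omega> 0 - \<beta>\<^sub>0)) \<partial>\<mu>)) \<and>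
         (\<forall>c s\<^sub>1 t\<^sub>1 s\<^sub>2 t\<^sub>2. 0 < c \<and> c < 1 \<and> s\<^sub>1 > 0 \<and> t\<^sub>1 > 0 \<and> s\<^sub>2 > 0 \<and> t\<^sub>2 > 0 \<and>
           c\<^sub>1 < ennreal (s\<^sub>1 / t\<^sub>1) \<and> ennreal (s\<^sub>1 / t\<^sub>1) < c\<^sub>2 \<and>
           c\<^sub>1 < ennreal (s\<^sub>2 / t\<^sub>2) \<and> ennreal (s\<^sub>2 / t\<^sub>2) < c\<^sub>2 \<and>
           (\<forall>k::real. (s\<^sub>1, t\<^sub>1) \<noteq> (k * s\<^sub>2, k * t\<^sub>2)) \<longrightarrow>
           g (c * s\<^sub>1 + (1 - c) * s\<^sub>2) (c * t\<^sub>1 + (1 - c) * t\<^sub>2)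
             > ennreal c * g s\<^sub>1 t\<^sub>1 + ennreal (1 - c) * g s\<^sub>2 t\<^sub>2) \<and>
         (\<forall>s>0. \<forall>t>0. g s t < \<infinity>) \<and>
         continuously_differentiable_on (\<lambda>(s, t). enn2real (g s t)) ({0<..} \<times> {0<..})"
proof -
  have lp: "law_pair (law_a \<mu>) \<alpha>\<^sub>0 (law_b \<mu>) \<beta>\<^sub>0"
    using environment_edge_law(1,2)[OF env] pos
    by (simp add: law_pair_def law_pair_axioms_def \<alpha>\<^sub>0 \<beta>\<^sub>0)
  interpret law_pair "law_a \<mu>" \<alpha>\<^sub>0 "law_b \<mu>" \<beta>\<^sub>0 by (rule lp)
  note environment_measurable[OF env, measurable]
  have g: "g s t = ennreal (\<gamma> s t)" if "s > 0" "t > 0" for s t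
    using shape_function_variational_formula[OF env shape lp[unfolded \<alpha>\<^sub>0 \<beta>\<^sub>0] that]
    by (simp add: \<alpha>\<^sub>0 \<beta>\<^sub>0)
  have int_a: "(\<integral>\<^sup>+\<omega>. f (fst \<omega> 0) \<partial>\<mu>) = (\<integral>\<^sup>+x. f x \<partial>law_a \<mu>)" if "f \<in> borel_measurable borel" for f :: "real \<Rightarrow> ennreal"
    using that unfolding law_a_def by (subst nn_integral_distr) auto
  have int_b: "(\<integral>\<^sup>+\<omega>. f (snd \<omega> 0) \<partial>\<mu>) = (\<integral>\<^sup>+x. f x \<partial>law_b \<mu>)" if "f \<in> borel_measurable borel" for f :: "real \<Rightarrow> ennreal"
    using that unfolding law_b_def by (subst nn_integral_distr) auto
  have c1_eq: "c\<^sub>1 = c1"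
    unfolding c\<^sub>1 c1_def A.edge_moment_def
    using int_a[of "\<lambda>x. inverse (ennreal (x - \<alpha>\<^sub>0) ^ 2)"] int_b[of "\<lambda>x. inverse (ennreal (x + \<alpha>\<^sub>0) ^ 2)"]
      B.nn_integral_Q[OF B_adm_a0] by simp
  have c2_eq: "c\<^sub>2 = c2"
    unfolding c\<^sub>2 c2_def B.edge_moment_def
    using int_b[of "\<lambda>x. inverse (ennreal (x - \<beta>\<^sub>0) ^ 2)"] int_a[of "\<lambda>x. inverse (ennreal (x + \<beta>\<^sub>0) ^ 2)"]
      A.nn_integral_Q[OF A_adm_b0] by simp
  have flat: "g s t = ennreal s * (\<integral>\<^sup>+\<omega>. inverse (ennreal (fst \<omega> 0 + z)) \<partial>\<mu>) +
                   ennreal t * (\<integral>\<^sup>+\<omega>. inverse (ennreal (snd \<omega> 0 - z)) \<partial>\<mu>)"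
    if st: "s > 0" "t > 0" and z: "adm z" and eq: "\<gamma> s t = h s t z" for s t z
  proof -
    have a: "A.adm z" "B.adm (- z)" using z by (auto simp: adm_def)
    have "g s t = ennreal (s * A.R z + t * B.R (- z))" using g[OF st] eq by (simp add: h_def)
    also have "\<dots> = ennreal s * ennreal (A.R z) + ennreal t * ennreal (B.R (- z))"
      using st A.R_nonneg[OF a(1)] B.R_nonneg[OF a(2)] by (simp add: ennreal_plus ennreal_mult)
    also have "ennreal (A.R z) = (\<integral>\<^sup>+\<omega>. inverse (ennreal (fst \<omega> 0 + z)) \<partial>\<mu>)"
      using int_a[of "\<lambda>x. inverse (ennreal (x + z))"] A.nn_integral_R[OF a(1)] by simp
    also have "ennreal (B.R (- z)) = (\<integral>\<^sup>+\<omega>. inverse (ennreal (snd \<omega> 0 - z)) \<partial>\<mu>)"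
      using int_b[of "\<lambda>x. inverse (ennreal (x - z))"] B.nn_integral_R[OF a(2)] by simp
    finally show ?thesis .
  qed
  show ?thesis unfolding c1_eq c2_eq
  proof (intro conjI allI impI)
    show "c1 < c2" by (rule c1_less_c2)
  next
    fix s t :: real assume "s > 0 \<and> t > 0 \<and> ennreal (s / t) \<le> c1"
    then have st: "s > 0" "t > 0" and le: "ennreal (s / t) \<le> c1" by auto
    show "g s t = ennreal s * (\<integral>\<^sup>+\<omega>. inverse (ennreal (fst \<omega> 0 - \<alpha>\<^sub>0)) \<partial>\<mu>) +
                   ennreal t * (\<integral>\<^sup>+\<omega>. inverse (ennreal (snd \<omega> 0 + \<alpha>\<^sub>0)) \<partial>\<mu>)"
      using flat[OF st \<gamma>_left_flat[OF st le]] by simp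
  next
    fix s t :: real assume "s > 0 \<and> t > 0 \<and> ennreal (s / t) \<ge> c2"
    then have st: "s > 0" "t > 0" and le: "c2 \<le> ennreal (s / t)" by auto
    show "g s t = ennreal s * (\<integral>\<^sup>+\<omega>. inverse (ennreal (fst \<omega> 0 + \<beta>\<^sub>0)) \<partial>\<mu>) +
                   ennreal t * (\<integral>\<^sup>+\<omega>. inverse (ennreal (snd \<omega> 0 - \<beta>\<^sub>0)) \<partial>\<mu>)"
      by (rule flat[OF st \<gamma>_right_flat[OF st le]])
  next
    fix c s1 t1 s2 t2 :: real
    assume "0 < c \<and> c < 1 \<and> s1 > 0 \<and> t1 > 0 \<and> s2 > 0 \<and> t2 > 0 \<and>
           c1 < ennreal (s1 / t1) \<and> ennreal (s1 / t1) < c2 \<and>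
           c1 < ennreal (s2 / t2) \<and> ennreal (s2 / t2) < c2 \<and>
           (\<forall>k::real. (s1, t1) \<noteq> (k * s2, k * t2))"
    then have c: "0 < c" "c < 1" and p: "s1 > 0" "t1 > 0" "s2 > 0" "t2 > 0"
      and strict: "\<gamma> (c * s1 + (1 - c) * s2) (c * t1 + (1 - c) * t2) > c * \<gamma> s1 t1 + (1 - c) * \<gamma> s2 t2"
      using \<gamma>_strictly_concave[of c s1 t1 s2 t2] by auto
    have q: "c * s1 + (1 - c) * s2 > 0" "c * t1 + (1 - c) * t2 > 0"
      using c p by (auto intro!: add_pos_pos mult_pos_pos)
    have nn: "\<gamma> s1 t1 \<ge> 0" "\<gamma> s2 t2 \<ge> 0" using p by (auto intro!: \<gamma>_nonneg)
    have "ennreal c * g s1 t1 + ennreal (1 - c) * g s2 t2 = ennreal (c * \<gamma> s1 t1 + (1 - c) * \<gamma> s2 t2)"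
      using c p nn by (simp add: g ennreal_plus ennreal_mult)
    also have "\<dots> < ennreal (\<gamma> (c * s1 + (1 - c) * s2) (c * t1 + (1 - c) * t2))"
      using strict c nn by (intro ennreal_lessI) (auto intro: le_less_trans[rotated])
    finally show "ennreal c * g s1 t1 + ennreal (1 - c) * g s2 t2 < g (c * s1 + (1 - c) * s2) (c * t1 + (1 - c) * t2)"
      by (simp add: g q)
  next
    fix s t :: real assume "s > 0" "t > 0"
    then show "g s t < \<infinity>" by (simp add: g)
  next
    show "continuously_differentiable_on (\<lambda>(s, t). enn2real (g s t)) ({0<..} \<times> {0<..})"
      by (rule \<gamma>_continuously_differentiable) (simp add: g \<gamma>_nonneg)
  qed
qed

end
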